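(* The $\mathbf{R}^d$-valued stationary pinned string $(U_t(x): t\ge0,\ x\in\mathbf{R})$ is almost surely recurrent if $d\le 6$ and almost surely not recurrent if $d\ge 7$.
   Context: $\dot W$ is an $\mathbf{R}^d$-valued space-time white noise (independent Gaussian white noise components with covariance $E[W_i(f)W_i(g)]=\int_0^\infty\int fg\,dx\,dt$) adapted to a filtration $(\mathcal F_t)$. Let $G_t(x)=(4\pi t)^{-1/2}e^{-x^2/(4t)}$. Let $U_0$ be an $\mathcal F_0$-measurable two-sided $\mathbf{R}^d$-valued Brownian motion, independent of $W$, with independent components, $U_0(0)=0$ and $E[(U_0^{(i)}(x)-U_0^{(i)}(y))^2]=|x-y|$. The stationary pinned string is a continuous version of $U_t(x)=\int G_t(x-z)U_0(z)dz+\int_0^t\int G_{t-r}(x-z)W(dz\,dr)$. For $\delta>0$, $B_\delta(0)=\{y\in\mathbf{R}^d: |y_i|<\delta \text{ for all } i\}$. A continuous function $(f_t(x): t\ge0,x\in\mathbf{R})$ is recurrent if for every $\delta>0$ there exist sequences $(x_n)$, $(t_n)$ with $t_n\to\infty$ and $f_{t_n}(x_n)\in B_\delta(0)$ for all $n$. *)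

theory Defs
  imports "HOL-Probability.Probability"
begin

definition heat_kernel :: "real \<Rightarrow> real \<Rightarrow> real" where
  "heat_kernel t x = exp (- (x^2) / (4 * t)) / sqrt (4 * pi * t)"

definition st_inner :: "(real \<times> real \<Rightarrow> real) \<Rightarrow> (real \<times> real \<Rightarrow> real) \<Rightarrow> real" where
  "st_inner f g = (LINT p|lborel. indicator ({0..} \<times> UNIV) p * f p * g p)"

definition st_L2 :: "(real \<times> real \<Rightarrow> real) \<Rightarrow> bool" where
  "st_L2 f \<longleftrightarrow> f \<in> borel_measurable lborel \<and>
     integrable lborel (\<lambda>p. indicator ({0..} \<times> UNIV) p * (f p)^2)"

text \<open>R^d-valued space-time white noise on [0,infinity) x R: W i f is the Wiener integral of
  f against the i-th component.  Jointly centered Gaussian family with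
  E[W_i(f) W_j(g)] = [i=j] * int_0^infinity int f g, stated via characteristic functions
  of finite linear combinations (this also gives independence of the components).\<close>
definition white_noise ::
  "'w measure \<Rightarrow> ('d \<Rightarrow> (real \<times> real \<Rightarrow> real) \<Rightarrow> 'w \<Rightarrow> real) \<Rightarrow> bool" where
  "white_noise M W \<longleftrightarrow>
     (\<forall>i f. st_L2 f \<longrightarrow> W i f \<in> borel_measurable M) \<and>
     (\<forall>(n::nat) (c::nat \<Rightarrow> real) (ii::nat \<Rightarrow> 'd) ff.
        (\<forall>k<n. st_L2 (ff k)) \<longrightarrow>
        (\<integral>\<omega>. iexp (\<Sum>k<n. c k * W (ii k) (ff k) \<omega>) \<partial>M) =
        complex_of_real (exp (- (\<Sum>k<n. \<Sum>l<n. c k * c l *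
            (if ii k = ii l then st_inner (ff k) (ff l) else 0)) / 2)))"

text \<open>Two-sided R^d-valued Brownian motion with independent components, B(0)=0,
  E[(B_i(x)-B_i(y))^2] = |x-y|: continuous paths and centered Gaussian with covariance
  E[B_i(x) B_j(y)] = [i=j] (|x|+|y|-|x-y|)/2.\<close>
definition two_sided_BM :: "'w measure \<Rightarrow> ('w \<Rightarrow> real \<Rightarrow> real ^ 'd) \<Rightarrow> bool" where
  "two_sided_BM M B \<longleftrightarrow>
     (\<forall>x. (\<lambda>\<omega>. B \<omega> x) \<in> borel_measurable M) \<and>
     (AE \<omega> in M. continuous_on UNIV (B \<omega>)) \<and>
     (\<forall>(n::nat) (c::nat \<Rightarrow> real) (jj::nat \<Rightarrow> 'd) (ys::nat \<Rightarrow> real).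
        (\<integral>\<omega>. iexp (\<Sum>k<n. c k * B \<omega> (ys k) $ jj k) \<partial>M) =
        complex_of_real (exp (- (\<Sum>k<n. \<Sum>l<n. c k * c l *
            (if jj k = jj l then (\<bar>ys k\<bar> + \<bar>ys l\<bar> - \<bar>ys k - ys l\<bar>) / 2 else 0)) / 2)))"

definition sigma_W :: "'w measure \<Rightarrow> ('d \<Rightarrow> (real \<times> real \<Rightarrow> real) \<Rightarrow> 'w \<Rightarrow> real)
    \<Rightarrow> ((real \<times> real \<Rightarrow> real) \<Rightarrow> bool) \<Rightarrow> 'w set set" where
  "sigma_W M W P = sigma_sets (space M)
     {{\<omega> \<in> space M. W i f \<omega> \<in> A} | i f A. st_L2 f \<and> P f \<and> A \<in> sets borel}"

definition sigma_U0 :: "'w measure \<Rightarrow> ('w \<Rightarrow> real \<Rightarrow> real ^ 'd) \<Rightarrow> 'w set set" where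
  "sigma_U0 M B = sigma_sets (space M)
     {{\<omega> \<in> space M. B \<omega> x \<in> A} | x A. A \<in> sets borel}"

definition adapted_white_noise ::
  "'w measure \<Rightarrow> (real \<Rightarrow> 'w set set) \<Rightarrow> ('d \<Rightarrow> (real \<times> real \<Rightarrow> real) \<Rightarrow> 'w \<Rightarrow> real) \<Rightarrow> bool" where
  "adapted_white_noise M F W \<longleftrightarrow>
     white_noise M W \<and>
     (\<forall>t\<ge>0. sigma_algebra (space M) (F t) \<and> F t \<subseteq> sets M) \<and>
     (\<forall>s t. 0 \<le> s \<longrightarrow> s \<le> t \<longrightarrow> F s \<subseteq> F t) \<and>
     (\<forall>t\<ge>0. sigma_W M W (\<lambda>f. \<forall>r z. r > t \<longrightarrow> f (r, z) = 0) \<subseteq> F t) \<and>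
     (\<forall>t\<ge>0. prob_space.indep_set M (F t) (sigma_W M W (\<lambda>f. \<forall>r z. r \<le> t \<longrightarrow> f (r, z) = 0)))"

definition stoch_conv_kernel :: "real \<Rightarrow> real \<Rightarrow> real \<times> real \<Rightarrow> real" where
  "stoch_conv_kernel t x = (\<lambda>(r, z). if 0 \<le> r \<and> r < t then heat_kernel (t - r) (x - z) else 0)"

definition heat_part :: "(real \<Rightarrow> real ^ 'd) \<Rightarrow> real \<Rightarrow> real \<Rightarrow> real ^ 'd" where
  "heat_part u0 t x = (if t = 0 then u0 x else (LINT z|lborel. heat_kernel t (x - z) *\<^sub>R u0 z))"

definition pinned_string_version ::
  "'w measure \<Rightarrow> ('w \<Rightarrow> real \<Rightarrow> real ^ 'd) \<Rightarrow> ('d \<Rightarrow> (real \<times> real \<Rightarrow> real) \<Rightarrow> 'w \<Rightarrow> real)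
    \<Rightarrow> ('w \<Rightarrow> real \<Rightarrow> real \<Rightarrow> real ^ 'd) \<Rightarrow> bool" where
  "pinned_string_version M U0 W U \<longleftrightarrow>
     (AE \<omega> in M. continuous_on ({0..} \<times> UNIV) (\<lambda>(t, x). U \<omega> t x)) \<and>
     (\<forall>t\<ge>0. \<forall>x. AE \<omega> in M. \<forall>i. U \<omega> t x $ i =
         heat_part (U0 \<omega>) t x $ i + W i (stoch_conv_kernel t x) \<omega>)"

definition box_nbhd :: "real \<Rightarrow> (real ^ 'd) set" where
  "box_nbhd \<delta> = {y. \<forall>i. \<bar>y $ i\<bar> < \<delta>}"

definition recurrent :: "(real \<Rightarrow> real \<Rightarrow> real ^ 'd) \<Rightarrow> bool" where
  "recurrent f \<longleftrightarrow> (\<forall>\<delta>>0. \<exists>xs ts :: nat \<Rightarrow> real.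
      (\<forall>n. ts n \<ge> 0) \<and> filterlim ts at_top sequentially \<and>
      (\<forall>n. f (ts n) (xs n) \<in> box_nbhd \<delta>))"

end

theory Submission
  imports Defs
begin

text \<open>
  The string is a Gaussian field: a point \<open>(t, x)\<close> has variance of order \<open>r = |x| + sqrt t\<close>, and the
  variance of an increment is of order \<open>|x - y| + sqrt |t - s|\<close>. A unit box at parabolic distance \<open>r\<close> is
  thus hit with probability about \<open>r powr (- d / 2)\<close>, and there are about \<open>r\<^sup>2 dr\<close> such boxes: the sum of
  the probabilities converges iff \<open>d > 6\<close>.

  For \<open>d \<ge> 7\<close> the Borel-Cantelli lemma gives transience; inside a box the string is controlled by chaining.

  For \<open>d \<le> 6\<close> replace the indicator of hitting the box by the Gaussian bump
  \<open>exp (- |V|\<^sup>2 / (2 \<eta>\<^sup>2))\<close>, whose first and second moments are explicit determinants, and average the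
  normalised bumps over a grid at scale \<open>2 ^ k\<close>. These averages have mean 1 and second moment \<open>O(k)\<close>, and
  they are asymptotically uncorrelated for distant scales, so their sum with weights \<open>1 / k\<close> concentrates
  around its diverging mean. Off the box of size \<open>\<delta>\<close> the bumps carry only a fraction
  \<open>O(exp (- \<delta>\<^sup>2 / (4 \<eta>\<^sup>2)))\<close> of that mean; letting \<open>\<eta>\<close> tend to 0 shows that the box is hit.
\<close>

section \<open>Centered Gaussian variables\<close>

text \<open>In the critical dimension 6 the expected number of late hits diverges only
  logarithmically, and the average over one scale has second moment of order k, which by itself
  gives a hit with probability of order 1 / k only. The weights 1 / k cure this: the diagonal terms
  add up to a harmonic sum H, whereas the squared mean is H^2. Keeping only scales that are
  multiples of a large L brings the mean products of all distinct pairs uniformly close to 1. The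
  parameters are chosen in the order \<eta>, L, number of scales, and the probability of no late hit
  comes out below every positive number, so that no zero-one law is called for. The second moment
  requires that the value at one point is not nearly determined by the value at another. The noise
  alone ensures this: through fresh noise if the time gap dominates, through the near orthogonality
  of separated heat kernels otherwise. For recurrence integer points of space-time suffice.
  Transience has to exclude all real points of a whole time slab, which is unbounded in space; hence
  the chaining and the summation over boxes in both directions.\<close>

lemma prob_space_std_normal: "prob_space std_normal_distribution"
  by (rule prob_space_normal_density) simp

definition centered_gaussian :: "'a measure \<Rightarrow> real \<Rightarrow> ('a \<Rightarrow> real) \<Rightarrow> bool" where
  "centered_gaussian M v X \<longleftrightarrow> X \<in> borel_measurable M \<and> 0 \<le> v \<and>
     (\<forall>t. (\<integral>\<omega>. iexp (t * X \<omega>) \<partial>M) = complex_of_real (exp (- (t\<^sup>2 * v) / 2)))"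

text \<open>An image of the standard normal law, unlike a density, also describes the degenerate
  case \<open>v = 0\<close>; moments of every variance are then read off from the standard
  ones.\<close>

lemma (in prob_space) centered_gaussian_distr:
  assumes "centered_gaussian M v X"
  shows "distr M borel X = distr std_normal_distribution borel (\<lambda>x. sqrt v * x)"
proof (rule Levy_uniqueness)
  have [measurable]: "X \<in> borel_measurable M" and v: "0 \<le> v"
    using assms by (auto simp: centered_gaussian_def)
  interpret N: prob_space std_normal_distribution by (rule prob_space_std_normal)
  show "real_distribution (distr M borel X)" by (rule real_distribution_distr) simp
  show "real_distribution (distr std_normal_distribution borel (\<lambda>x. sqrt v * x))"
    by (rule N.real_distribution_distr) measurable
  show "char (distr M borel X) = char (distr std_normal_distribution borel (\<lambda>x. sqrt v * x))"
  proof
    fix t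
    have "char (distr M borel X) t = (\<integral>\<omega>. iexp (t * X \<omega>) \<partial>M)"
      unfolding char_def by (subst integral_distr) auto
    also have "\<dots> = complex_of_real (exp (- (t\<^sup>2 * v) / 2))"
      using assms by (simp add: centered_gaussian_def)
    also have "\<dots> = char std_normal_distribution (t * sqrt v)"
      by (simp add: char_std_normal_distribution power_mult_distrib v)
    also have "\<dots> = char (distr std_normal_distribution borel (\<lambda>x. sqrt v * x)) t"
      unfolding char_def by (subst integral_distr) (auto simp: mult_ac)
    finally show "char (distr M borel X) t = \<dots>" .
  qed
qed

lemma (in prob_space) centered_gaussian_moment:
  assumes "centered_gaussian M v X"
  shows "integrable M (\<lambda>\<omega>. X \<omega> ^ n)"
    and "(\<integral>\<omega>. X \<omega> ^ (2 * k) \<partial>M) = v ^ k * (fact (2 * k) / (2 ^ k * fact k))"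
proof -
  have [measurable]: "X \<in> borel_measurable M" and v: "0 \<le> v"
    using assms by (auto simp: centered_gaussian_def)
  have "integrable (distr M borel X) (\<lambda>x. x ^ n)"
    unfolding centered_gaussian_distr[OF assms]
    by (subst integrable_distr_eq)
      (auto simp: power_mult_distrib intro!: integrable_mult_right integrable_std_normal_distribution_moment)
  then show "integrable M (\<lambda>\<omega>. X \<omega> ^ n)"
    by (subst (asm) integrable_distr_eq) auto
  have "(\<integral>\<omega>. X \<omega> ^ (2 * k) \<partial>M) = (\<integral>x. x ^ (2 * k) \<partial>distr M borel X)"
    by (subst integral_distr) auto
  also have "\<dots> = (\<integral>x. sqrt v ^ (2 * k) * x ^ (2 * k) \<partial>std_normal_distribution)"
    unfolding centered_gaussian_distr[OF assms] by (subst integral_distr) (auto simp: power_mult_distrib)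
  also have "\<dots> = v ^ k * (fact (2 * k) / (2 ^ k * fact k))"
    using v by (subst integral_mult_right_zero)
      (simp only: std_normal_distribution_even_moments, simp add: power_mult)
  finally show "(\<integral>\<omega>. X \<omega> ^ (2 * k) \<partial>M) = v ^ k * (fact (2 * k) / (2 ^ k * fact k))" .
qed

lemma (in prob_space) centered_gaussian_variance:
  assumes "centered_gaussian M v X"
  shows "integrable M (\<lambda>\<omega>. (X \<omega>)\<^sup>2)" "(\<integral>\<omega>. (X \<omega>)\<^sup>2 \<partial>M) = v"
  using centered_gaussian_moment(1)[OF assms, of 2] centered_gaussian_moment(2)[OF assms, of 1]
  by (simp_all add: fact_numeral)

text \<open>Markov's inequality for the moment of order \<open>2 * k\<close>. The constant is crude,
  since later only the decay in \<open>v / a\<^sup>2\<close> matters, for one fixed large k.\<close>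

lemma (in prob_space) centered_gaussian_tail:
  assumes X: "centered_gaussian M v X" and a: "0 < a"
  shows "prob {\<omega> \<in> space M. a \<le> \<bar>X \<omega>\<bar>} \<le> fact (2 * k) * (v / a\<^sup>2) ^ k"
proof -
  have [measurable]: "X \<in> borel_measurable M" and v: "0 \<le> v"
    using X by (auto simp: centered_gaussian_def)
  have "prob {\<omega> \<in> space M. a \<le> \<bar>X \<omega>\<bar>} \<le> prob {\<omega> \<in> space M. a ^ (2 * k) \<le> X \<omega> ^ (2 * k)}"
  proof (rule finite_measure_mono)
    have "a ^ (2 * k) \<le> x ^ (2 * k)" if "a \<le> \<bar>x\<bar>" for x
      using power_mono[OF that, of "2 * k"] a by (simp add: power_even_abs)
    then show "{\<omega> \<in> space M. a \<le> \<bar>X \<omega>\<bar>} \<subseteq> {\<omega> \<in> space M. a ^ (2 * k) \<le> X \<omega> ^ (2 * k)}" by auto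
  qed measurable
  also have "\<dots> \<le> (\<integral>\<omega>. X \<omega> ^ (2 * k) \<partial>M) / a ^ (2 * k)"
    using a by (intro integral_Markov_inequality_measure[where A="space M", simplified]
        centered_gaussian_moment[OF X]) auto
  also have "\<dots> = (fact (2 * k) / (2 ^ k * fact k)) * (v / a\<^sup>2) ^ k"
    unfolding centered_gaussian_moment[OF X] by (simp add: power_divide power_mult)
  also have "\<dots> \<le> fact (2 * k) * (v / a\<^sup>2) ^ k"
  proof (rule mult_right_mono)
    have "1 * 1 \<le> 2 ^ k * (fact k :: real)" by (rule mult_mono) auto
    then show "fact (2 * k) / (2 ^ k * fact k) \<le> (fact (2 * k) :: real)"
      by (simp add: divide_le_eq mult_le_cancel_left1 del: fact_gt_zero)
  qed (use v in simp)
  finally show ?thesis .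
qed

section \<open>Expectations of exponentials of quadratic forms\<close>

lemma std_normal_exp_quadratic:
  fixes a b :: real
  assumes a: "0 < 1 + a"
  shows "has_bochner_integral std_normal_distribution (\<lambda>n. exp (b * n - a * n\<^sup>2 / 2))
           (exp (b\<^sup>2 / (2 * (1 + a))) / sqrt (1 + a))"
proof -
  let ?m = "b / (1 + a)" and ?s = "1 / sqrt (1 + a)" and ?C = "exp (b\<^sup>2 / (2 * (1 + a))) / sqrt (1 + a)"
  have eq: "std_normal_density n * exp (b * n - a * n\<^sup>2 / 2) = ?C * normal_density ?m ?s n" for n
  proof -
    have e: "- n\<^sup>2 / 2 + (b * n - a * n\<^sup>2 / 2) = b\<^sup>2 / (2 * (1 + a)) + - (n - ?m)\<^sup>2 / (2 * ?s\<^sup>2)"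
    proof -
      have s2: "?s\<^sup>2 = 1 / (1 + a)" using a by (simp add: power_divide)
      have "(1 + a) * (n - ?m)\<^sup>2 = (1 + a) * n\<^sup>2 - 2 * b * n + b\<^sup>2 / (1 + a)"
      proof -
        have "(1 + a) * ?m = b" using a by simp
        then have "(1 + a) * (n - ?m)\<^sup>2 = (1 + a) * n\<^sup>2 - 2 * b * n + b * ?m"
          using a by (simp add: power2_diff right_diff_distrib distrib_left) (simp add:
              power2_eq_square mult.assoc[symmetric])
        then show ?thesis by (simp add: power2_eq_square)
      qed
      then have "(n - ?m)\<^sup>2 / (2 * ?s\<^sup>2) = ((1 + a) * n\<^sup>2 - 2 * b * n + b\<^sup>2 / (1 + a)) / 2"
        unfolding s2 by (simp add: mult.commute)
      then show ?thesis by (simp add: add_divide_distrib diff_divide_distrib distrib_right)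
    qed
    have s: "sqrt (2 * pi * ?s\<^sup>2) = sqrt (2 * pi) / sqrt (1 + a)"
      using a by (simp add: power_divide real_sqrt_divide)
    show ?thesis
      using arg_cong[OF e, of exp] a
      unfolding std_normal_density_def normal_density_def s exp_add by (simp add: mult.assoc)
  qed
  have "has_bochner_integral lborel (\<lambda>n. ?C * normal_density ?m ?s n) (?C * 1)"
    using a by (intro has_bochner_integral_mult_right) (auto simp: has_bochner_integral_iff)
  then have "has_bochner_integral lborel (\<lambda>n. std_normal_density n *\<^sub>R exp (b * n - a * n\<^sup>2 / 2)) ?C"
    unfolding eq real_scaleR_def by simp
  then show ?thesis
    by (intro has_bochner_integral_density) auto
qed

text \<open>The one-variable formula is applied twice. The quantity under the root is the
  determinant of the identity plus the covariance matrix with entries v, c, c, v'. The condition on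
  c makes the quadratic form nonnegative, so the integrand is at most 1 and Fubini applies.\<close>

lemma std_normal_pair_exp_quadratic:
  fixes v v' c :: real
  assumes v: "0 \<le> v" "0 \<le> v'" and c: "c\<^sup>2 \<le> v * v'"
  defines "f \<equiv> \<lambda>z::real \<times> real. exp (- ((fst z)\<^sup>2 * v + 2 * fst z * snd z * c + (snd z)\<^sup>2 * v') / 2)"
  shows "has_bochner_integral (std_normal_distribution \<Otimes>\<^sub>M std_normal_distribution) f
     (1 / sqrt ((1 + v) * (1 + v') - c\<^sup>2))"
proof -
  interpret N: prob_space std_normal_distribution by (rule prob_space_std_normal)
  interpret P: pair_prob_space std_normal_distribution std_normal_distribution by standard
  have [measurable]: "f \<in> borel_measurable (std_normal_distribution \<Otimes>\<^sub>M std_normal_distribution)"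
    unfolding f_def by measurable
  have Q: "0 \<le> x\<^sup>2 * v + 2 * x * y * c + y\<^sup>2 * v'" for x y
  proof -
    have "\<bar>c\<bar> \<le> sqrt v * sqrt v'"
      using real_sqrt_le_mono[OF c] by (simp add: real_sqrt_mult)
    then have "\<bar>x * y\<bar> * \<bar>c\<bar> \<le> \<bar>x * y\<bar> * (sqrt v * sqrt v')" by (rule mult_left_mono) simp
    then have "- (2 * x * y * c) \<le> 2 * (\<bar>x\<bar> * sqrt v) * (\<bar>y\<bar> * sqrt v')"
      using abs_ge_minus_self[of "x * y * c"] by (simp add: abs_mult mult_ac)
    also have "\<dots> \<le> (\<bar>x\<bar> * sqrt v)\<^sup>2 + (\<bar>y\<bar> * sqrt v')\<^sup>2" by (rule sum_squares_bound)
    also have "\<dots> = x\<^sup>2 * v + y\<^sup>2 * v'" using v by (simp add: power_mult_distrib)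
    finally show ?thesis by simp
  qed
  have int: "integrable (std_normal_distribution \<Otimes>\<^sub>M std_normal_distribution) f"
  proof (rule P.integrable_const_bound[where B=1])
    have "norm (f z) \<le> 1" for z using Q[of "fst z" "snd z"] by (simp add: f_def)
    then show "AE z in std_normal_distribution \<Otimes>\<^sub>M std_normal_distribution. norm (f z) \<le> 1" by simp
  qed simp
  have in1: "(\<integral>y. f (x, y) \<partial>std_normal_distribution)
      = exp (0 * x - (v - c\<^sup>2 / (1 + v')) * x\<^sup>2 / 2) / sqrt (1 + v')" for x
  proof -
    have "(\<integral>y. f (x, y) \<partial>std_normal_distribution)
      = (\<integral>y. exp (- x\<^sup>2 * v / 2) * exp ((- x * c) * y - v' * y\<^sup>2 / 2) \<partial>std_normal_distribution)"
      unfolding f_def by (intro Bochner_Integration.integral_cong)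
        (auto simp: field_simps simp flip: exp_add)
    also have "\<dots> = exp (- x\<^sup>2 * v / 2) * (exp ((- x * c)\<^sup>2 / (2 * (1 + v'))) / sqrt (1 + v'))"
      using std_normal_exp_quadratic[of v' "- x * c"] v
      by (simp add: has_bochner_integral_iff)
    also have "\<dots> = exp (0 * x - (v - c\<^sup>2 / (1 + v')) * x\<^sup>2 / 2) / sqrt (1 + v')"
      using v by (simp add: field_simps flip: exp_add)
    finally show ?thesis .
  qed
  have "c\<^sup>2 / (1 + v') \<le> v"
    using c v by (simp add: divide_le_eq) (metis add.commute add_increasing2 distrib_left mult.right_neutral)
  then have pos: "0 < 1 + (v - c\<^sup>2 / (1 + v'))" by simp
  have "integral\<^sup>L (std_normal_distribution \<Otimes>\<^sub>M std_normal_distribution) f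
     = (\<integral>x. exp (0 * x - (v - c\<^sup>2 / (1 + v')) * x\<^sup>2 / 2) / sqrt (1 + v') \<partial>std_normal_distribution)"
    unfolding P.integral_fst'[OF int, symmetric] in1 ..
  also have "\<dots> = (1 / sqrt (1 + (v - c\<^sup>2 / (1 + v')))) / sqrt (1 + v')"
    using std_normal_exp_quadratic[OF pos, of 0] by (simp add: has_bochner_integral_iff)
  also have "\<dots> = 1 / sqrt ((1 + (v - c\<^sup>2 / (1 + v'))) * (1 + v'))" by (simp add: real_sqrt_mult)
  also have "(1 + (v - c\<^sup>2 / (1 + v'))) * (1 + v') = (1 + v) * (1 + v') - c\<^sup>2"
    using v by (simp add: field_simps)
  finally show ?thesis using int by (simp add: has_bochner_integral_iff)
qed

text \<open>Writing \<open>exp (- x\<^sup>2 / 2)\<close> as a characteristic function and exchanging the integrals uses the joint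
  characteristic function alone, so no multivariate uniqueness theorem is needed.\<close>
lemma (in prob_space) expectation_prod_exp_square:
  fixes X Y :: "'d::finite \<Rightarrow> 'a \<Rightarrow> real"
  assumes X[measurable]: "\<And>i. X i \<in> borel_measurable M" and Y[measurable]: "\<And>i. Y i \<in> borel_measurable M"
    and v: "0 \<le> v" "0 \<le> v'" and c: "c\<^sup>2 \<le> v * v'"
    and char: "\<And>a b. (\<integral>\<omega>. iexp (\<Sum>i\<in>UNIV. a i * X i \<omega> + b i * Y i \<omega>) \<partial>M)
      = complex_of_real (exp (- (\<Sum>i\<in>UNIV. (a i)\<^sup>2 * v + 2 * a i * b i * c + (b i)\<^sup>2 * v') / 2))"
  shows "(\<integral>\<omega>. (\<Prod>i\<in>UNIV. exp (- ((X i \<omega>)\<^sup>2 + (Y i \<omega>)\<^sup>2) / 2)) \<partial>M)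
    = (1 / sqrt ((1 + v) * (1 + v') - c\<^sup>2)) ^ CARD('d)"
proof -
  let ?N = "std_normal_distribution"
  let ?N2 = "?N \<Otimes>\<^sub>M ?N"
  interpret N: prob_space ?N by (rule prob_space_std_normal)
  interpret N2: pair_prob_space ?N ?N by standard
  interpret PS: product_prob_space "\<lambda>_::'d. ?N2" by standard
  define P where "P = Pi\<^sub>M (UNIV::'d set) (\<lambda>_. ?N2)"
  interpret P: prob_space P unfolding P_def by (rule prob_space_PiM) (rule N2.prob_space_axioms)
  interpret MP: pair_prob_space M P by standard
  have comp: "(\<lambda>z. z i) \<in> P \<rightarrow>\<^sub>M borel \<Otimes>\<^sub>M borel" for i
  proof -
    have "(\<lambda>z. z i) \<in> P \<rightarrow>\<^sub>M ?N2" unfolding P_def by (rule measurable_component_singleton) simp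
    moreover have "sets ?N2 = sets (borel \<Otimes>\<^sub>M borel)" by (rule sets_pair_measure_cong) auto
    ultimately show ?thesis using measurable_cong_sets[of P P ?N2 "borel \<Otimes>\<^sub>M borel"] by simp
  qed
  have [measurable]: "(\<lambda>z. fst (z i)) \<in> borel_measurable P" "(\<lambda>z. snd (z i)) \<in> borel_measurable P" for i
    using measurable_compose[OF comp measurable_fst] measurable_compose[OF comp measurable_snd] by auto
  define f where "f x y z = iexp (fst z * x + snd z * y)" for x y :: real and z :: "real \<times> real"
  have [measurable]: "f x y \<in> borel_measurable ?N2" for x y
    unfolding f_def by measurable
  have f_int: "integrable ?N2 (f x y)" for x y
    by (rule N2.integrable_const_bound[where B=1]) (auto simp: f_def)
  have f_char: "integral\<^sup>L ?N2 (f x y) = complex_of_real (exp (- (x\<^sup>2 + y\<^sup>2) / 2))" for x y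
  proof -
    have "integral\<^sup>L ?N2 (f x y) = (\<integral>n. (\<integral>m. f x y (n, m) \<partial>?N) \<partial>?N)"
      by (rule N2.integral_fst'[OF f_int, symmetric])
    also have "\<dots> = (\<integral>n. (\<integral>m. iexp (n * x) * iexp (m * y) \<partial>?N) \<partial>?N)"
      by (simp add: f_def distrib_left exp_add)
    also have "\<dots> = (\<integral>n. iexp (x * n) \<partial>?N) * (\<integral>m. iexp (y * m) \<partial>?N)"
      by (simp add: mult.commute)
    also have "\<dots> = char ?N x * char ?N y" by (simp add: char_def)
    also have "\<dots> = complex_of_real (exp (- (x\<^sup>2 + y\<^sup>2) / 2))"
      by (simp add: char_std_normal_distribution diff_divide_distrib flip: exp_add of_real_mult)
    finally show ?thesis .
  qed
  let ?g = "\<lambda>\<omega> z. iexp (\<Sum>i\<in>UNIV. fst (z i) * X i \<omega> + snd (z i) * Y i \<omega>)"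
  have g_prod: "?g \<omega> z = (\<Prod>i\<in>UNIV. f (X i \<omega>) (Y i \<omega>) (z i))" for \<omega> z
    by (simp add: f_def exp_sum sum_distrib_left)
  have inner: "(\<integral>z. ?g \<omega> z \<partial>P) = (\<Prod>i\<in>UNIV. complex_of_real (exp (- ((X i \<omega>)\<^sup>2 + (Y i \<omega>)\<^sup>2) / 2)))" for \<omega>
    unfolding g_prod P_def
    by (subst PS.product_integral_prod[OF finite f_int]) (simp only: f_char)
  define h where "h z = exp (- ((fst z)\<^sup>2 * v + 2 * fst z * snd z * c + (snd z)\<^sup>2 * v') / 2)"
      for z :: "real \<times> real"
  have h: "has_bochner_integral ?N2 h (1 / sqrt ((1 + v) * (1 + v') - c\<^sup>2))"
    unfolding h_def using std_normal_pair_exp_quadratic[OF v c] .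
  have "complex_of_real (\<integral>\<omega>. (\<Prod>i\<in>UNIV. exp (- ((X i \<omega>)\<^sup>2 + (Y i \<omega>)\<^sup>2) / 2)) \<partial>M)
      = (\<integral>\<omega>. (\<integral>z. ?g \<omega> z \<partial>P) \<partial>M)"
    unfolding inner of_real_prod[symmetric] integral_complex_of_real ..
  also have "\<dots> = (\<integral>z. (\<integral>\<omega>. ?g \<omega> z \<partial>M) \<partial>P)"
    by (rule MP.Fubini_integral[symmetric], rule MP.integrable_const_bound[where B=1]) auto
  also have "\<dots> = (\<integral>z. complex_of_real (\<Prod>i\<in>UNIV. h (z i)) \<partial>P)"
  proof (intro Bochner_Integration.integral_cong refl)
    fix z :: "'d \<Rightarrow> real \<times> real"
    have "- (\<Sum>i\<in>UNIV. q i) / 2 = (\<Sum>i\<in>UNIV. - q i / 2)" for q :: "'d \<Rightarrow> real"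
      by (simp add: sum_negf sum_divide_distrib)
    then show "(\<integral>\<omega>. ?g \<omega> z \<partial>M) = complex_of_real (\<Prod>i\<in>UNIV. h (z i))"
      unfolding char h_def by (simp only: exp_sum[OF finite])
  qed
  also have "\<dots> = complex_of_real (\<integral>z. (\<Prod>i\<in>UNIV. h (z i)) \<partial>P)" by (rule integral_complex_of_real)
  also have "(\<integral>z. (\<Prod>i\<in>UNIV. h (z i)) \<partial>P) = (\<Prod>i\<in>(UNIV::'d set). integral\<^sup>L ?N2 h)"
    unfolding P_def by (rule PS.product_integral_prod) (use h in \<open>auto simp: has_bochner_integral_iff\<close>)
  also have "\<dots> = (1 / sqrt ((1 + v) * (1 + v') - c\<^sup>2)) ^ CARD('d)"
    using h by (simp add: has_bochner_integral_iff)
  finally show ?thesis by (simp only: of_real_eq_iff)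
qed

section \<open>Cauchy-Schwarz and L2 limits of Gaussian variables\<close>

lemma integral_cauchy_schwarz:
  fixes f g :: "'a \<Rightarrow> real"
  assumes [measurable]: "f \<in> borel_measurable M" "g \<in> borel_measurable M"
    and f: "integrable M (\<lambda>x. (f x)\<^sup>2)" and g: "integrable M (\<lambda>x. (g x)\<^sup>2)"
  shows "integrable M (\<lambda>x. f x * g x)"
    and "(\<integral>x. f x * g x \<partial>M)\<^sup>2 \<le> (\<integral>x. (f x)\<^sup>2 \<partial>M) * (\<integral>x. (g x)\<^sup>2 \<partial>M)"
proof -
  show fg: "integrable M (\<lambda>x. f x * g x)"
  proof (rule Bochner_Integration.integrable_bound)
    show "integrable M (\<lambda>x. (f x)\<^sup>2 + (g x)\<^sup>2)" using f g by simp
    have "\<bar>a * b\<bar> \<le> a\<^sup>2 + b\<^sup>2" for a b :: real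
    proof -
      have "2 * \<bar>a * b\<bar> \<le> a\<^sup>2 + b\<^sup>2"
        using sum_squares_bound[of "\<bar>a\<bar>" "\<bar>b\<bar>"] by (simp add: abs_mult)
      then show ?thesis using abs_ge_zero[of "a * b"] by linarith
    qed
    then show "AE x in M. norm (f x * g x) \<le> norm ((f x)\<^sup>2 + (g x)\<^sup>2)" by simp
  qed measurable
  define A B C where "A = (\<integral>x. (f x)\<^sup>2 \<partial>M)" "B = (\<integral>x. f x * g x \<partial>M)" "C = (\<integral>x. (g x)\<^sup>2 \<partial>M)"
  have q: "0 \<le> A - 2 * c * B + c\<^sup>2 * C" for c
  proof -
    have "0 \<le> (\<integral>x. (f x - c * g x)\<^sup>2 \<partial>M)" by simp
    also have "\<dots> = (\<integral>x. (f x)\<^sup>2 - 2 * c * (f x * g x) + c\<^sup>2 * (g x)\<^sup>2 \<partial>M)"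
      by (intro Bochner_Integration.integral_cong) (auto simp: power2_diff power_mult_distrib)
    also have "\<dots> = A - 2 * c * B + c\<^sup>2 * C" using f g fg by (simp add: A_B_C_def)
    finally show ?thesis .
  qed
  have "0 \<le> C" unfolding A_B_C_def by simp
  have "B\<^sup>2 \<le> A * C"
  proof (cases "C = 0")
    case True
    have "B = 0"
    proof (rule ccontr)
      assume "B \<noteq> 0"
      \<comment> \<open>With \<open>C = 0\<close> the quadratic is affine in c; this c gives it the
        value -1.\<close>
      then show False using q[of "(A + 1) / (2 * B)"] True by simp
    qed
    then show ?thesis using True by simp
  next
    case False
    then have "0 \<le> C * (A - 2 * (B / C) * B + (B / C)\<^sup>2 * C)"
      using q[of "B / C"] \<open>0 \<le> C\<close> by simp
    also have "\<dots> = A * C - B\<^sup>2" using False by (simp add: field_simps power2_eq_square)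
    finally show ?thesis by simp
  qed
  then show "(\<integral>x. f x * g x \<partial>M)\<^sup>2 \<le> (\<integral>x. (f x)\<^sup>2 \<partial>M) * (\<integral>x. (g x)\<^sup>2 \<partial>M)" by (simp add: A_B_C_def)
qed

lemma (in prob_space) integral_square_le:
  assumes [measurable]: "f \<in> borel_measurable M" and f: "integrable M (\<lambda>x. (f x)\<^sup>2)"
  shows "integrable M f" "(\<integral>x. f x \<partial>M)\<^sup>2 \<le> (\<integral>x. (f x :: real)\<^sup>2 \<partial>M)"
  using integral_cauchy_schwarz[of f M "\<lambda>_. 1"] f by (simp_all add: prob_space)

text \<open>Variances converge by Cauchy-Schwarz, and characteristic functions converge because the
  map from x to \<open>iexp (t * x)\<close> is Lipschitz with constant
  \<open>\<bar>t\<bar>\<close>.\<close>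

lemma (in prob_space) centered_gaussian_L2_limit:
  assumes X: "\<And>n. centered_gaussian M (v n) (X n)" and Y[measurable]: "Y \<in> borel_measurable M"
    and int: "\<And>n. integrable M (\<lambda>\<omega>. (X n \<omega> - Y \<omega>)\<^sup>2)"
    and lim: "(\<lambda>n. \<integral>\<omega>. (X n \<omega> - Y \<omega>)\<^sup>2 \<partial>M) \<longlonglongrightarrow> 0"
  shows "centered_gaussian M (\<integral>\<omega>. (Y \<omega>)\<^sup>2 \<partial>M) Y"
proof -
  have [measurable]: "X n \<in> borel_measurable M" for n using X by (auto simp: centered_gaussian_def)
  define e where "e n = (\<integral>\<omega>. (X n \<omega> - Y \<omega>)\<^sup>2 \<partial>M)" for n
  have e0: "0 \<le> e n" for n by (simp add: e_def)
  have X2: "integrable M (\<lambda>\<omega>. (X n \<omega>)\<^sup>2)" "(\<integral>\<omega>. (X n \<omega>)\<^sup>2 \<partial>M) = v n" for n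
    using centered_gaussian_variance[OF X] by auto
  have XD: "integrable M (\<lambda>\<omega>. X n \<omega> * (X n \<omega> - Y \<omega>))" for n
    by (rule integral_cauchy_schwarz) (auto simp: X2 int)
  have Yeq: "(Y \<omega>)\<^sup>2 = (X n \<omega> - Y \<omega>)\<^sup>2 - 2 * (X n \<omega> * (X n \<omega> - Y \<omega>)) + (X n \<omega>)\<^sup>2" for n \<omega>
    by (simp add: power2_eq_square algebra_simps)
  have Y2: "integrable M (\<lambda>\<omega>. (Y \<omega>)\<^sup>2)"
    unfolding Yeq[of _ 0] using X2 XD int by simp
  have YD: "integrable M (\<lambda>\<omega>. Y \<omega> * (X n \<omega> - Y \<omega>))"
    and YD2: "(\<integral>\<omega>. Y \<omega> * (X n \<omega> - Y \<omega>) \<partial>M)\<^sup>2 \<le> (\<integral>\<omega>. (Y \<omega>)\<^sup>2 \<partial>M) * e n" for n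
    using integral_cauchy_schwarz[of Y M "\<lambda>\<omega>. X n \<omega> - Y \<omega>"] Y2 int by (auto simp: e_def)
  have elim: "e \<longlonglongrightarrow> 0" using lim by (simp add: e_def[abs_def])
  have YDlim: "(\<lambda>n. \<integral>\<omega>. Y \<omega> * (X n \<omega> - Y \<omega>) \<partial>M) \<longlonglongrightarrow> 0"
  proof (rule Lim_null_comparison)
    show "\<forall>\<^sub>F n in sequentially. norm (\<integral>\<omega>. Y \<omega> * (X n \<omega> - Y \<omega>) \<partial>M) \<le> sqrt ((\<integral>\<omega>. (Y \<omega>)\<^sup>2 \<partial>M) * e n)"
      using real_sqrt_le_mono[OF YD2] by simp
    show "(\<lambda>n. sqrt ((\<integral>\<omega>. (Y \<omega>)\<^sup>2 \<partial>M) * e n)) \<longlonglongrightarrow> 0"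
      using tendsto_real_sqrt[OF tendsto_mult_left[OF elim, of "\<integral>\<omega>. (Y \<omega>)\<^sup>2 \<partial>M"]] by simp
  qed
  have "v n = e n + 2 * (\<integral>\<omega>. Y \<omega> * (X n \<omega> - Y \<omega>) \<partial>M) + (\<integral>\<omega>. (Y \<omega>)\<^sup>2 \<partial>M)" for n
  proof -
    have "(\<integral>\<omega>. (X n \<omega>)\<^sup>2 \<partial>M) = (\<integral>\<omega>. (X n \<omega> - Y \<omega>)\<^sup>2 + 2 * (Y \<omega> * (X n \<omega> - Y \<omega>)) + (Y \<omega>)\<^sup>2 \<partial>M)"
      by (intro Bochner_Integration.integral_cong) (auto simp: power2_eq_square algebra_simps)
    then show ?thesis using int YD Y2 by (simp add: X2 e_def)
  qed
  then have "v = (\<lambda>n. e n + 2 * (\<integral>\<omega>. Y \<omega> * (X n \<omega> - Y \<omega>) \<partial>M) + (\<integral>\<omega>. (Y \<omega>)\<^sup>2 \<partial>M))" by auto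
  moreover have "\<dots> \<longlonglongrightarrow> 0 + 2 * 0 + (\<integral>\<omega>. (Y \<omega>)\<^sup>2 \<partial>M)"
    by (intro tendsto_intros elim YDlim)
  ultimately have vlim: "v \<longlonglongrightarrow> (\<integral>\<omega>. (Y \<omega>)\<^sup>2 \<partial>M)" by simp
  have "(\<integral>\<omega>. iexp (t * Y \<omega>) \<partial>M) = complex_of_real (exp (- (t\<^sup>2 * (\<integral>\<omega>. (Y \<omega>)\<^sup>2 \<partial>M)) / 2))" for t
  proof (rule LIMSEQ_unique)
    have "(\<lambda>n. complex_of_real (exp (- (t\<^sup>2 * v n) / 2)))
        \<longlonglongrightarrow> complex_of_real (exp (- (t\<^sup>2 * (\<integral>\<omega>. (Y \<omega>)\<^sup>2 \<partial>M)) / 2))"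
      by (intro tendsto_intros vlim) simp
    also have "(\<lambda>n. complex_of_real (exp (- (t\<^sup>2 * v n) / 2))) = (\<lambda>n. \<integral>\<omega>. iexp (t * X n \<omega>) \<partial>M)"
      using X by (auto simp: centered_gaussian_def)
    finally show "(\<lambda>n. \<integral>\<omega>. iexp (t * X n \<omega>) \<partial>M) \<longlonglongrightarrow> complex_of_real (exp (- (t\<^sup>2 * (\<integral>\<omega>. (Y \<omega>)\<^sup>2 \<partial>M)) / 2))" .
    show "(\<lambda>n. \<integral>\<omega>. iexp (t * X n \<omega>) \<partial>M) \<longlonglongrightarrow> (\<integral>\<omega>. iexp (t * Y \<omega>) \<partial>M)"
    proof (rule LIM_zero_cancel, rule Lim_null_comparison)
      have "norm ((\<integral>\<omega>. iexp (t * X n \<omega>) \<partial>M) - (\<integral>\<omega>. iexp (t * Y \<omega>) \<partial>M)) \<le> \<bar>t\<bar> * sqrt (e n)" for n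
      proof -
        have i: "integrable M (\<lambda>\<omega>. iexp (t * Z \<omega>))" if "Z \<in> borel_measurable M" for Z
          using that by (intro integrable_const_bound[where B=1]) auto
        have a: "integrable M (\<lambda>\<omega>. \<bar>X n \<omega> - Y \<omega>\<bar>)" "(\<integral>\<omega>. \<bar>X n \<omega> - Y \<omega>\<bar> \<partial>M)\<^sup>2 \<le> e n"
          using integral_square_le[of "\<lambda>\<omega>. \<bar>X n \<omega> - Y \<omega>\<bar>"] int by (auto simp: e_def)
        have "norm ((\<integral>\<omega>. iexp (t * X n \<omega>) \<partial>M) - (\<integral>\<omega>. iexp (t * Y \<omega>) \<partial>M))
            = norm (\<integral>\<omega>. iexp (t * X n \<omega>) - iexp (t * Y \<omega>) \<partial>M)"
          by (simp only: Bochner_Integration.integral_diff[OF i i] Y \<open>X n \<in> borel_measurable M\<close>)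
        also have "\<dots> \<le> (\<integral>\<omega>. \<bar>t\<bar> * \<bar>X n \<omega> - Y \<omega>\<bar> \<partial>M)"
        proof (rule order_trans[OF integral_norm_bound integral_mono])
          show "integrable M (\<lambda>\<omega>. \<bar>t\<bar> * \<bar>X n \<omega> - Y \<omega>\<bar>)" using a by simp
          show "integrable M (\<lambda>\<omega>. norm (iexp (t * X n \<omega>) - iexp (t * Y \<omega>)))"
            by (intro integrable_norm Bochner_Integration.integrable_diff i) auto
          show "norm (iexp (t * X n \<omega>) - iexp (t * Y \<omega>)) \<le> \<bar>t\<bar> * \<bar>X n \<omega> - Y \<omega>\<bar>" for \<omega>
          proof -
            have "iexp (t * X n \<omega>) - iexp (t * Y \<omega>) = iexp (t * Y \<omega>) * (iexp (t * (X n \<omega> - Y \<omega>)) - 1)"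
              by (simp add: algebra_simps flip: exp_add)
            also have "norm \<dots> = norm (iexp (t * (X n \<omega> - Y \<omega>)) - 1)"
              by (simp add: norm_mult)
            also have "\<dots> \<le> \<bar>t * (X n \<omega> - Y \<omega>)\<bar>"
              using iexp_approx1[of "t * (X n \<omega> - Y \<omega>)" 0] by simp
            finally show ?thesis by (simp add: abs_mult)
          qed
        qed
        also have "\<dots> = \<bar>t\<bar> * (\<integral>\<omega>. \<bar>X n \<omega> - Y \<omega>\<bar> \<partial>M)" by simp
        also have "\<dots> \<le> \<bar>t\<bar> * sqrt (e n)"
          by (intro mult_left_mono real_le_rsqrt a) simp
        finally show ?thesis .
      qed
      then show "\<forall>\<^sub>F n in sequentially. norm ((\<integral>\<omega>. iexp (t * X n \<omega>) \<partial>M) - (\<integral>\<omega>. iexp (t * Y \<omega>) \<partial>M))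
          \<le> \<bar>t\<bar> * sqrt (e n)"
        by simp
      show "(\<lambda>n. \<bar>t\<bar> * sqrt (e n)) \<longlonglongrightarrow> 0"
        using tendsto_mult_left[OF tendsto_real_sqrt[OF elim], of "\<bar>t\<bar>"] by simp
    qed
  qed
  then show ?thesis by (simp add: centered_gaussian_def)
qed

section \<open>The Gaussian space spanned by the noise and the Brownian motion\<close>

text \<open>The minimum of the absolute values if y and z lie on the same side of 0, and 0 if they
  lie on opposite sides.\<close>

definition bm_cov :: "real \<Rightarrow> real \<Rightarrow> real" where
  "bm_cov y z = (\<bar>y\<bar> + \<bar>z\<bar> - \<bar>y - z\<bar>) / 2"

lemma sum_list_nth_lessThan:
  "(\<Sum>p\<leftarrow>xs. f p) = (\<Sum>k<length xs. f (xs ! k))" for f :: "'b \<Rightarrow> 'c::comm_monoid_add"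
  by (simp add: sum_list_sum_nth atLeast0LessThan)

locale noise_and_bm = prob_space M for M :: "'w measure" +
  fixes W :: "'d::finite \<Rightarrow> (real \<times> real \<Rightarrow> real) \<Rightarrow> 'w \<Rightarrow> real"
    and U0 :: "'w \<Rightarrow> real \<Rightarrow> real ^ 'd"
  assumes white: "white_noise M W"
    and bm: "two_sided_BM M U0"
    and indep: "indep_set (sigma_U0 M U0) (sigma_W M W (\<lambda>f. True))"
begin

lemma W_measurable[measurable]: "st_L2 f \<Longrightarrow> W i f \<in> borel_measurable M"
  using white by (auto simp: white_noise_def)

lemma U0_measurable[measurable]: "(\<lambda>\<omega>. U0 \<omega> y) \<in> borel_measurable M"
  using bm by (auto simp: two_sided_BM_def)

lemma U0_nth_measurable[measurable]: "(\<lambda>\<omega>. U0 \<omega> y $ i) \<in> borel_measurable M"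
  by (rule measurable_compose[OF U0_measurable]) (intro borel_measurable_continuous_onI continuous_intros)

text \<open>A list holds coefficient, point and component of each term. Repetitions are allowed, so
  addition is concatenation and scaling is a map over the list.\<close>

definition bm_comb :: "(real \<times> real \<times> 'd) list \<Rightarrow> 'w \<Rightarrow> real" where
  "bm_comb xs \<omega> = (\<Sum>p\<leftarrow>xs. fst p * U0 \<omega> (fst (snd p)) $ snd (snd p))"

definition bm_comb_var :: "(real \<times> real \<times> 'd) list \<Rightarrow> real" where
  "bm_comb_var xs = (\<Sum>p\<leftarrow>xs. \<Sum>q\<leftarrow>xs. fst p * fst q *
     (if snd (snd p) = snd (snd q) then bm_cov (fst (snd p)) (fst (snd q)) else 0))"

definition noise_comb :: "(real \<times> (real \<times> real \<Rightarrow> real) \<times> 'd) list \<Rightarrow> 'w \<Rightarrow> real" where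
  "noise_comb ys \<omega> = (\<Sum>p\<leftarrow>ys. fst p * W (snd (snd p)) (fst (snd p)) \<omega>)"

definition noise_comb_var :: "(real \<times> (real \<times> real \<Rightarrow> real) \<times> 'd) list \<Rightarrow> real" where
  "noise_comb_var ys = (\<Sum>p\<leftarrow>ys. \<Sum>q\<leftarrow>ys. fst p * fst q *
     (if snd (snd p) = snd (snd q) then st_inner (fst (snd p)) (fst (snd q)) else 0))"

abbreviation "noise_list ys \<equiv> \<forall>p\<in>set ys. st_L2 (fst (snd p))"

lemma bm_comb_char: "(\<integral>\<omega>. iexp (bm_comb xs \<omega>) \<partial>M) = complex_of_real (exp (- bm_comb_var xs / 2))"
proof -
  from bm[unfolded two_sided_BM_def, THEN conjunct2, THEN conjunct2, rule_format, where n="length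
      xs" and c="\<lambda>k. fst (xs ! k)" and ys="\<lambda>k. fst (snd (xs ! k))" and jj="\<lambda>k. snd (snd (xs ! k))"]
  show ?thesis
    unfolding bm_comb_def bm_comb_var_def sum_list_nth_lessThan bm_cov_def .
qed

lemma noise_comb_char:
  assumes "noise_list ys"
  shows "(\<integral>\<omega>. iexp (noise_comb ys \<omega>) \<partial>M) = complex_of_real (exp (- noise_comb_var ys / 2))"
proof -
  from white[unfolded white_noise_def, THEN conjunct2, rule_format, where n="length ys"
      and ff="\<lambda>k. fst (snd (ys ! k))" and c="\<lambda>k. fst (ys ! k)" and ii="\<lambda>k. snd (snd (ys ! k))"] assms
  show ?thesis
    unfolding noise_comb_def noise_comb_var_def sum_list_nth_lessThan by auto
qed

lemma sum_list_measurable: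
  assumes "\<And>p. p \<in> set xs \<Longrightarrow> f p \<in> borel_measurable N"
  shows "(\<lambda>\<omega>. \<Sum>p\<leftarrow>xs. f p \<omega> :: real) \<in> borel_measurable N"
  using assms by (induction xs) auto

lemma bm_comb_measurable[measurable]: "bm_comb xs \<in> borel_measurable M"
  unfolding bm_comb_def[abs_def] by (rule sum_list_measurable) measurable

lemma noise_comb_measurable: "noise_list ys \<Longrightarrow> noise_comb ys \<in> borel_measurable M"
  unfolding noise_comb_def[abs_def] by (rule sum_list_measurable) auto

text \<open>Each combination is measurable for the sigma-algebra generated by its own family,
  rebuilt here as the measures \<open>NU\<close> and \<open>NW\<close>; independence of the two
  families therefore passes to the combinations.\<close>

lemma indep_combs:
  assumes ys: "noise_list ys"
  shows "indep_var borel (bm_comb xs) borel (noise_comb ys)"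
proof -
  define GU where "GU = {{\<omega> \<in> space M. U0 \<omega> x \<in> A} | x A. A \<in> sets borel}"
  define GW where "GW = {{\<omega> \<in> space M. W i f \<omega> \<in> A} | i f A. st_L2 f \<and> True \<and> A \<in> sets (borel ::
      real measure)}"
  have GU: "GU \<subseteq> Pow (space M)" and GW: "GW \<subseteq> Pow (space M)" by (auto simp: GU_def GW_def)
  define NU where "NU = sigma (space M) GU"
  define NW where "NW = sigma (space M) GW"
  have sU: "sets NU = sigma_U0 M U0" "space NU = space M"
    using GU by (auto simp: NU_def sigma_U0_def GU_def[symmetric])
  have "sets NW = sigma_sets (space M) GW" using GW by (simp add: NW_def)
  then have sW: "sets NW = sigma_W M W (\<lambda>f. True)"
    by (simp only: sigma_W_def GW_def)
  have spW: "space NW = space M" using GW by (simp add: NW_def)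
  have [measurable]: "(\<lambda>\<omega>. U0 \<omega> y) \<in> borel_measurable NU" for y
  proof (rule measurableI)
    fix A :: "(real ^ 'd) set" assume "A \<in> sets borel"
    then have "{\<omega> \<in> space M. U0 \<omega> y \<in> A} \<in> GU" by (auto simp: GU_def)
    also have "{\<omega> \<in> space M. U0 \<omega> y \<in> A} = (\<lambda>\<omega>. U0 \<omega> y) -` A \<inter> space NU" by (auto simp: sU)
    finally show "(\<lambda>\<omega>. U0 \<omega> y) -` A \<inter> space NU \<in> sets NU" using GU by (auto simp: NU_def)
  qed simp
  have Wm: "W i f \<in> borel_measurable NW" if "st_L2 f" for i f
  proof (rule measurableI)
    fix A :: "real set" assume "A \<in> sets borel"
    then have "{\<omega> \<in> space M. W i f \<omega> \<in> A} \<in> GW" using that by (auto simp: GW_def)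
    also have "{\<omega> \<in> space M. W i f \<omega> \<in> A} = W i f -` A \<inter> space NW" by (auto simp: spW)
    finally show "W i f -` A \<inter> space NW \<in> sets NW" using GW by (auto simp: NW_def)
  qed simp
  have [measurable]: "(\<lambda>\<omega>. U0 \<omega> y $ i) \<in> borel_measurable NU" for y i
    by (rule measurable_compose[where N=borel]) (auto intro!: borel_measurable_continuous_onI
        continuous_intros)
  have bU: "bm_comb xs \<in> borel_measurable NU"
    unfolding bm_comb_def[abs_def] by (rule sum_list_measurable) measurable
  have nW: "noise_comb ys \<in> borel_measurable NW"
    unfolding noise_comb_def[abs_def] by (rule sum_list_measurable) (use ys in \<open>auto intro!:
        borel_measurable_times Wm\<close>)
  have sub: "sigma_sets (space M) {X -` A \<inter> space M | A. A \<in> sets borel} \<subseteq> sets N"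
    if "X \<in> borel_measurable N" "space N = space M" for X :: "'w \<Rightarrow> real" and N :: "'w measure"
    unfolding that(2)[symmetric]
    by (rule sets.sigma_sets_subset) (use measurable_sets[OF that(1)] in auto)
  show ?thesis
    unfolding indep_var_eq
  proof (intro conjI)
    show "bm_comb xs \<in> borel_measurable M" "noise_comb ys \<in> borel_measurable M"
      using ys by (auto intro: noise_comb_measurable)
    show "indep_set (sigma_sets (space M) {bm_comb xs -` A \<inter> space M |A. A \<in> sets borel})
        (sigma_sets (space M) {noise_comb ys -` A \<inter> space M |A. A \<in> sets borel})"
      using indep sub[OF bU sU(2)] sub[OF nW spW] unfolding indep_set_def sU(1) sW
      by (elim indep_sets_mono_sets) (auto split: bool.splits)
  qed
qed

lemma comb_char:
  assumes ys: "noise_list ys"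
  shows "(\<integral>\<omega>. iexp (bm_comb xs \<omega> + noise_comb ys \<omega>) \<partial>M)
    = complex_of_real (exp (- (bm_comb_var xs + noise_comb_var ys) / 2))"
proof -
  note [measurable] = noise_comb_measurable[OF ys]
  have ind: "indep_var borel (iexp \<circ> bm_comb xs) borel (iexp \<circ> noise_comb ys)"
    by (rule indep_var_compose[OF indep_combs[OF ys]]) auto
  have i: "integrable M (iexp \<circ> Z)" if "Z \<in> borel_measurable M" for Z
    using that by (intro integrable_const_bound[where B=1]) (auto simp: comp_def)
  have "(\<integral>\<omega>. iexp (bm_comb xs \<omega> + noise_comb ys \<omega>) \<partial>M)
      = (\<integral>\<omega>. (iexp \<circ> bm_comb xs) \<omega> * (iexp \<circ> noise_comb ys) \<omega> \<partial>M)"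
    by (simp add: distrib_left exp_add)
  also have "\<dots> = (\<integral>\<omega>. (iexp \<circ> bm_comb xs) \<omega> \<partial>M) * (\<integral>\<omega>. (iexp \<circ> noise_comb ys) \<omega> \<partial>M)"
    by (rule indep_var_lebesgue_integral[OF ind i i]) auto
  also have "\<dots> = complex_of_real (exp (- bm_comb_var xs / 2))
      * complex_of_real (exp (- noise_comb_var ys / 2))"
    unfolding comp_def bm_comb_char noise_comb_char[OF ys] ..
  also have "\<dots> = complex_of_real (exp (- (bm_comb_var xs + noise_comb_var ys) / 2))"
    by (simp add: diff_divide_distrib flip: exp_add of_real_mult)
  finally show ?thesis .
qed

lemma comb_gaussian:
  assumes ys: "noise_list ys"
  shows "centered_gaussian M (bm_comb_var xs + noise_comb_var ys) (\<lambda>\<omega>. bm_comb xs \<omega> + noise_comb ys \<omega>)"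
proof -
  note [measurable] = noise_comb_measurable[OF ys]
  let ?v = "bm_comb_var xs + noise_comb_var ys"
  have ch: "(\<integral>\<omega>. iexp (t * (bm_comb xs \<omega> + noise_comb ys \<omega>)) \<partial>M)
      = complex_of_real (exp (- (t\<^sup>2 * ?v) / 2))" for t
  proof -
    let ?xs = "map (\<lambda>p. (t * fst p, snd p)) xs" and ?ys = "map (\<lambda>p. (t * fst p, snd p)) ys"
    have ys': "noise_list ?ys" using ys by auto
    have "bm_comb ?xs \<omega> + noise_comb ?ys \<omega> = t * (bm_comb xs \<omega> + noise_comb ys \<omega>)" for \<omega>
      by (simp add: bm_comb_def noise_comb_def comp_def mult.assoc distrib_left flip: sum_list_const_mult)
    moreover have "bm_comb_var ?xs + noise_comb_var ?ys = t\<^sup>2 * ?v"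
      by (simp add: bm_comb_var_def noise_comb_var_def comp_def distrib_left power2_eq_square
          mult_ac flip: sum_list_const_mult cong: if_cong)
    ultimately show ?thesis using comb_char[OF ys', of ?xs] by simp
  qed
  \<comment> \<open>A characteristic function has modulus at most 1, so the exponent cannot be
    positive.\<close>
  have "0 \<le> ?v"
  proof -
    have "norm (\<integral>\<omega>. iexp (1 * (bm_comb xs \<omega> + noise_comb ys \<omega>)) \<partial>M)
        \<le> (\<integral>\<omega>. norm (iexp (1 * (bm_comb xs \<omega> + noise_comb ys \<omega>))) \<partial>M)"
      by (rule integral_norm_bound)
    also have "\<dots> = (\<integral>\<omega>. 1 \<partial>M)" by (rule Bochner_Integration.integral_cong) (simp_all only: norm_exp_i_times)
    also have "\<dots> = 1" by (simp add: prob_space)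
    finally show ?thesis unfolding ch by simp
  qed
  then show ?thesis unfolding centered_gaussian_def using ch by auto
qed

section \<open>The linear span and its L2 closure\<close>

definition base_space :: "('w \<Rightarrow> real) set" where
  "base_space = {\<lambda>\<omega>. bm_comb xs \<omega> + noise_comb ys \<omega> | xs ys. noise_list ys}"

lemma base_gaussian:
  assumes "X \<in> base_space" obtains v where "centered_gaussian M v X"
  using assms comb_gaussian by (auto simp: base_space_def)

lemma base_measurable: "X \<in> base_space \<Longrightarrow> X \<in> borel_measurable M"
  by (elim base_gaussian) (simp add: centered_gaussian_def)

lemma base_add:
  assumes "X \<in> base_space" "Y \<in> base_space"
  shows "(\<lambda>\<omega>. X \<omega> + Y \<omega>) \<in> base_space"
proof -
  obtain xs ys xs' ys' where "noise_list ys" "noise_list ys'"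
    and "X = (\<lambda>\<omega>. bm_comb xs \<omega> + noise_comb ys \<omega>)" "Y = (\<lambda>\<omega>. bm_comb xs' \<omega> + noise_comb ys' \<omega>)"
    using assms by (auto simp: base_space_def)
  then have "(\<lambda>\<omega>. X \<omega> + Y \<omega>) = (\<lambda>\<omega>. bm_comb (xs @ xs') \<omega> + noise_comb (ys @ ys') \<omega>)" "noise_list (ys @ ys')"
    by (auto simp: bm_comb_def noise_comb_def algebra_simps)
  then show ?thesis unfolding base_space_def by blast
qed

lemma base_scale:
  assumes "X \<in> base_space"
  shows "(\<lambda>\<omega>. c * X \<omega>) \<in> base_space"
proof -
  obtain xs ys where "noise_list ys" "X = (\<lambda>\<omega>. bm_comb xs \<omega> + noise_comb ys \<omega>)"
    using assms by (auto simp: base_space_def)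
  then have "(\<lambda>\<omega>. c * X \<omega>) = (\<lambda>\<omega>. bm_comb (map (\<lambda>p. (c * fst p, snd p)) xs) \<omega>
      + noise_comb (map (\<lambda>p. (c * fst p, snd p)) ys) \<omega>)"
     "noise_list (map (\<lambda>p. (c * fst p, snd p)) ys)"
    by (auto simp: bm_comb_def noise_comb_def comp_def mult.assoc distrib_left simp flip: sum_list_const_mult)
  then show ?thesis unfolding base_space_def by blast
qed

lemma U0_base: "(\<lambda>\<omega>. U0 \<omega> y $ i) \<in> base_space"
proof -
  have "(\<lambda>\<omega>. U0 \<omega> y $ i) = (\<lambda>\<omega>. bm_comb [(1, y, i)] \<omega> + noise_comb [] \<omega>)"
    by (simp add: bm_comb_def noise_comb_def)
  then show ?thesis unfolding base_space_def by (intro CollectI exI conjI) auto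
qed

lemma W_base: "st_L2 f \<Longrightarrow> W i f \<in> base_space"
proof -
  assume "st_L2 f"
  moreover have "W i f = (\<lambda>\<omega>. bm_comb [] \<omega> + noise_comb [(1, f, i)] \<omega>)"
    by (simp add: bm_comb_def noise_comb_def)
  ultimately show ?thesis unfolding base_space_def by (intro CollectI exI conjI) auto
qed

lemma base_zero: "(\<lambda>\<omega>. 0) \<in> base_space"
  using base_scale[OF U0_base, of 0] by simp

lemma base_sum:
  assumes "finite I" "\<And>k. k \<in> I \<Longrightarrow> X k \<in> base_space"
  shows "(\<lambda>\<omega>. \<Sum>k\<in>I. X k \<omega>) \<in> base_space"
  using assms by (induction I rule: finite_induct) (auto intro: base_zero base_add)

text \<open>Being closed under L2 limits, this space contains the heat averages of the Brownian path.\<close>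
definition gaussian_space :: "('w \<Rightarrow> real) set" where
  "gaussian_space = {X. X \<in> borel_measurable M \<and> (\<exists>Xn. (\<forall>n. Xn n \<in> base_space) \<and>
     (\<forall>n. integrable M (\<lambda>\<omega>. (Xn n \<omega> - X \<omega>)\<^sup>2)) \<and> (\<lambda>n. \<integral>\<omega>. (Xn n \<omega> - X \<omega>)\<^sup>2 \<partial>M) \<longlonglongrightarrow> 0)}"

lemma base_gaussian_space: "X \<in> base_space \<Longrightarrow> X \<in> gaussian_space"
  unfolding gaussian_space_def
  by (intro CollectI conjI base_measurable exI[of _ "\<lambda>_. X"]) auto

lemma gaussian_space_centered:
  assumes "X \<in> gaussian_space"
  shows "centered_gaussian M (\<integral>\<omega>. (X \<omega>)\<^sup>2 \<partial>M) X"
proof -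
  obtain Xn where Xn: "\<And>n. Xn n \<in> base_space" "\<And>n. integrable M (\<lambda>\<omega>. (Xn n \<omega> - X \<omega>)\<^sup>2)"
      "(\<lambda>n. \<integral>\<omega>. (Xn n \<omega> - X \<omega>)\<^sup>2 \<partial>M) \<longlonglongrightarrow> 0" and X: "X \<in> borel_measurable M"
    using assms by (auto simp: gaussian_space_def)
  have "\<forall>n. \<exists>v. centered_gaussian M v (Xn n)" using Xn(1) base_gaussian by metis
  then obtain v where "\<And>n. centered_gaussian M (v n) (Xn n)" by metis
  from centered_gaussian_L2_limit[OF this X Xn(2,3)] show ?thesis .
qed

lemma gaussian_space_measurable: "X \<in> gaussian_space \<Longrightarrow> X \<in> borel_measurable M"
  by (simp add: gaussian_space_def)

lemma gaussian_space_square_integrable: "X \<in> gaussian_space \<Longrightarrow> integrable M (\<lambda>\<omega>. (X \<omega>)\<^sup>2)"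
  using gaussian_space_centered centered_gaussian_variance by blast

lemma gaussian_space_mult_integrable:
  "X \<in> gaussian_space \<Longrightarrow> Y \<in> gaussian_space \<Longrightarrow> integrable M (\<lambda>\<omega>. X \<omega> * Y \<omega>)"
  by (intro integral_cauchy_schwarz gaussian_space_measurable gaussian_space_square_integrable)

lemma gaussian_space_scale:
  assumes "X \<in> gaussian_space" shows "(\<lambda>\<omega>. c * X \<omega>) \<in> gaussian_space"
proof -
  obtain Xn where Xn: "\<And>n. Xn n \<in> base_space" "\<And>n. integrable M (\<lambda>\<omega>. (Xn n \<omega> - X \<omega>)\<^sup>2)"
      "(\<lambda>n. \<integral>\<omega>. (Xn n \<omega> - X \<omega>)\<^sup>2 \<partial>M) \<longlonglongrightarrow> 0" and X: "X \<in> borel_measurable M"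
    using assms by (auto simp: gaussian_space_def)
  have eq: "(c * Xn n \<omega> - c * X \<omega>)\<^sup>2 = c\<^sup>2 * (Xn n \<omega> - X \<omega>)\<^sup>2" for n \<omega>
    by (simp add: power_mult_distrib flip: right_diff_distrib)
  show ?thesis unfolding gaussian_space_def
  proof (intro CollectI conjI exI[of _ "\<lambda>n \<omega>. c * Xn n \<omega>"] allI)
    show "(\<lambda>n. \<integral>\<omega>. (c * Xn n \<omega> - c * X \<omega>)\<^sup>2 \<partial>M) \<longlonglongrightarrow> 0"
      unfolding eq using tendsto_mult_left[OF Xn(3), of "c\<^sup>2"] by simp
  qed (use X Xn in \<open>auto intro: base_scale simp: eq\<close>)
qed

lemma gaussian_space_add:
  assumes "X \<in> gaussian_space" "Y \<in> gaussian_space" shows "(\<lambda>\<omega>. X \<omega> + Y \<omega>) \<in> gaussian_space"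
proof -
  obtain Xn where Xn: "\<And>n. Xn n \<in> base_space" "\<And>n. integrable M (\<lambda>\<omega>. (Xn n \<omega> - X \<omega>)\<^sup>2)"
      "(\<lambda>n. \<integral>\<omega>. (Xn n \<omega> - X \<omega>)\<^sup>2 \<partial>M) \<longlonglongrightarrow> 0" and X[measurable]: "X \<in> borel_measurable M"
    using assms by (auto simp: gaussian_space_def)
  obtain Yn where Yn: "\<And>n. Yn n \<in> base_space" "\<And>n. integrable M (\<lambda>\<omega>. (Yn n \<omega> - Y \<omega>)\<^sup>2)"
      "(\<lambda>n. \<integral>\<omega>. (Yn n \<omega> - Y \<omega>)\<^sup>2 \<partial>M) \<longlonglongrightarrow> 0" and Y[measurable]: "Y \<in> borel_measurable M"
    using assms by (auto simp: gaussian_space_def)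
  note [measurable] = base_measurable[OF Xn(1)] base_measurable[OF Yn(1)]
  have le: "(Xn n \<omega> + Yn n \<omega> - (X \<omega> + Y \<omega>))\<^sup>2 \<le> 2 * (Xn n \<omega> - X \<omega>)\<^sup>2 + 2 * (Yn n \<omega> - Y \<omega>)\<^sup>2" for n \<omega>
  proof -
    have "(a + b)\<^sup>2 \<le> 2 * a\<^sup>2 + 2 * b\<^sup>2" for a b :: real
      using sum_squares_bound[of a b] by (simp add: power2_sum)
    from this[of "Xn n \<omega> - X \<omega>" "Yn n \<omega> - Y \<omega>"] show ?thesis by (simp add: algebra_simps)
  qed
  have int: "integrable M (\<lambda>\<omega>. (Xn n \<omega> + Yn n \<omega> - (X \<omega> + Y \<omega>))\<^sup>2)" for n
  proof (rule Bochner_Integration.integrable_bound)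
    show "integrable M (\<lambda>\<omega>. 2 * (Xn n \<omega> - X \<omega>)\<^sup>2 + 2 * (Yn n \<omega> - Y \<omega>)\<^sup>2)" using Xn Yn by simp
  qed (use le in auto)
  show ?thesis unfolding gaussian_space_def
  proof (intro CollectI conjI exI[of _ "\<lambda>n \<omega>. Xn n \<omega> + Yn n \<omega>"] allI)
    show "(\<lambda>n. \<integral>\<omega>. (Xn n \<omega> + Yn n \<omega> - (X \<omega> + Y \<omega>))\<^sup>2 \<partial>M) \<longlonglongrightarrow> 0"
    proof (rule Lim_null_comparison)
      have "(\<integral>\<omega>. (Xn n \<omega> + Yn n \<omega> - (X \<omega> + Y \<omega>))\<^sup>2 \<partial>M)
          \<le> (\<integral>\<omega>. 2 * (Xn n \<omega> - X \<omega>)\<^sup>2 + 2 * (Yn n \<omega> - Y \<omega>)\<^sup>2 \<partial>M)" for n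
        by (intro integral_mono int le) (use Xn Yn in simp)
      then show "\<forall>\<^sub>F n in sequentially. norm (\<integral>\<omega>. (Xn n \<omega> + Yn n \<omega> - (X \<omega> + Y \<omega>))\<^sup>2 \<partial>M)
         \<le> 2 * (\<integral>\<omega>. (Xn n \<omega> - X \<omega>)\<^sup>2 \<partial>M) + 2 * (\<integral>\<omega>. (Yn n \<omega> - Y \<omega>)\<^sup>2 \<partial>M)"
        using Xn Yn by simp
      show "(\<lambda>n. 2 * (\<integral>\<omega>. (Xn n \<omega> - X \<omega>)\<^sup>2 \<partial>M) + 2 * (\<integral>\<omega>. (Yn n \<omega> - Y \<omega>)\<^sup>2 \<partial>M)) \<longlonglongrightarrow> 0"
        using tendsto_add[OF tendsto_mult_left[OF Xn(3), of 2] tendsto_mult_left[OF Yn(3), of 2]] by simp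
    qed
  qed (use Xn Yn int in \<open>auto intro: base_add\<close>)
qed

lemma gaussian_space_sum:
  assumes "finite I" "\<And>k. k \<in> I \<Longrightarrow> X k \<in> gaussian_space"
  shows "(\<lambda>\<omega>. \<Sum>k\<in>I. X k \<omega>) \<in> gaussian_space"
  using assms by (induction I rule: finite_induct) (auto intro: base_gaussian_space base_zero
      gaussian_space_add)

text \<open>The characteristic functions of combinations yield variances only; covariances are
  recovered from the variances of sums.\<close>

lemma polarization:
  assumes "X \<in> gaussian_space" "Y \<in> gaussian_space"
  shows "(\<integral>\<omega>. X \<omega> * Y \<omega> \<partial>M) = ((\<integral>\<omega>. (X \<omega> + Y \<omega>)\<^sup>2 \<partial>M) - (\<integral>\<omega>. (X \<omega>)\<^sup>2 \<partial>M) - (\<integral>\<omega>. (Y \<omega>)\<^sup>2 \<partial>M)) / 2"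
  using gaussian_space_square_integrable[OF assms(1)] gaussian_space_square_integrable[OF assms(2)]
    gaussian_space_mult_integrable[OF assms]
  by (simp add: power2_sum mult.assoc)

section \<open>Covariances of the generating variables\<close>

lemma comb_variance:
  assumes "noise_list ys"
  shows "(\<integral>\<omega>. (bm_comb xs \<omega> + noise_comb ys \<omega>)\<^sup>2 \<partial>M) = bm_comb_var xs + noise_comb_var ys"
  using centered_gaussian_variance(2)[OF comb_gaussian[OF assms]] .

lemma bm_cov_commute: "bm_cov y z = bm_cov z y"
  by (simp add: bm_cov_def abs_minus_commute)

lemma st_inner_commute: "st_inner f g = st_inner g f"
  by (simp add: st_inner_def mult_ac)

lemma U0_cov: "(\<integral>\<omega>. U0 \<omega> y $ i * U0 \<omega> z $ j \<partial>M) = (if i = j then bm_cov y z else 0)"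
proof -
  have "(\<integral>\<omega>. (U0 \<omega> y $ i)\<^sup>2 \<partial>M) = bm_cov y y" for y i
    using comb_variance[of "[]" "[(1, y, i)]"]
    by (simp add: bm_comb_def noise_comb_def bm_comb_var_def noise_comb_var_def)
  moreover have "(\<integral>\<omega>. (U0 \<omega> y $ i + U0 \<omega> z $ j)\<^sup>2 \<partial>M) = bm_cov y y + bm_cov z z + 2 * (if i
      = j then bm_cov y z else 0)"
    using comb_variance[of "[]" "[(1, y, i), (1, z, j)]"]
    by (auto simp add: bm_comb_def noise_comb_def bm_comb_var_def noise_comb_var_def bm_cov_commute)
  ultimately show ?thesis
    using polarization[OF base_gaussian_space[OF U0_base, of y i] base_gaussian_space[OF U0_base, of
        z j]] by simp
qed

lemma W_cov:
  assumes "st_L2 f" "st_L2 g"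
  shows "(\<integral>\<omega>. W i f \<omega> * W j g \<omega> \<partial>M) = (if i = j then st_inner f g else 0)"
proof -
  have "(\<integral>\<omega>. (W i f \<omega>)\<^sup>2 \<partial>M) = st_inner f f" if "st_L2 f" for f i
    using comb_variance[of "[(1, f, i)]" "[]"] that
    by (simp add: bm_comb_def noise_comb_def bm_comb_var_def noise_comb_var_def)
  moreover have "(\<integral>\<omega>. (W i f \<omega> + W j g \<omega>)\<^sup>2 \<partial>M) = st_inner f f + st_inner g g + 2 * (if i
      = j then st_inner f g else 0)"
    using comb_variance[of "[(1, f, i), (1, g, j)]" "[]"] assms
    by (auto simp add: bm_comb_def noise_comb_def bm_comb_var_def noise_comb_var_def st_inner_commute)
  ultimately show ?thesis
    using polarization[OF base_gaussian_space[OF W_base, of f i] base_gaussian_space[OF W_base, of g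
        j]] assms by simp
qed

lemma U0_W_cov:
  assumes "st_L2 f"
  shows "(\<integral>\<omega>. U0 \<omega> y $ i * W j f \<omega> \<partial>M) = 0"
  using polarization[OF base_gaussian_space[OF U0_base, of y i] base_gaussian_space[OF W_base, of f j]] assms
    comb_variance[of "[(1, f, j)]" "[(1, y, i)]"] comb_variance[of "[(1, f, j)]" "[]"]
        comb_variance[of "[]" "[(1, y, i)]"]
  by (simp add: bm_comb_def noise_comb_def bm_comb_var_def noise_comb_var_def)

end

section \<open>Heat averages of the Brownian motion\<close>

interpretation std_normal: prob_space std_normal_distribution
  by (rule prob_space_std_normal)

context noise_and_bm
begin

text \<open>Elements of the space are functions and not classes, so the passage from
  \<open>U0\<close> to its regular modification has to be justified.\<close>

lemma gaussian_space_AE_cong: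
  assumes X: "X \<in> gaussian_space" and [measurable]: "Y \<in> borel_measurable M" and eq: "AE \<omega> in M. X \<omega> = Y \<omega>"
  shows "Y \<in> gaussian_space"
proof -
  obtain Xn where Xn: "\<And>n. Xn n \<in> base_space" "\<And>n. integrable M (\<lambda>\<omega>. (Xn n \<omega> - X \<omega>)\<^sup>2)"
      "(\<lambda>n. \<integral>\<omega>. (Xn n \<omega> - X \<omega>)\<^sup>2 \<partial>M) \<longlonglongrightarrow> 0" and [measurable]: "X \<in> borel_measurable M"
    using X by (auto simp: gaussian_space_def)
  note [measurable] = base_measurable[OF Xn(1)]
  have ae: "AE \<omega> in M. (Xn n \<omega> - X \<omega>)\<^sup>2 = (Xn n \<omega> - Y \<omega>)\<^sup>2" for n
    using eq by eventually_elim simp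
  have "integrable M (\<lambda>\<omega>. (Xn n \<omega> - Y \<omega>)\<^sup>2)" for n
    using Xn(2)[of n] by (rule integrable_cong_AE_imp) (use ae[of n] in simp_all)
  moreover have "(\<integral>\<omega>. (Xn n \<omega> - Y \<omega>)\<^sup>2 \<partial>M) = (\<integral>\<omega>. (Xn n \<omega> - X \<omega>)\<^sup>2 \<partial>M)" for n
    by (rule integral_cong_AE[symmetric]) (use ae[of n] in simp_all)
  ultimately show ?thesis
    unfolding gaussian_space_def using Xn by (intro CollectI conjI exI[of _ Xn]) auto
qed

text \<open>Discarding the null set of irregular paths makes the Brownian motion jointly measurable in
  \<open>(\<omega>, y)\<close>, as Fubini requires.\<close>
definition regular_set :: "'w set" where
  "regular_set = (SOME S. S \<in> sets M \<and> (AE \<omega> in M. \<omega> \<in> S) \<and>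
     (\<forall>\<omega>\<in>S. continuous_on UNIV (U0 \<omega>) \<and> U0 \<omega> 0 = 0))"

lemma regular_set:
  shows "regular_set \<in> sets M" "AE \<omega> in M. \<omega> \<in> regular_set"
    and "\<And>\<omega>. \<omega> \<in> regular_set \<Longrightarrow> continuous_on UNIV (U0 \<omega>)" "\<And>\<omega>. \<omega> \<in> regular_set \<Longrightarrow> U0 \<omega> 0 = 0"
proof -
  have "AE \<omega> in M. U0 \<omega> 0 $ i = 0" for i
  proof -
    have "(\<integral>\<omega>. (U0 \<omega> 0 $ i)\<^sup>2 \<partial>M) = 0"
      using U0_cov[of 0 i 0 i] by (simp add: power2_eq_square bm_cov_def)
    then have "AE \<omega> in M. (U0 \<omega> 0 $ i)\<^sup>2 = 0"
      by (subst (asm) integral_nonneg_eq_0_iff_AE)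
        (simp_all add: gaussian_space_square_integrable[OF base_gaussian_space[OF U0_base]])
    then show ?thesis by simp
  qed
  then have "AE \<omega> in M. \<forall>i. U0 \<omega> 0 $ i = 0" by (simp add: AE_all_countable)
  moreover have "AE \<omega> in M. continuous_on UNIV (U0 \<omega>)" using bm by (simp add: two_sided_BM_def)
  ultimately have "AE \<omega> in M. continuous_on UNIV (U0 \<omega>) \<and> U0 \<omega> 0 = 0"
    by (auto simp: vec_eq_iff)
  then obtain N where N: "{\<omega> \<in> space M. \<not> (continuous_on UNIV (U0 \<omega>) \<and> U0 \<omega> 0 = 0)} \<subseteq> N" "N \<in> null_sets M"
    unfolding eventually_ae_filter by blast
  have "\<exists>S. S \<in> sets M \<and> (AE \<omega> in M. \<omega> \<in> S) \<and> (\<forall>\<omega>\<in>S. continuous_on UNIV (U0 \<omega>) \<and> U0 \<omega> 0 = 0)"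
  proof (intro exI[of _ "space M - N"] conjI)
    show "AE \<omega> in M. \<omega> \<in> space M - N" using AE_not_in[OF N(2)] by auto
  qed (use N in auto)
  from someI_ex[OF this, folded regular_set_def]
  show "regular_set \<in> sets M" "AE \<omega> in M. \<omega> \<in> regular_set"
    and "\<And>\<omega>. \<omega> \<in> regular_set \<Longrightarrow> continuous_on UNIV (U0 \<omega>)" "\<And>\<omega>. \<omega> \<in> regular_set \<Longrightarrow> U0 \<omega> 0 = 0"
    by auto
qed

definition B :: "'w \<Rightarrow> real \<Rightarrow> real ^ 'd" where
  "B \<omega> y = (if \<omega> \<in> regular_set then U0 \<omega> y else 0)"

lemma B_zero[simp]: "B \<omega> 0 = 0"
  using regular_set(4) by (simp add: B_def)

lemma B_continuous: "continuous_on UNIV (B \<omega>)"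
  using regular_set(3)[of \<omega>] by (cases "\<omega> \<in> regular_set") (auto simp: B_def[abs_def])

lemma B_AE: "AE \<omega> in M. \<forall>y. B \<omega> y = U0 \<omega> y"
  using regular_set(2) by eventually_elim (simp add: B_def)

lemma B_measurable[measurable]: "(\<lambda>\<omega>. B \<omega> y $ i) \<in> borel_measurable M"
proof -
  note [measurable] = regular_set(1)
  have "(\<lambda>\<omega>. B \<omega> y $ i) = (\<lambda>\<omega>. if \<omega> \<in> regular_set then U0 \<omega> y $ i else 0)"
    by (auto simp: B_def)
  also have "\<dots> \<in> borel_measurable M" by measurable
  finally show ?thesis .
qed

lemma B_gaussian: "(\<lambda>\<omega>. B \<omega> y $ i) \<in> gaussian_space"
  by (rule gaussian_space_AE_cong[OF base_gaussian_space[OF U0_base, of y i]]) (use B_AE in auto)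

lemma B_cov: "(\<integral>\<omega>. B \<omega> y $ i * B \<omega> z $ j \<partial>M) = (if i = j then bm_cov y z else 0)"
  unfolding U0_cov[symmetric] by (rule integral_cong_AE) (use B_AE in auto)

lemma B_diff_square: 
  "integrable M (\<lambda>\<omega>. (B \<omega> y $ i - B \<omega> z $ i)\<^sup>2)" "(\<integral>\<omega>. (B \<omega> y $ i - B \<omega> z $ i)\<^sup>2 \<partial>M) = \<bar>y - z\<bar>"
proof -
  have eq: "(B \<omega> y $ i - B \<omega> z $ i)\<^sup>2 = B \<omega> y $ i * B \<omega> y $ i - 2 * (B \<omega> y $ i * B \<omega> z $ i)
      + B \<omega> z $ i * B \<omega> z $ i" for \<omega>
    by (simp add: power2_eq_square algebra_simps)
  note int = gaussian_space_mult_integrable[OF B_gaussian B_gaussian]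
  show "integrable M (\<lambda>\<omega>. (B \<omega> y $ i - B \<omega> z $ i)\<^sup>2)" unfolding eq using int by simp
  show "(\<integral>\<omega>. (B \<omega> y $ i - B \<omega> z $ i)\<^sup>2 \<partial>M) = \<bar>y - z\<bar>" unfolding eq
    using int by (simp add: B_cov) (simp add: bm_cov_def field_simps)
qed

text \<open>By continuity of the paths, B is the limit of its values at y rounded down to multiples
  of \<open>1 / (n + 1)\<close>. A rounded argument takes countably many values, so each
  approximation is jointly measurable.\<close>

lemma B_joint_measurable: "(\<lambda>p. B (fst p) (snd p) $ i) \<in> borel_measurable (M \<Otimes>\<^sub>M borel)"
proof (rule borel_measurable_LIMSEQ_metric)
  fix n
  show "(\<lambda>p. B (fst p) (real_of_int \<lfloor>real (Suc n) * snd p\<rfloor>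
      / real (Suc n)) $ i) \<in> borel_measurable (M \<Otimes>\<^sub>M borel)"
    by (rule measurable_compose_countable[where f="\<lambda>k p. B (fst p) (real_of_int k
        / real (Suc n)) $ i"]) measurable
next
  fix p :: "'w \<times> real"
  have "(\<lambda>n. real_of_int \<lfloor>real (Suc n) * snd p\<rfloor> / real (Suc n)) \<longlonglongrightarrow> snd p"
  proof (rule LIM_zero_cancel, rule Lim_null_comparison)
    show "\<forall>\<^sub>F n in sequentially. norm (real_of_int \<lfloor>real (Suc n) * snd p\<rfloor> / real (Suc n) - snd p)
        \<le> inverse (real (Suc n))"
    proof (intro always_eventually allI)
      fix n
      let ?y = "real (Suc n) * snd p"
      have "\<bar>real_of_int \<lfloor>?y\<rfloor> - ?y\<bar> \<le> 1" using floor_correct[of ?y] by linarith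
      moreover have "real_of_int \<lfloor>?y\<rfloor> / real (Suc n) - snd p = (real_of_int \<lfloor>?y\<rfloor> - ?y) / real (Suc n)"
        by (simp add: diff_divide_distrib)
      ultimately show "norm (real_of_int \<lfloor>?y\<rfloor> / real (Suc n) - snd p) \<le> inverse (real (Suc n))"
        by (simp add: abs_divide divide_le_eq inverse_eq_divide del: of_nat_Suc)
    qed
    show "(\<lambda>n. inverse (real (Suc n))) \<longlonglongrightarrow> 0" by (rule LIMSEQ_inverse_real_of_nat)
  qed
  moreover have "isCont (B (fst p)) (snd p)" using B_continuous[of "fst p"]
      by (simp add: continuous_on_eq_continuous_at)
  ultimately have "(\<lambda>n. B (fst p) (real_of_int \<lfloor>real (Suc n) * snd p\<rfloor> / real (Suc n))) \<longlonglongrightarrow> B (fst p) (snd p)"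
    by (rule isCont_tendsto_compose[rotated])
  then show "(\<lambda>n. B (fst p) (real_of_int \<lfloor>real (Suc n) * snd p\<rfloor> / real (Suc n)) $ i) \<longlonglongrightarrow> B (fst p) (snd p) $ i"
    by (rule tendsto_vec_nth)
qed

sublocale NM: pair_prob_space std_normal_distribution M by standard

lemma B_comp_measurable[measurable]:
  assumes [measurable]: "u \<in> borel_measurable borel"
  shows "(\<lambda>(n, \<omega>). B \<omega> (u n) $ i) \<in> borel_measurable (std_normal_distribution \<Otimes>\<^sub>M M)"
    and "(\<lambda>(\<omega>, n). B \<omega> (u n) $ i) \<in> borel_measurable (M \<Otimes>\<^sub>M std_normal_distribution)"
proof -
  have "(\<lambda>z. (snd z, u (fst z))) \<in> std_normal_distribution \<Otimes>\<^sub>M M \<rightarrow>\<^sub>M M \<Otimes>\<^sub>M borel" by measurable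
  from measurable_compose[OF this B_joint_measurable[of i]]
  show "(\<lambda>(n, \<omega>). B \<omega> (u n) $ i) \<in> borel_measurable (std_normal_distribution \<Otimes>\<^sub>M M)"
      by (simp add: case_prod_beta')
  have "(\<lambda>z. (fst z, u (snd z))) \<in> M \<Otimes>\<^sub>M std_normal_distribution \<rightarrow>\<^sub>M M \<Otimes>\<^sub>M borel" by measurable
  from measurable_compose[OF this B_joint_measurable[of i]]
  show "(\<lambda>(\<omega>, n). B \<omega> (u n) $ i) \<in> borel_measurable (M \<Otimes>\<^sub>M std_normal_distribution)"
      by (simp add: case_prod_beta')
qed

text \<open>For \<open>u n = x + sqrt (2 * t) * n\<close> this is the convolution of the path with
  the heat kernel, which is normal with variance \<open>2 * t\<close>. A general u makes room for
  approximation by simple functions.\<close>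

definition heat_avg :: "(real \<Rightarrow> real) \<Rightarrow> 'd \<Rightarrow> 'w \<Rightarrow> real" where
  "heat_avg u i \<omega> = (\<integral>n. B \<omega> (u n) $ i \<partial>std_normal_distribution)"

lemma heat_avg_measurable[measurable]:
  assumes [measurable]: "u \<in> borel_measurable borel"
  shows "heat_avg u i \<in> borel_measurable M"
  unfolding heat_avg_def[abs_def] by (rule std_normal.borel_measurable_lebesgue_integral) (rule
      B_comp_measurable, simp)

lemma B_comp_diff_square:
  assumes [measurable]: "u \<in> borel_measurable borel" "w \<in> borel_measurable borel"
    and u: "integrable std_normal_distribution u" and w: "integrable std_normal_distribution w"
  shows "integrable (std_normal_distribution \<Otimes>\<^sub>M M) (\<lambda>(n, \<omega>). (B \<omega> (u n) $ i - B \<omega> (w n) $ i)\<^sup>2)"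
    and "(\<integral>\<omega>. (\<integral>n. (B \<omega> (u n) $ i - B \<omega> (w n) $ i)\<^sup>2 \<partial>std_normal_distribution) \<partial>M)
        = (\<integral>n. \<bar>u n - w n\<bar> \<partial>std_normal_distribution)"
proof -
  have m: "(\<lambda>z. (B (snd z) (u (fst z)) $ i - B (snd z) (w (fst z)) $ i)\<^sup>2) \<in> borel_measurable
      (std_normal_distribution \<Otimes>\<^sub>M M)"
    using B_comp_measurable(1)[OF assms(1), of i] B_comp_measurable(1)[OF assms(2), of i]
    by (simp add: case_prod_beta')
  show int: "integrable (std_normal_distribution \<Otimes>\<^sub>M M) (\<lambda>(n, \<omega>). (B \<omega> (u n) $ i - B \<omega> (w n) $ i)\<^sup>2)"
    unfolding case_prod_beta'
  proof (rule NM.Fubini_integrable[OF m])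
    show "integrable std_normal_distribution (\<lambda>n. \<integral>\<omega>. norm ((B (snd (n, \<omega>)) (u (fst (n, \<omega>))) $ i
        - B (snd (n, \<omega>)) (w (fst (n, \<omega>))) $ i)\<^sup>2) \<partial>M)"
      using u w by (simp add: B_diff_square)
  qed (simp add: B_diff_square)
  show "(\<integral>\<omega>. (\<integral>n. (B \<omega> (u n) $ i - B \<omega> (w n) $ i)\<^sup>2 \<partial>std_normal_distribution) \<partial>M)
      = (\<integral>n. \<bar>u n - w n\<bar> \<partial>std_normal_distribution)"
    using NM.Fubini_integral[OF int] by (simp add: B_diff_square)
qed

lemma heat_avg_AE_square_integrable:
  assumes [measurable]: "u \<in> borel_measurable borel" "w \<in> borel_measurable borel"
    and u: "integrable std_normal_distribution u" and w: "integrable std_normal_distribution w"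
  shows "AE \<omega> in M. integrable std_normal_distribution (\<lambda>n. (B \<omega> (u n) $ i - B \<omega> (w n) $ i)\<^sup>2)"
  using NM.AE_integrable_snd[OF B_comp_diff_square(1)[OF assms]] .

lemma B_comp_section_measurable[measurable]:
  "u \<in> borel_measurable borel \<Longrightarrow> (\<lambda>n. B \<omega> (u n) $ i) \<in> borel_measurable borel"
  by (rule measurable_compose[where N=borel])
    (auto intro!: borel_measurable_continuous_onI continuous_intros B_continuous)

lemma heat_avg_AE_integrable:
  assumes [measurable]: "u \<in> borel_measurable borel" and u: "integrable std_normal_distribution u"
  shows "AE \<omega> in M. integrable std_normal_distribution (\<lambda>n. B \<omega> (u n) $ i)"
  using heat_avg_AE_square_integrable[OF assms(1) _ u, of "\<lambda>_. 0" i]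
  by (simp, elim eventually_mono) (rule std_normal.integral_square_le, simp_all)

text \<open>Both averages use the same normal variable. Jensen's inequality for the normal law and
  Fubini then reduce the claim to the variance \<open>\<bar>y - z\<bar>\<close> of a Brownian
  increment.\<close>

lemma heat_avg_diff:
  assumes [measurable]: "u \<in> borel_measurable borel" "w \<in> borel_measurable borel"
    and u: "integrable std_normal_distribution u" and w: "integrable std_normal_distribution w"
  shows "integrable M (\<lambda>\<omega>. (heat_avg u i \<omega> - heat_avg w i \<omega>)\<^sup>2)"
    and "(\<integral>\<omega>. (heat_avg u i \<omega> - heat_avg w i \<omega>)\<^sup>2 \<partial>M) \<le> (\<integral>n. \<bar>u n - w n\<bar> \<partial>std_normal_distribution)"
proof -
  let ?D = "\<lambda>\<omega>. \<integral>n. (B \<omega> (u n) $ i - B \<omega> (w n) $ i)\<^sup>2 \<partial>std_normal_distribution"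
  have D: "integrable M ?D" using NM.integrable_snd[OF B_comp_diff_square(1)[OF assms]] .
  have le: "AE \<omega> in M. (heat_avg u i \<omega> - heat_avg w i \<omega>)\<^sup>2 \<le> ?D \<omega>"
    using heat_avg_AE_integrable[OF assms(1) u, of i] heat_avg_AE_integrable[OF assms(2) w, of i]
      heat_avg_AE_square_integrable[OF assms, of i]
  proof eventually_elim
    case (elim \<omega>)
    have "heat_avg u i \<omega> - heat_avg w i \<omega> = (\<integral>n. B \<omega> (u n) $ i - B \<omega> (w n) $ i \<partial>std_normal_distribution)"
      unfolding heat_avg_def using elim by simp
    then show ?case using std_normal.integral_square_le(2)[OF _ elim(3)] by simp
  qed
  show int: "integrable M (\<lambda>\<omega>. (heat_avg u i \<omega> - heat_avg w i \<omega>)\<^sup>2)"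
    by (rule Bochner_Integration.integrable_bound[OF D]) (use le in \<open>auto elim!: eventually_mono\<close>)
  show "(\<integral>\<omega>. (heat_avg u i \<omega> - heat_avg w i \<omega>)\<^sup>2 \<partial>M) \<le> (\<integral>n. \<bar>u n - w n\<bar> \<partial>std_normal_distribution)"
    unfolding B_comp_diff_square(2)[OF assms, of i, symmetric] by (rule integral_mono_AE[OF int D le])
qed

text \<open>For simple u the average is a finite combination of Brownian values. In general u is an
  L1 limit of simple functions, and by \<open>heat_avg_diff\<close> this turns into L2 convergence
  of the averages.\<close>

lemma heat_avg_gaussian:
  assumes [measurable]: "u \<in> borel_measurable borel" and u: "integrable std_normal_distribution u"
  shows "heat_avg u i \<in> gaussian_space"
proof -
  obtain F where F: "\<And>k. simple_function borel (F k)" "\<And>x. (\<lambda>k. F k x) \<longlonglongrightarrow> u x"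
      "\<And>k x. dist (F k x) 0 \<le> 2 * dist (u x) 0"
    using borel_measurable_implies_sequence_metric[OF assms(1), of 0] by auto
  have Fm[measurable]: "F k \<in> borel_measurable borel" for k using F(1)
      by (rule borel_measurable_simple_function)
  have Fint: "integrable std_normal_distribution (F k)" for k
    by (rule Bochner_Integration.integrable_bound[where f="\<lambda>x. 2
        * u x"]) (use u F(3) in \<open>auto simp: dist_real_def abs_mult\<close>)
  define X where "X k \<omega> = (\<Sum>v\<in>range (F k). measure std_normal_distribution (F k -` {v}) * U0 \<omega> v $ i)" for k \<omega>
  have fin: "finite (range (F k))" for k using F(1)[of k] by (simp add: simple_function_def)
  have Xb: "X k \<in> base_space" for k
    unfolding X_def[abs_def] by (rule base_sum[OF fin]) (intro base_scale U0_base)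
  have HX: "AE \<omega> in M. heat_avg (F k) i \<omega> = X k \<omega>" for k
    using B_AE
  proof eventually_elim
    case (elim \<omega>)
    have "B \<omega> (F k n) $ i = (\<Sum>v\<in>range (F k). indicator (F k -` {v}) n * B \<omega> v $ i)" for n
    proof -
      have "(\<Sum>v\<in>range (F k). indicator (F k -` {v}) n * B \<omega> v $ i)
          = (\<Sum>v\<in>{F k n}. indicator (F k -` {v}) n * B \<omega> v $ i)"
        by (rule sum.mono_neutral_right[OF fin]) auto
      then show ?thesis by simp
    qed
    then have "heat_avg (F k) i \<omega> = (\<integral>n. (\<Sum>v\<in>range (F k). indicator (F k -` {v}) n
        * B \<omega> v $ i) \<partial>std_normal_distribution)"
      by (simp add: heat_avg_def)
    also have "\<dots> = (\<Sum>v\<in>range (F k). \<integral>n. indicator (F k -` {v}) n * B \<omega> v $ i \<partial>std_normal_distribution)"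
    proof (rule Bochner_Integration.integral_sum)
      fix v
      have "F k -` {v} \<in> sets borel" using measurable_sets[OF Fm, of "{v}" k] by simp
      then show "integrable std_normal_distribution (\<lambda>n. indicator (F k -` {v}) n * B \<omega> v $ i)"
        by (intro integrable_mult_left) (auto simp: std_normal.emeasure_finite less_top[symmetric])
    qed
    also have "\<dots> = X k \<omega>" unfolding X_def using elim by simp
    finally show ?case .
  qed
  have Xm[measurable]: "X k \<in> borel_measurable M" for k using base_measurable[OF Xb] .
  have ae: "AE \<omega> in M. (heat_avg (F k) i \<omega> - heat_avg u i \<omega>)\<^sup>2 = (X k \<omega> - heat_avg u i \<omega>)\<^sup>2" for k
    using HX[of k] by eventually_elim simp
  have int: "integrable M (\<lambda>\<omega>. (X k \<omega> - heat_avg u i \<omega>)\<^sup>2)" for k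
    by (rule integrable_cong_AE_imp[OF heat_avg_diff(1)[OF Fm assms(1) Fint u]]) (use ae in auto)
  have le: "norm (\<integral>\<omega>. (X k \<omega> - heat_avg u i \<omega>)\<^sup>2 \<partial>M) \<le> (\<integral>n. \<bar>F k n - u n\<bar> \<partial>std_normal_distribution)" for k
  proof -
    have "(\<integral>\<omega>. (X k \<omega> - heat_avg u i \<omega>)\<^sup>2 \<partial>M) = (\<integral>\<omega>. (heat_avg (F k) i \<omega> - heat_avg u i \<omega>)\<^sup>2 \<partial>M)"
      by (rule integral_cong_AE) (use ae[of k] in auto)
    then show ?thesis using heat_avg_diff(2)[OF Fm assms(1) Fint u] by simp
  qed
  have lim: "(\<lambda>k. \<integral>n. \<bar>F k n - u n\<bar> \<partial>std_normal_distribution) \<longlonglongrightarrow> (\<integral>n. 0 \<partial>std_normal_distribution)"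
  proof (rule integral_dominated_convergence)
    show "integrable std_normal_distribution (\<lambda>n. 3 * \<bar>u n\<bar>)" using u by simp
    show "AE n in std_normal_distribution. (\<lambda>k. \<bar>F k n - u n\<bar>) \<longlonglongrightarrow> 0"
      using F(2) by (auto intro!: tendsto_rabs_zero LIM_zero)
    show "AE n in std_normal_distribution. norm \<bar>F k n - u n\<bar> \<le> 3 * \<bar>u n\<bar>" for k
    proof (rule AE_I2)
      fix n show "norm \<bar>F k n - u n\<bar> \<le> 3 * \<bar>u n\<bar>"
        using F(3)[of k n] by (simp add: dist_real_def)
    qed
  qed auto
  have "(\<lambda>k. \<integral>\<omega>. (X k \<omega> - heat_avg u i \<omega>)\<^sup>2 \<partial>M) \<longlonglongrightarrow> 0"
    by (rule Lim_null_comparison[OF always_eventually[OF allI[OF le]] lim[unfolded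
        Bochner_Integration.integral_zero]])
  then show ?thesis
    unfolding gaussian_space_def mem_Collect_eq
    by (intro conjI exI[of _ X] allI Xb int heat_avg_measurable assms(1))
qed

lemma heat_avg_mult:
  assumes [measurable]: "u \<in> borel_measurable borel" "Y \<in> borel_measurable M"
    and u: "integrable std_normal_distribution u" and Y: "integrable M (\<lambda>\<omega>. (Y \<omega>)\<^sup>2)"
  shows "(\<integral>\<omega>. heat_avg u i \<omega> * Y \<omega> \<partial>M) = (\<integral>n. (\<integral>\<omega>. B \<omega> (u n) $ i * Y \<omega> \<partial>M) \<partial>std_normal_distribution)"
proof -
  have Y2: "integrable (std_normal_distribution \<Otimes>\<^sub>M M) (\<lambda>z. (Y (snd z))\<^sup>2)"
    by (rule NM.Fubini_integrable) (use Y in auto)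
  have "integrable (std_normal_distribution \<Otimes>\<^sub>M M) (\<lambda>z. B (snd z) (u (fst z)) $ i * Y (snd z))"
  proof (rule integral_cauchy_schwarz)
    show "(\<lambda>z. B (snd z) (u (fst z)) $ i) \<in> borel_measurable (std_normal_distribution \<Otimes>\<^sub>M M)"
      using B_comp_measurable(1)[OF assms(1), of i] by (simp add: case_prod_beta')
    show "integrable (std_normal_distribution \<Otimes>\<^sub>M M) (\<lambda>z. (B (snd z) (u (fst z)) $ i)\<^sup>2)"
      using B_comp_diff_square(1)[OF assms(1) _ u, of "\<lambda>_. 0" i] by (simp add: case_prod_beta')
  qed (use Y2 in auto)
  then have "integrable (std_normal_distribution \<Otimes>\<^sub>M M) (\<lambda>(n, \<omega>). B \<omega> (u n) $ i * Y \<omega>)"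
    by (simp add: case_prod_beta')
  from NM.Fubini_integral[OF this] show ?thesis by (simp add: heat_avg_def)
qed

lemma heat_avg_cov:
  assumes u: "u \<in> borel_measurable borel" "integrable std_normal_distribution u"
    and w: "w \<in> borel_measurable borel" "integrable std_normal_distribution w"
  shows "(\<integral>\<omega>. heat_avg u i \<omega> * heat_avg w j \<omega> \<partial>M)
    = (if i = j then (\<integral>n. (\<integral>m. bm_cov (u n) (w m) \<partial>std_normal_distribution) \<partial>std_normal_distribution) else 0)"
proof -
  have "(\<integral>\<omega>. B \<omega> y $ i * heat_avg w j \<omega> \<partial>M) = (if i
      = j then (\<integral>m. bm_cov y (w m) \<partial>std_normal_distribution) else 0)" for y
    using heat_avg_mult[OF w(1) gaussian_space_measurable[OF B_gaussian] w(2)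
        gaussian_space_square_integrable[OF B_gaussian], of j y i]
    by (simp add: mult.commute B_cov bm_cov_commute)
  then show ?thesis
    using heat_avg_mult[OF u(1) _ u(2) gaussian_space_square_integrable[OF heat_avg_gaussian[OF w]],
        of j i] w(1)
    by simp
qed

lemma heat_avg_W_cov:
  assumes u: "u \<in> borel_measurable borel" "integrable std_normal_distribution u" and f: "st_L2 f"
  shows "(\<integral>\<omega>. heat_avg u i \<omega> * W j f \<omega> \<partial>M) = 0"
proof -
  have "(\<integral>\<omega>. B \<omega> y $ i * W j f \<omega> \<partial>M) = 0" for y
    unfolding U0_W_cov[OF f, of y i j, symmetric] by (rule integral_cong_AE) (use B_AE f in auto)
  then show ?thesis
    using heat_avg_mult[OF u(1) W_measurable[OF f] u(2) gaussian_space_square_integrable[OF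
        base_gaussian_space[OF W_base[OF f]]]]
    by simp
qed

end

section \<open>Covariance of the stochastic convolution\<close>

text \<open>The derivative is required only inside the interval, because the integrands met below
  may blow up at the left end like \<open>1 / sqrt u\<close>.\<close>

lemma nn_integral_FTC_Ioc:
  fixes F f :: "real \<Rightarrow> real"
  assumes ab: "a \<le> b" and F: "continuous_on {a..b} F"
    and deriv: "\<And>x. a < x \<Longrightarrow> x < b \<Longrightarrow> (F has_real_derivative f x) (at x)"
    and [measurable]: "f \<in> borel_measurable borel" and nonneg: "\<And>x. a < x \<Longrightarrow> x \<le> b \<Longrightarrow> 0 \<le> f x"
  shows "(\<integral>\<^sup>+x. ennreal (indicator {a<..b} x * f x) \<partial>lborel) = ennreal (F b - F a)"
proof (rule nn_integral_has_integral_lborel)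
  show "(\<lambda>x. indicator {a<..b} x * f x) \<in> borel_measurable borel" by measurable
  show "0 \<le> indicator {a<..b} x * f x" for x using nonneg[of x] by (simp add: indicator_def)
  have "(f has_integral F b - F a) {a..b}"
    by (rule fundamental_theorem_of_calculus_interior[OF ab F])
      (use deriv in \<open>auto simp: has_real_derivative_iff_has_vector_derivative\<close>)
  then have "((\<lambda>x. indicator {a<..b} x * f x) has_integral F b - F a) {a..b}"
    by (rule has_integral_spike[of "{a}", rotated 2]) (auto simp: indicator_def)
  then have "((\<lambda>x. if x \<in> {a..b} then indicator {a<..b} x * f x else 0) has_integral F b - F a) UNIV"
    by (simp only: has_integral_restrict_UNIV)
  also have "(\<lambda>x. if x \<in> {a..b} then indicator {a<..b} x * f x else 0) = (\<lambda>x. indicator {a<..b} x * f x)"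
    by (auto simp: indicator_def)
  finally show "((\<lambda>x. indicator {a<..b} x * f x) has_integral F b - F a) UNIV" .
qed

lemma heat_kernel_nonneg: "0 \<le> t \<Longrightarrow> 0 \<le> heat_kernel t x"
  by (simp add: heat_kernel_def)

lemma heat_kernel_measurable[measurable]:
  assumes [measurable]: "f \<in> borel_measurable N" "g \<in> borel_measurable N"
  shows "(\<lambda>z. heat_kernel (f z) (g z)) \<in> borel_measurable N"
  unfolding heat_kernel_def by measurable

lemma heat_kernel_normal: "0 < t \<Longrightarrow> heat_kernel t x = normal_density 0 (sqrt (2 * t)) x"
  by (simp add: heat_kernel_def normal_density_def mult_ac)

lemma heat_kernel_even: "heat_kernel t (- x) = heat_kernel t x"
  by (simp add: heat_kernel_def)

lemma heat_kernel_semigroup: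
  assumes "0 < a" "0 < b"
  shows "(\<integral>\<^sup>+z. ennreal (heat_kernel a (x - z) * heat_kernel b (y - z)) \<partial>lborel)
      = ennreal (heat_kernel (a + b) (x - y))"
proof -
  let ?f = "\<lambda>w. ennreal (normal_density 0 (sqrt (2 * a)) ((x - y) - w) * normal_density 0 (sqrt (2 * b)) w)"
  have "ennreal (heat_kernel (a + b) (x - y))
      = ennreal (normal_density 0 (sqrt ((sqrt (2 * a))\<^sup>2 + (sqrt (2 * b))\<^sup>2)) (x - y))"
    using assms by (simp add: heat_kernel_normal)
  also have "\<dots> = (\<integral>\<^sup>+w. ?f w \<partial>lborel)"
    using fun_cong[OF conv_normal_density_zero_mean[of "sqrt (2 * a)" "sqrt (2 * b)"], of "x
        - y"] assms by simp
  also have "\<dots> = (\<integral>\<^sup>+z. ?f (- y + 1 * z) \<partial>lborel)"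
    by (subst nn_integral_real_affine[where c=1 and t="- y"]) auto
  also have "\<dots> = (\<integral>\<^sup>+z. ennreal (heat_kernel a (x - z) * heat_kernel b (y - z)) \<partial>lborel)"
  proof (rule nn_integral_cong)
    fix z
    have "heat_kernel b (y - z) = heat_kernel b (z - y)" by (metis heat_kernel_even minus_diff_eq)
    then show "?f (- y + 1 * z) = ennreal (heat_kernel a (x - z) * heat_kernel b (y - z))"
      using assms by (simp add: heat_kernel_normal)
  qed
  finally show ?thesis ..
qed

text \<open>The covariance of the noise parts at times s + h and s and at distance a: the semigroup
  property merges the two kernels into one at time \<open>h + 2 * u\<close>, where u = s - r is the
  time left until s. It is kept in \<open>ennreal\<close> so that square integrability of the
  kernels follows from its finiteness.\<close>

definition noise_integral :: "real \<Rightarrow> real \<Rightarrow> real \<Rightarrow> ennreal" where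
  "noise_integral h a s = (\<integral>\<^sup>+u. ennreal (indicator {0<..s} u * heat_kernel (h + 2 * u) a) \<partial>lborel)"

lemma stoch_conv_kernel_measurable[measurable]: "stoch_conv_kernel t x \<in> borel_measurable borel"
proof -
  have "stoch_conv_kernel t x \<in> borel_measurable (borel \<Otimes>\<^sub>M borel)"
    unfolding stoch_conv_kernel_def by measurable
  then show ?thesis by (simp add: borel_prod)
qed

lemma half_plane_borel[measurable]: "{0..} \<times> UNIV \<in> sets (borel :: (real \<times> real) measure)"
  by (intro borel_closed closed_Times closed_atLeast closed_UNIV)

lemma stoch_conv_kernel_nonneg: "0 \<le> stoch_conv_kernel t x p"
  by (auto simp: stoch_conv_kernel_def split: prod.splits intro!: heat_kernel_nonneg)

lemma stoch_conv_kernel_nn_integral: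
  assumes st: "0 \<le> s" "s \<le> t"
  shows "(\<integral>\<^sup>+p. ennreal (indicator ({0..} \<times> UNIV) p * stoch_conv_kernel t x p
      * stoch_conv_kernel s y p) \<partial>lborel)
    = noise_integral (t - s) (x - y) s"
proof -
  let ?f = "\<lambda>p::real \<times> real. ennreal (indicator ({0..} \<times> UNIV) p * stoch_conv_kernel t x p
      * stoch_conv_kernel s y p)"
  have [measurable]: "?f \<in> borel_measurable (lborel \<Otimes>\<^sub>M lborel)"
    unfolding lborel_prod by measurable
  have "(\<integral>\<^sup>+p. ?f p \<partial>lborel) = (\<integral>\<^sup>+r. (\<integral>\<^sup>+z. ?f (r, z) \<partial>lborel) \<partial>lborel)"
    by (subst lborel.nn_integral_fst) (auto simp: lborel_prod)
  also have "\<dots> = (\<integral>\<^sup>+r. ennreal (indicator {0..<s} r * heat_kernel (t + s - 2 * r) (x - y)) \<partial>lborel)"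
  proof (rule nn_integral_cong)
    fix r :: real
    show "(\<integral>\<^sup>+z. ?f (r, z) \<partial>lborel) = ennreal (indicator {0..<s} r * heat_kernel (t + s - 2 * r) (x - y))"
    proof (cases "0 \<le> r \<and> r < s")
      case True
      then have "(\<integral>\<^sup>+z. ?f (r, z) \<partial>lborel) = (\<integral>\<^sup>+z. ennreal (heat_kernel (t - r) (x - z)
          * heat_kernel (s - r) (y - z)) \<partial>lborel)"
        using st by (intro nn_integral_cong) (simp add: stoch_conv_kernel_def)
      also have "\<dots> = ennreal (heat_kernel (t - r + (s - r)) (x - y))"
        using True st by (intro heat_kernel_semigroup) auto
      finally show ?thesis using True by (simp add: algebra_simps)
    next
      case False
      then show ?thesis by (auto simp: stoch_conv_kernel_def)
    qed
  qed
  \<comment> \<open>Reversal of time, r = s - u; the half-open interval for r becomes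
    \<open>{0<..s}\<close> for u.\<close>
  also have "\<dots> = (\<integral>\<^sup>+u. ennreal (indicator {0..<s} (s + (- 1) * u) * heat_kernel (t + s - 2 * (s
      + (- 1) * u)) (x - y)) \<partial>lborel)"
    by (subst nn_integral_real_affine[where c="-1" and t=s]) auto
  also have "\<dots> = noise_integral (t - s) (x - y) s"
    unfolding noise_integral_def by (intro nn_integral_cong) (auto simp: indicator_def algebra_simps)
  finally show ?thesis .
qed

lemma sqrt_frac_deriv:
  assumes "0 < u + h"
  shows "((\<lambda>u. sqrt ((u + h) / (2 * pi))) has_real_derivative heat_kernel (2 * h + 2 * u) 0) (at u)"
proof -
  have e: "sqrt (8 * (pi * w)) = 2 * (2 * pi) * sqrt (w / (2 * pi))" if "0 < w" for w
  proof -
    have "8 * (pi * w) = (2 * (2 * pi))\<^sup>2 * (w / (2 * pi))" by (simp add: power2_eq_square)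
    then have "sqrt (8 * (pi * w)) = sqrt ((2 * (2 * pi))\<^sup>2) * sqrt (w / (2 * pi))"
      by (simp only: real_sqrt_mult)
    then show ?thesis by (simp only: real_sqrt_abs) simp
  qed
  have "((\<lambda>u. sqrt ((u + h) / (2 * pi))) has_real_derivative inverse (sqrt ((u + h) / (2 * pi))) / 2
      * (1 / (2 * pi))) (at u)"
    using divide_pos_pos[OF assms, of "2 * pi"] by (auto intro!: derivative_eq_intros)
  moreover have "heat_kernel (2 * h + 2 * u) 0 = inverse (sqrt ((u + h) / (2 * pi))) / 2 * (1 / (2 * pi))"
    using e[OF assms] by (simp add: heat_kernel_def field_simps)
  ultimately show ?thesis by simp
qed

lemma heat_kernel_diag_integral:
  assumes "0 \<le> h" "0 \<le> \<alpha>" "\<alpha> \<le> \<beta>"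
  shows "(\<integral>\<^sup>+u. ennreal (indicator {\<alpha><..\<beta>} u * heat_kernel (2 * h + 2 * u) 0) \<partial>lborel)
    = ennreal (sqrt ((\<beta> + h) / (2 * pi)) - sqrt ((\<alpha> + h) / (2 * pi)))"
  by (rule nn_integral_FTC_Ioc[where F="\<lambda>u. sqrt ((u + h) / (2 * pi))"])
    (use assms in \<open>auto intro!: continuous_intros sqrt_frac_deriv heat_kernel_nonneg\<close>)

lemma noise_integral_diag: "0 \<le> s \<Longrightarrow> noise_integral 0 0 s = ennreal (sqrt (s / (2 * pi)))"
  using heat_kernel_diag_integral[of 0 0 s] by (simp add: noise_integral_def)

lemma st_L2_stoch_conv_kernel: "0 \<le> t \<Longrightarrow> st_L2 (stoch_conv_kernel t x)"
  using stoch_conv_kernel_nn_integral[of t t x x] noise_integral_diag[of t]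
  unfolding st_L2_def
  by (auto simp: integrable_iff_bounded power2_eq_square mult.assoc abs_mult
      stoch_conv_kernel_nonneg abs_of_nonneg)

definition noise_cov :: "real \<Rightarrow> real \<Rightarrow> real \<Rightarrow> real" where
  "noise_cov h a s = enn2real (noise_integral h a s)"

lemma st_inner_stoch_conv_kernel:
  assumes "0 \<le> s" "s \<le> t"
  shows "st_inner (stoch_conv_kernel t x) (stoch_conv_kernel s y) = noise_cov (t - s) (x - y) s"
  unfolding st_inner_def noise_cov_def stoch_conv_kernel_nn_integral[OF assms, symmetric]
  by (rule integral_eq_nn_integral) (auto simp: stoch_conv_kernel_nonneg)

section \<open>Upper and lower bounds for the covariance of the noise\<close>

lemma noise_cov_diag: "0 \<le> s \<Longrightarrow> noise_cov 0 0 s = sqrt (s / (2 * pi))"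
  by (simp add: noise_cov_def noise_integral_diag)

lemma noise_cov_nonneg: "0 \<le> noise_cov h a s"
  by (simp add: noise_cov_def)

lemma heat_kernel_le: "0 \<le> h \<Longrightarrow> 0 < w \<Longrightarrow> heat_kernel (h + w) a \<le> heat_kernel w 0"
proof -
  assume h: "0 \<le> h" "0 < w"
  have "exp (- a\<^sup>2 / (4 * (h + w))) / sqrt (4 * pi * (h + w)) \<le> 1 / sqrt (4 * pi * w)"
    using h by (intro frac_le) (auto simp: divide_nonpos_pos)
  then show ?thesis by (simp add: heat_kernel_def)
qed

lemma noise_integral_le: 
  assumes "0 \<le> h" "0 \<le> s"
  shows "noise_integral h a s \<le> ennreal (sqrt (s / (2 * pi)))"
  unfolding noise_integral_diag[OF assms(2), symmetric] noise_integral_def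
proof (intro nn_integral_mono ennreal_leI)
  fix u :: real
  show "indicator {0<..s} u * heat_kernel (h + 2 * u) a \<le> indicator {0<..s} u * heat_kernel (0 + 2 * u) 0"
    using heat_kernel_le[OF assms(1), of "2 * u" a] by (simp add: indicator_def)
qed

lemma noise_integral_eq: "0 \<le> h \<Longrightarrow> 0 \<le> s \<Longrightarrow> noise_integral h a s = ennreal (noise_cov h a s)"
  unfolding noise_cov_def
  by (rule ennreal_enn2real[symmetric]) (rule le_less_trans[OF noise_integral_le ennreal_less_top])

text \<open>The kernel is at most its maximum at time h, on an interval of length s. This is
  effective when s is much smaller than h, that is, across distant scales.\<close>

lemma noise_cov_le_separated:
  assumes "0 < h" "0 \<le> s"
  shows "noise_cov h a s \<le> s / sqrt (4 * pi * h)"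
proof -
  have "noise_integral h a s \<le> (\<integral>\<^sup>+u. ennreal (1 / sqrt (4 * pi * h)) * indicator {0<..s} u \<partial>lborel)"
    unfolding noise_integral_def
  proof (rule nn_integral_mono)
    fix u :: real
    have "heat_kernel (h + 2 * u) a \<le> 1 / sqrt (4 * pi * h)" if "0 < u"
      using that assms heat_kernel_le[of "2 * u" h a] by (simp add: heat_kernel_def add.commute)
    then show "ennreal (indicator {0<..s} u * heat_kernel (h + 2 * u) a)
        \<le> ennreal (1 / sqrt (4 * pi * h)) * indicator {0<..s} u"
      by (auto simp: indicator_def intro!: ennreal_leI)
  qed
  also have "\<dots> = ennreal (s / sqrt (4 * pi * h))"
    using assms by (simp add: nn_integral_cmult_indicator flip: ennreal_mult)
  finally show ?thesis using assms by (simp add: noise_integral_eq ennreal_le_iff)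
qed

lemma exp_minus_ge:
  fixes z :: real
  assumes z: "0 \<le> z"
  shows "1 \<le> exp (- z) + 2 * z / (1 + z)"
proof (cases "z \<le> 1")
  case True
  have "z * z \<le> z" using mult_left_mono[OF True z] by simp
  then have "z \<le> 2 * z / (1 + z)" using z by (simp add: pos_le_divide_eq distrib_left)
  then show ?thesis using exp_ge_add_one_self[of "- z"] by linarith
next
  case False
  then have "1 \<le> 2 * z / (1 + z)" using z by (simp add: pos_le_divide_eq)
  then show ?thesis using exp_gt_zero[of "- z"] by linarith
qed

text \<open>The bound \<open>1 \<le> exp (- z) + 2 * z / (1 + z)\<close> is chosen because, at \<open>z = b / w\<close>, the
  correction term has an elementary integral against \<open>1 / sqrt w\<close>.\<close>
lemma noise_cov_ge:
  assumes h: "0 \<le> h" and s: "0 \<le> s"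
  shows "sqrt (s / (2 * pi)) - sqrt h - \<bar>a\<bar> \<le> noise_cov h a s"
proof -
  \<comment> \<open>Chosen so that the exponent of the heat kernel at time w is
    \<open>- (b / w)\<close>.\<close>
  define b where "b = a\<^sup>2 / 4"
  have b: "0 \<le> b" "sqrt b = \<bar>a\<bar> / 2" by (auto simp: b_def real_sqrt_divide)
  let ?g = "\<lambda>u. 2 * b / ((h + 2 * u + b) * sqrt (4 * pi * (h + 2 * u)))"
  let ?k = "\<lambda>u. 1 / sqrt (4 * pi * (h + 2 * u))"
  \<comment> \<open>A primitive of the correction \<open>?g\<close>. Since arctan stays below pi /
    2, its total increase is at most \<open>sqrt b * sqrt pi / 2\<close>, which is at most
    \<open>\<bar>a\<bar>\<close>.\<close>
  let ?G = "\<lambda>u. sqrt b / sqrt pi * arctan (sqrt ((h + 2 * u) / b))"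
  have k: "(\<integral>\<^sup>+u. ennreal (indicator {0<..s} u * ?k u) \<partial>lborel)
      = ennreal (sqrt (h + 2 * s) / sqrt (4 * pi) - sqrt (h + 2 * 0) / sqrt (4 * pi))"
  proof (rule nn_integral_FTC_Ioc[where F="\<lambda>u. sqrt (h + 2 * u) / sqrt (4 * pi)"])
    show "((\<lambda>u. sqrt (h + 2 * u) / sqrt (4 * pi)) has_real_derivative ?k u) (at u)" if "0 < u" for u
    proof -
      have "((\<lambda>u. sqrt (h + 2 * u) / sqrt (4 * pi)) has_real_derivative (inverse (sqrt (h + 2 * u))
          / 2 * 2) / sqrt (4 * pi)) (at u)"
        using that h by (intro DERIV_cdivide) (auto intro!: derivative_eq_intros)
      moreover have "sqrt (4 * pi * (h + 2 * u)) = sqrt (4 * pi) * sqrt (h + 2 * u)" by (rule real_sqrt_mult)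
      ultimately show ?thesis by (simp add: field_simps)
    qed
  qed (use s h in \<open>auto intro!: continuous_intros\<close>)
  have g: "(\<integral>\<^sup>+u. ennreal (indicator {0<..s} u * ?g u) \<partial>lborel) \<le> ennreal \<bar>a\<bar>"
  proof (cases "a = 0")
    case True then show ?thesis by (simp add: b_def)
  next
    case False
    then have b0: "0 < b" by (simp add: b_def)
    have "(\<integral>\<^sup>+u. ennreal (indicator {0<..s} u * ?g u) \<partial>lborel) = ennreal (?G s - ?G 0)"
    proof (rule nn_integral_FTC_Ioc)
      show "(?G has_real_derivative ?g u) (at u)" if u: "0 < u" for u
      proof -
        let ?w = "h + 2 * u"
        have w: "0 < ?w" using u h by simp
        have "(?G has_real_derivative sqrt b / sqrt pi * (inverse (1 + (sqrt (?w / b))\<^sup>2)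
            * (inverse (sqrt (?w / b)) / 2 * (2 / b)))) (at u)"
          by (rule DERIV_cmult) (use divide_pos_pos[OF w b0] in \<open>auto intro!: derivative_eq_intros\<close>)
        also have "sqrt b / sqrt pi * (inverse (1 + (sqrt (?w / b))\<^sup>2) * (inverse (sqrt (?w / b))
            / 2 * (2 / b))) = ?g u"
        proof -
          have "(sqrt (?w / b))\<^sup>2 = ?w / b" using w b0 by simp
          moreover have "inverse (1 + ?w / b) = b / (?w + b)" using w b0 by (simp add: field_simps)
          moreover have "inverse (sqrt (?w / b)) = sqrt b / sqrt ?w" by (simp add: real_sqrt_divide)
          moreover have "sqrt (4 * pi * ?w) = 2 * sqrt pi * sqrt ?w" by (simp add: real_sqrt_mult)
          moreover have "sqrt b / sqrt pi * (b / (?w + b) * (sqrt b / sqrt ?w / 2 * (2 / b)))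
              = (sqrt b * sqrt b) / ((?w + b) * (sqrt pi * sqrt ?w))"
          proof -
            have "r / P * (c / X * (r / R / 2 * (2 / c))) = (r * r) / (X * (P * R))" if "c \<noteq> 0"
                for r P c X R :: real
              using that by (simp add: divide_simps)
            then show ?thesis using b0 by simp
          qed
          ultimately show ?thesis using b0 by (simp add: mult_ac)
        qed
        finally show ?thesis .
      qed
    qed (use s h b0 in \<open>auto intro!: continuous_intros\<close>)
    also have "\<dots> \<le> ennreal \<bar>a\<bar>"
    proof (rule ennreal_leI)
      have "?G s \<le> sqrt b / sqrt pi * (pi / 2)"
        using b arctan_ubound by (intro mult_left_mono) (auto simp: less_imp_le)
      moreover have "0 \<le> ?G 0" using b h by (simp add: zero_le_arctan_iff)
      moreover have "sqrt b / sqrt pi * (pi / 2) = \<bar>a\<bar> * sqrt pi / 4"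
        unfolding b(2) by (simp add: field_simps real_div_sqrt)
      moreover have "sqrt pi \<le> 4" using pi_less_4 by (intro real_le_lsqrt) auto
      then have "\<bar>a\<bar> * sqrt pi / 4 \<le> \<bar>a\<bar>" using mult_left_mono[of "sqrt pi" 4 "\<bar>a\<bar>"] by simp
      ultimately show "?G s - ?G 0 \<le> \<bar>a\<bar>" by linarith
    qed
    finally show ?thesis .
  qed
  have "(\<integral>\<^sup>+u. ennreal (indicator {0<..s} u * ?k u) \<partial>lborel)
     \<le> (\<integral>\<^sup>+u. ennreal (indicator {0<..s} u * heat_kernel (h + 2 * u) a)
         + ennreal (indicator {0<..s} u * ?g u) \<partial>lborel)"
  proof (rule nn_integral_mono)
    fix u :: real
    show "ennreal (indicator {0<..s} u * ?k u)
        \<le> ennreal (indicator {0<..s} u * heat_kernel (h + 2 * u) a) + ennreal (indicator {0<..s} u * ?g u)"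
    proof (cases "u \<in> {0<..s}")
      case True
      then have w: "0 < h + 2 * u" using h by simp
      let ?w = "h + 2 * u" let ?z = "b / ?w"
      have z: "0 \<le> ?z" using w b by simp
      have "1 + ?z = (?w + b) / ?w" using w by (simp add: add_divide_distrib)
      then have "2 * ?z / (1 + ?z) = 2 * b / (?w + b)" using w by simp
      from exp_minus_ge[OF z, unfolded this] have "1 \<le> exp (- ?z) + 2 * b / (?w + b)" .
      then have "1 / sqrt (4 * pi * ?w) \<le> (exp (- ?z) + 2 * b / (?w + b)) / sqrt (4 * pi * ?w)"
        using w by (intro divide_right_mono) auto
      also have "\<dots> = heat_kernel ?w a + ?g u"
        by (simp add: heat_kernel_def b_def add_divide_distrib)
      finally have "?k u \<le> heat_kernel ?w a + ?g u" .
      then show ?thesis using True w b by (simp add: heat_kernel_nonneg flip: ennreal_plus)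
    qed simp
  qed
  also have "\<dots> = noise_integral h a s + (\<integral>\<^sup>+u. ennreal (indicator {0<..s} u * ?g u) \<partial>lborel)"
    unfolding noise_integral_def by (rule nn_integral_add) auto
  also have "\<dots> \<le> ennreal (noise_cov h a s) + ennreal \<bar>a\<bar>"
    using g h s by (intro add_mono) (simp_all add: noise_integral_eq)
  finally have "ennreal (sqrt (h + 2 * s) / sqrt (4 * pi) - sqrt h / sqrt (4 * pi))
      \<le> ennreal (noise_cov h a s + \<bar>a\<bar>)"
    unfolding k by (simp add: noise_cov_nonneg)
  then have "sqrt (h + 2 * s) / sqrt (4 * pi) - sqrt h / sqrt (4 * pi) \<le> noise_cov h a s + \<bar>a\<bar>"
    using noise_cov_nonneg[of h a s] by (subst (asm) ennreal_le_iff) auto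
  moreover have "sqrt (s / (2 * pi)) \<le> sqrt (h + 2 * s) / sqrt (4 * pi)"
    using h s by (simp add: divide_simps flip: real_sqrt_divide)
  moreover have "sqrt h / sqrt (4 * pi) \<le> sqrt h"
    using pi_ge_two h by (simp add: divide_le_eq mult_le_cancel_left1)
  ultimately show ?thesis by linarith
qed

section \<open>Nondegeneracy of the noise at two points\<close>

lemma heat_kernel_geometric:
  assumes h: "0 \<le> h" and u: "0 < u"
  shows "(heat_kernel (h + 2 * u) a)\<^sup>2 \<le> heat_kernel (2 * u) 0 * heat_kernel (2 * h + 2 * u) 0"
proof -
  have "heat_kernel (h + 2 * u) a \<le> 1 / sqrt (4 * pi * (h + 2 * u))"
    using heat_kernel_le[of 0 "h + 2 * u" a] h u by (simp add: heat_kernel_def)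
  then have "(heat_kernel (h + 2 * u) a)\<^sup>2 \<le> (1 / sqrt (4 * pi * (h + 2 * u)))\<^sup>2"
    using h u by (intro power_mono heat_kernel_nonneg) auto
  also have "\<dots> = 1 / (4 * pi * (h + 2 * u))" using h u by (simp add: power_divide)
  also have "\<dots> \<le> 1 / sqrt ((4 * pi * (2 * u)) * (4 * pi * (2 * h + 2 * u)))"
  proof (rule frac_le)
    have "(4 * pi * (2 * u)) * (4 * pi * (2 * h + 2 * u)) \<le> (4 * pi * (h + 2 * u))\<^sup>2"
    proof -
      \<comment> \<open>The two sides differ by \<open>h\<^sup>2\<close>. This is the core of a
        Cauchy-Schwarz inequality that holds already for the integrands: the covariance integrand
        against the two variance integrands at the same noise time.\<close>
      have "(2 * u) * (2 * h + 2 * u) \<le> (h + 2 * u)\<^sup>2" by (simp add: power2_eq_square algebra_simps)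
      from mult_left_mono[OF this zero_le_power2[of "4 * pi"]]
      have "(4 * pi)\<^sup>2 * ((2 * u) * (2 * h + 2 * u)) \<le> (4 * pi * (h + 2 * u))\<^sup>2"
        by (simp only: power_mult_distrib)
      moreover have "(4 * pi * (2 * u)) * (4 * pi * (2 * h + 2 * u))
          = (4 * pi)\<^sup>2 * ((2 * u) * (2 * h + 2 * u))"
        by (simp only: power2_eq_square mult_ac)
      ultimately show ?thesis by linarith
    qed
    then show "sqrt ((4 * pi * (2 * u)) * (4 * pi * (2 * h + 2 * u))) \<le> 4 * pi * (h + 2 * u)"
      using h u by (intro real_le_lsqrt) auto
    show "0 < sqrt (4 * pi * (2 * u) * (4 * pi * (2 * h + 2 * u)))" using h u by simp
  qed auto
  also have "\<dots> = heat_kernel (2 * u) 0 * heat_kernel (2 * h + 2 * u) 0"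
  proof -
    have "heat_kernel w 0 = 1 / sqrt (4 * pi * w)" for w by (simp add: heat_kernel_def)
    moreover have "1 / sqrt (x * y) = (1 / sqrt x) * (1 / sqrt y)" for x y by (simp add: real_sqrt_mult)
    ultimately show ?thesis by (simp only:)
  qed
  finally show ?thesis .
qed

text \<open>For \<open>u > \<theta>\<close> the integrand of the quadratic form is merely nonnegative; the gain comes from \<open>u \<le> \<theta>\<close>,
  where the two kernels are nearly orthogonal.\<close>
lemma noise_cov_quadratic:
  assumes h: "0 \<le> h" and \<theta>: "0 \<le> \<theta>" "\<theta> \<le> s" and \<kappa>: "0 \<le> \<kappa>"
    and small: "\<And>u. 0 < u \<Longrightarrow> u \<le> \<theta> \<Longrightarrow> heat_kernel (h + 2 * u) a \<le> \<kappa> * heat_kernel (2 * u) 0"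
  shows "2 * \<bar>c\<bar> * noise_cov h a s \<le> 2 * \<bar>c\<bar> * \<kappa> * sqrt (\<theta> / (2 * pi)) +
     c\<^sup>2 * (sqrt (s / (2 * pi)) - sqrt (\<theta> / (2 * pi))) + (sqrt ((s + h) / (2 * pi)) - sqrt ((\<theta> + h)
         / (2 * pi)))"
proof -
  let ?A = "\<lambda>u. ennreal (indicator {0<..\<theta>} u * heat_kernel (2 * 0 + 2 * u) 0)"
  let ?B = "\<lambda>u. ennreal (indicator {\<theta><..s} u * heat_kernel (2 * 0 + 2 * u) 0)"
  let ?C = "\<lambda>u. ennreal (indicator {\<theta><..s} u * heat_kernel (2 * h + 2 * u) 0)"
  have s: "0 \<le> s" using \<theta> by simp
  have m1: "sqrt (\<theta> / (2 * pi)) \<le> sqrt (s / (2 * pi))" "sqrt ((\<theta> + h) / (2 * pi)) \<le> sqrt ((s + h) / (2 * pi))"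
    using \<theta> by (auto intro!: divide_right_mono)
  have "ennreal (2 * \<bar>c\<bar> * noise_cov h a s) = ennreal (2 * \<bar>c\<bar>) * noise_integral h a s"
    using h s by (simp add: noise_integral_eq ennreal_mult noise_cov_nonneg)
  also have "\<dots> = (\<integral>\<^sup>+u. ennreal (2 * \<bar>c\<bar>) * ennreal (indicator {0<..s} u * heat_kernel (h + 2
      * u) a) \<partial>lborel)"
    unfolding noise_integral_def by (rule nn_integral_cmult[symmetric]) measurable
  also have "\<dots> \<le> (\<integral>\<^sup>+u. ennreal (2 * \<bar>c\<bar> * \<kappa>) * ?A u + (ennreal (c\<^sup>2) * ?B u + ?C u) \<partial>lborel)"
  proof (rule nn_integral_mono)
    fix u :: real
    consider "u \<notin> {0<..s}" | "0 < u" "u \<le> \<theta>" | "\<theta> < u" "u \<le> s" "0 < u" using \<theta> by force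
    then show "ennreal (2 * \<bar>c\<bar>) * ennreal (indicator {0<..s} u * heat_kernel (h + 2 * u) a)
       \<le> ennreal (2 * \<bar>c\<bar> * \<kappa>) * ?A u + (ennreal (c\<^sup>2) * ?B u + ?C u)"
    proof cases
      case 1 then show ?thesis by simp
    next
      case 2
      have "2 * \<bar>c\<bar> * heat_kernel (h + 2 * u) a \<le> 2 * \<bar>c\<bar> * (\<kappa> * heat_kernel (2 * u) 0)"
        by (intro mult_left_mono small 2) simp
      then show ?thesis using 2 \<theta> \<kappa> h by (simp add: heat_kernel_nonneg mult.assoc flip: ennreal_mult)
    next
      case 3
      let ?g = "heat_kernel (h + 2 * u) a" and ?p = "heat_kernel (2 * u) 0"
          and ?q = "heat_kernel (2 * h + 2 * u) 0"
      have pq: "0 \<le> ?p" "0 \<le> ?q" "0 \<le> ?g" using 3 h by (auto intro!: heat_kernel_nonneg)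
      have "?g \<le> sqrt ?p * sqrt ?q"
        using real_sqrt_le_mono[OF heat_kernel_geometric[OF h 3(3), of a]] pq by (simp add: real_sqrt_mult)
      then have "2 * \<bar>c\<bar> * ?g \<le> 2 * \<bar>c\<bar> * (sqrt ?p * sqrt ?q)" by (rule mult_left_mono) simp
      also have "\<dots> \<le> (\<bar>c\<bar> * sqrt ?p)\<^sup>2 + (sqrt ?q)\<^sup>2"
        using sum_squares_bound[of "\<bar>c\<bar> * sqrt ?p" "sqrt ?q"] by (simp add: mult_ac)
      also have "\<dots> = c\<^sup>2 * ?p + ?q" using pq by (simp add: power_mult_distrib)
      finally have "2 * \<bar>c\<bar> * ?g \<le> c\<^sup>2 * ?p + ?q" .
      then show ?thesis using 3 pq by (simp flip: ennreal_mult ennreal_plus)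
    qed
  qed
  also have "\<dots> = ennreal (2 * \<bar>c\<bar> * \<kappa>) * (\<integral>\<^sup>+u. ?A u \<partial>lborel) + (ennreal (c\<^sup>2)
      * (\<integral>\<^sup>+u. ?B u \<partial>lborel) + (\<integral>\<^sup>+u. ?C u \<partial>lborel))"
    by (simp add: nn_integral_add nn_integral_cmult)
  also have "\<dots> = ennreal (2 * \<bar>c\<bar> * \<kappa> * sqrt (\<theta> / (2 * pi)) +
     (c\<^sup>2 * (sqrt (s / (2 * pi)) - sqrt (\<theta> / (2 * pi))) + (sqrt ((s + h) / (2 * pi)) - sqrt ((\<theta> + h)
         / (2 * pi)))))"
    using heat_kernel_diag_integral[of 0 0 \<theta>] heat_kernel_diag_integral[of 0 \<theta> s]
        heat_kernel_diag_integral[of h \<theta> s] \<theta> h \<kappa> m1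
    by (simp only: flip: ennreal_mult ennreal_plus) (simp flip: ennreal_mult ennreal_plus)
  finally show ?thesis
    using \<theta> \<kappa> m1 by (subst (asm) ennreal_le_iff) (auto intro!: add_nonneg_nonneg mult_nonneg_nonneg)
qed

text \<open>The right side is the variance of the noise part at the later point minus c times the
  noise part at the earlier one. As the bound is uniform in c, it bounds from below the variance
  that remains after the best linear prediction. The assumption on a guarantees that the cut-off
  \<open>a\<^sup>2 / 16\<close> used for close times does not exceed s; the constant 48 is dictated
  by that case.\<close>

lemma noise_nondegenerate:
  assumes h: "0 \<le> h" and s: "0 \<le> s" and a: "a\<^sup>2 \<le> 16 * s"
  shows "(sqrt h + \<bar>a\<bar>) / 48 \<le> sqrt ((s + h) / (2 * pi)) - 2 * c * noise_cov h a s + c\<^sup>2 * sqrt (s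
      / (2 * pi))"
proof -
  have pi3: "sqrt (2 * pi) \<le> 3" using pi_less_4 by (intro real_le_lsqrt) auto
  have cle: "2 * c * noise_cov h a s \<le> 2 * \<bar>c\<bar> * noise_cov h a s"
    by (intro mult_right_mono noise_cov_nonneg) auto
  show ?thesis
  proof (cases "a\<^sup>2 / 8 \<le> h")
    case True
    \<comment> \<open>The cut-off is 0 here. What is left over is
      \<open>sqrt (h / (2 * pi))\<close>, the variance of the noise between the two times, which
      acts on the later point only.\<close>
    have "2 * \<bar>c\<bar> * noise_cov h a s \<le> c\<^sup>2 * sqrt (s / (2 * pi)) + (sqrt ((s + h) / (2 * pi))
        - sqrt (h / (2 * pi)))"
      using noise_cov_quadratic[of h 0 s 0 a c] h s by simp
    moreover have "(sqrt h + \<bar>a\<bar>) / 48 \<le> sqrt (h / (2 * pi))"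
    proof -
      have "\<bar>a\<bar> \<le> 3 * sqrt h"
      proof -
        have "\<bar>a\<bar> = sqrt (a\<^sup>2)" by simp
        also have "\<dots> \<le> sqrt (9 * h)" using True h by (intro real_sqrt_le_mono) linarith
        finally show ?thesis by (simp add: real_sqrt_mult)
      qed
      then have "(sqrt h + \<bar>a\<bar>) / 48 \<le> sqrt h / 3" using h by simp
      also have "\<dots> \<le> sqrt h / sqrt (2 * pi)" using pi3 h by (intro divide_left_mono) auto
      finally show ?thesis by (simp add: real_sqrt_divide)
    qed
    ultimately show ?thesis using cle by linarith
  next
    case False
    \<comment> \<open>From \<open>h < a\<^sup>2 / 8\<close> and
      \<open>u \<le> a\<^sup>2 / 16\<close> it follows that
      \<open>4 * (h + 2 * u) \<le> a\<^sup>2\<close>, so the Gaussian factor is at most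
      \<open>exp (- 1)\<close>.\<close>
    let ?\<theta> = "a\<^sup>2 / 16" and ?k = "exp (- 1) :: real"
    have a0: "0 < a\<^sup>2" using False h by (cases "a = 0") auto
    have small: "heat_kernel (h + 2 * u) a \<le> ?k * heat_kernel (2 * u) 0" if u: "0 < u" "u \<le> ?\<theta>" for u
    proof -
      have w: "0 < h + 2 * u" "4 * (h + 2 * u) \<le> a\<^sup>2" using u False h by auto
      then have "1 \<le> a\<^sup>2 / (4 * (h + 2 * u))" by (simp add: pos_le_divide_eq)
      then have "exp (- a\<^sup>2 / (4 * (h + 2 * u))) \<le> ?k" by simp
      then have "exp (- a\<^sup>2 / (4 * (h + 2 * u))) / sqrt (4 * pi * (h + 2 * u)) \<le> ?k / sqrt (4 * pi * (2 * u))"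
        using u h by (intro frac_le) auto
      then show ?thesis by (simp add: heat_kernel_def)
    qed
    let ?r = "sqrt (?\<theta> / (2 * pi))"
    have q: "2 * \<bar>c\<bar> * noise_cov h a s \<le> 2 * \<bar>c\<bar> * ?k * ?r + c\<^sup>2 * (sqrt (s / (2 * pi)) - ?r)
        + (sqrt ((s + h) / (2 * pi)) - sqrt ((?\<theta> + h) / (2 * pi)))"
      by (rule noise_cov_quadratic[OF h _ _ _ small]) (use a in auto)
    have r: "?r \<le> sqrt ((?\<theta> + h) / (2 * pi))" using h by (intro real_sqrt_le_mono divide_right_mono) auto
    \<comment> \<open>The coefficient of the gain is a quadratic in \<open>\<bar>c\<bar>\<close>;
      since \<open>exp (- 1) \<le> 1 / 2\<close>, it stays away from 0 for every c.\<close>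
    have "1 / 2 \<le> 1 - 2 * \<bar>c\<bar> * ?k + c\<^sup>2"
    proof -
      have "(2::real) \<le> exp 1" using exp_ge_add_one_self[of 1] by simp
      then have k: "?k \<le> 1 / 2" by (simp add: exp_minus field_simps)
      have "2 * \<bar>c\<bar> * ?k \<le> \<bar>c\<bar>" using mult_left_mono[OF k, of "2 * \<bar>c\<bar>"] by simp
      moreover have "\<bar>c\<bar> \<le> c\<^sup>2 + 1 / 2"
        using zero_le_power2[of "\<bar>c\<bar> - 1 / 2"] by (simp add: power2_diff power_divide)
      ultimately show ?thesis by linarith
    qed
    then have "(1 / 2) * ?r \<le> (1 - 2 * \<bar>c\<bar> * ?k + c\<^sup>2) * ?r" by (rule mult_right_mono) simp
    then have Q: "?r / 2 \<le> ?r - 2 * \<bar>c\<bar> * ?k * ?r + c\<^sup>2 * ?r" by (simp add: algebra_simps)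
    have "(sqrt h + \<bar>a\<bar>) / 48 \<le> ?r / 2"
    proof -
      have "sqrt h \<le> sqrt (a\<^sup>2)" using False h by (intro real_sqrt_le_mono) linarith
      then have "(sqrt h + \<bar>a\<bar>) / 48 \<le> \<bar>a\<bar> / 4 / 3 / 2" by simp
      also have "\<bar>a\<bar> / 4 / 3 \<le> \<bar>a\<bar> / 4 / sqrt (2 * pi)" using pi3 by (intro divide_left_mono) auto
      also have "\<dots> = sqrt (a\<^sup>2 / 16) / sqrt (2 * pi)" by (simp add: real_sqrt_divide)
      also have "\<dots> = ?r" by (rule real_sqrt_divide[symmetric])
      finally show ?thesis by simp
    qed
    moreover have "c\<^sup>2 * (sqrt (s / (2 * pi)) - ?r) = c\<^sup>2 * sqrt (s / (2 * pi)) - c\<^sup>2 * ?r"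
        by (simp add: algebra_simps)
    ultimately show ?thesis using Q q r cle by linarith
  qed
qed

section \<open>Covariance of the string\<close>

lemma measure_std_normal_UNIV[simp]: "measure std_normal_distribution UNIV = 1"
  using std_normal.prob_space by simp

lemma integrable_affine_std_normal: "integrable std_normal_distribution (\<lambda>n. x + c * n)"
  using integrable_std_normal_distribution_moment[of 1] by simp

lemma integral_affine_std_normal: "(\<integral>n. x + c * n \<partial>std_normal_distribution) = x"
  using integrable_std_normal_distribution_moment[of 1] integral_std_normal_distribution_moment_odd[of 1]
  by simp

lemma integrable_abs_std_normal: "integrable std_normal_distribution (\<lambda>n. \<bar>n\<bar>)"
  using integrable_std_normal_distribution_moment[of 1] by simp

lemma integral_abs_std_normal_le: "(\<integral>n. \<bar>n\<bar> \<partial>std_normal_distribution) \<le> 1"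
proof -
  have "(\<integral>n. \<bar>n\<bar> \<partial>std_normal_distribution)\<^sup>2 \<le> (\<integral>n. \<bar>n\<bar>\<^sup>2 \<partial>std_normal_distribution)"
    by (rule std_normal.integral_square_le) (use std_normal_distribution_even_moments(2)[of 1] in simp_all)
  also have "\<dots> = 1" using std_normal_distribution_even_moments(1)[of 1] by (simp add: fact_numeral)
  finally have "(\<integral>n. \<bar>n\<bar> \<partial>std_normal_distribution)\<^sup>2 \<le> 1\<^sup>2" by simp
  then show ?thesis by (rule power2_le_imp_le) simp
qed

lemma integral_abs_affine_std_normal_le: "(\<integral>n. \<bar>x + c * n\<bar> \<partial>std_normal_distribution) \<le> \<bar>x\<bar> + \<bar>c\<bar>"
proof -
  have "(\<integral>n. \<bar>x + c * n\<bar> \<partial>std_normal_distribution) \<le> (\<integral>n. \<bar>x\<bar> + \<bar>c\<bar> * \<bar>n\<bar> \<partial>std_normal_distribution)"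
    using integrable_abs_std_normal integrable_affine_std_normal[of x c]
    by (intro integral_mono) (auto simp: abs_mult intro: order_trans[OF abs_triangle_ineq])
  also have "\<dots> = \<bar>x\<bar> + \<bar>c\<bar> * (\<integral>n. \<bar>n\<bar> \<partial>std_normal_distribution)"
    using integrable_abs_std_normal by simp
  also have "\<dots> \<le> \<bar>x\<bar> + \<bar>c\<bar> * 1" by (intro add_left_mono mult_left_mono integral_abs_std_normal_le) simp
  finally show ?thesis by simp
qed

lemma integral_abs_affine_std_normal_ge: "\<bar>x\<bar> \<le> (\<integral>n. \<bar>x + c * n\<bar> \<partial>std_normal_distribution)"
  using integral_norm_bound[of std_normal_distribution "\<lambda>n. x + c * n"]
      by (simp add: integral_affine_std_normal)

definition heat_cov :: "real \<Rightarrow> real \<Rightarrow> real \<Rightarrow> real \<Rightarrow> real" where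
  "heat_cov t x s y = (\<integral>n. (\<integral>m. bm_cov (x + sqrt (2 * t) * n) (y + sqrt (2 * s) * m)
     \<partial>std_normal_distribution) \<partial>std_normal_distribution)"

definition string_cov :: "real \<Rightarrow> real \<Rightarrow> real \<Rightarrow> real \<Rightarrow> real" where
  "string_cov t x s y = heat_cov t x s y + st_inner (stoch_conv_kernel t x) (stoch_conv_kernel s y)"

lemma bm_cov_measurable[measurable]:
  assumes [measurable]: "f \<in> borel_measurable N" "g \<in> borel_measurable N"
  shows "(\<lambda>z. bm_cov (f z) (g z)) \<in> borel_measurable N"
  unfolding bm_cov_def by measurable

lemma bm_cov_abs_le: "\<bar>bm_cov u w\<bar> \<le> \<bar>w\<bar>"
  by (simp add: bm_cov_def)

lemma heat_cov_abs_le: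
  assumes "0 \<le> s"
  shows "\<bar>heat_cov t x s y\<bar> \<le> \<bar>y\<bar> + sqrt (2 * s)"
proof -
  have inner: "\<bar>\<integral>m. bm_cov u (y + sqrt (2 * s) * m) \<partial>std_normal_distribution\<bar> \<le> \<bar>y\<bar> + sqrt (2 * s)" for u
  proof -
    have "\<bar>\<integral>m. bm_cov u (y + sqrt (2 * s) * m) \<partial>std_normal_distribution\<bar>
        \<le> (\<integral>m. \<bar>bm_cov u (y + sqrt (2 * s) * m)\<bar> \<partial>std_normal_distribution)"
      by (rule integral_abs_bound)
    also have "\<dots> \<le> (\<integral>m. \<bar>y + sqrt (2 * s) * m\<bar> \<partial>std_normal_distribution)"
      using integrable_affine_std_normal[of y "sqrt (2 * s)"]
      by (intro integral_mono' bm_cov_abs_le) auto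
    also have "\<dots> \<le> \<bar>y\<bar> + sqrt (2 * s)"
      using integral_abs_affine_std_normal_le[of y "sqrt (2 * s)"] assms by simp
    finally show ?thesis .
  qed
  have "\<bar>heat_cov t x s y\<bar> \<le> (\<integral>n. \<bar>\<integral>m. bm_cov (x + sqrt (2 * t) * n) (y + sqrt (2 * s)
      * m) \<partial>std_normal_distribution\<bar> \<partial>std_normal_distribution)"
    unfolding heat_cov_def by (rule integral_abs_bound)
  also have "\<dots> \<le> (\<integral>n. \<bar>y\<bar> + sqrt (2 * s) \<partial>std_normal_distribution)"
    using inner assms by (intro integral_mono') (auto intro: order_trans[OF abs_ge_zero inner])
  also have "\<dots> = \<bar>y\<bar> + sqrt (2 * s)" by simp
  finally show ?thesis .
qed

text \<open>Bounding the distance of the two sample points by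
  \<open>c * \<bar>n\<bar> + c * \<bar>m\<bar>\<close>, with c = sqrt (2 t), separates the variables
  n and m. Only first absolute moments remain: Jensen bounds the mean of
  \<open>\<bar>x + c * n\<bar>\<close> from below by \<open>\<bar>x\<bar>\<close>, and the mean of
  \<open>\<bar>n\<bar>\<close> is at most 1.\<close>

lemma heat_cov_diag_ge:
  assumes "0 \<le> t"
  shows "\<bar>x\<bar> - sqrt (2 * t) \<le> heat_cov t x t x"
proof -
  let ?c = "sqrt (2 * t)"
  let ?I = "\<integral>n. \<bar>x + ?c * n\<bar> \<partial>std_normal_distribution"
  let ?J = "\<integral>n. \<bar>n\<bar> \<partial>std_normal_distribution"
  note ints = integrable_abs_std_normal integrable_abs[OF integrable_affine_std_normal[of x ?c]]
  have c: "0 \<le> ?c" using assms by simp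
  have pt: "(\<bar>x + ?c * n\<bar> - ?c * \<bar>n\<bar>) / 2 + (\<bar>x + ?c * m\<bar> - ?c * \<bar>m\<bar>) / 2
      \<le> bm_cov (x + ?c * n) (x + ?c * m)" for n m
  proof -
    have "\<bar>(x + ?c * n) - (x + ?c * m)\<bar> = \<bar>?c * n - ?c * m\<bar>" by simp
    also have "\<dots> \<le> \<bar>?c * n\<bar> + \<bar>?c * m\<bar>" by (rule abs_triangle_ineq4)
    also have "\<dots> = ?c * \<bar>n\<bar> + ?c * \<bar>m\<bar>" using assms by (simp add: abs_mult)
    finally show ?thesis unfolding bm_cov_def by argo
  qed
  have ib: "integrable std_normal_distribution (\<lambda>m. bm_cov u (x + ?c * m))" for u
    by (rule Bochner_Integration.integrable_bound[OF integrable_affine_std_normal[of x ?c]])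
      (auto intro!: bm_cov_abs_le)
  let ?H = "\<lambda>n. \<integral>m. bm_cov (x + ?c * n) (x + ?c * m) \<partial>std_normal_distribution"
  have in1: "(\<bar>x + ?c * n\<bar> - ?c * \<bar>n\<bar>) / 2 + (?I - ?c * ?J) / 2 \<le> ?H n" for n
  proof -
    have "(\<integral>m. (\<bar>x + ?c * n\<bar> - ?c * \<bar>n\<bar>) / 2 + (\<bar>x + ?c * m\<bar> - ?c * \<bar>m\<bar>) / 2 \<partial>std_normal_distribution) \<le> ?H n"
      by (rule integral_mono[OF _ ib pt]) (use ints in auto)
    then show ?thesis using ints by simp
  qed
  have Hle: "\<bar>?H n\<bar> \<le> \<bar>x\<bar> + ?c" for n
  proof -
    have "\<bar>?H n\<bar> \<le> (\<integral>m. \<bar>bm_cov (x + ?c * n) (x + ?c * m)\<bar> \<partial>std_normal_distribution)"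
        by (rule integral_abs_bound)
    also have "\<dots> \<le> (\<integral>m. \<bar>x + ?c * m\<bar> \<partial>std_normal_distribution)"
      using ints(2) by (intro integral_mono' bm_cov_abs_le) auto
    also have "\<dots> \<le> \<bar>x\<bar> + ?c" using integral_abs_affine_std_normal_le[of x ?c] c by simp
    finally show ?thesis .
  qed
  have Hm: "?H \<in> borel_measurable std_normal_distribution"
    by (rule std_normal.borel_measurable_lebesgue_integral) measurable
  have Hi: "integrable std_normal_distribution ?H"
    by (rule std_normal.integrable_const_bound[where B="\<bar>x\<bar> + ?c"]) (use Hle Hm in auto)
  have "(\<integral>n. (\<bar>x + ?c * n\<bar> - ?c * \<bar>n\<bar>) / 2 + (?I - ?c * ?J) / 2 \<partial>std_normal_distribution) \<le> heat_cov t x t x"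
    unfolding heat_cov_def by (rule integral_mono[OF _ Hi in1]) (use ints in auto)
  then have "?I - ?c * ?J \<le> heat_cov t x t x"
    using ints by simp
  moreover have "\<bar>x\<bar> \<le> ?I" by (rule integral_abs_affine_std_normal_ge)
  moreover have "?c * ?J \<le> ?c * 1" by (intro mult_left_mono integral_abs_std_normal_le c)
  ultimately show ?thesis by linarith
qed

lemma st_inner_diag: "0 \<le> t \<Longrightarrow> st_inner (stoch_conv_kernel t x) (stoch_conv_kernel t x) = sqrt (t / (2 * pi))"
  using st_inner_stoch_conv_kernel[of t t x x] noise_cov_diag[of t] by simp

lemma sqrt_over_two_pi: 
  assumes "0 \<le> t" shows "sqrt t / 3 \<le> sqrt (t / (2 * pi))" "sqrt (t / (2 * pi)) \<le> sqrt t / 2"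
proof -
  have "sqrt (2 * pi) \<le> 3" using pi_less_4 by (intro real_le_lsqrt) auto
  moreover have "2 \<le> sqrt (2 * pi)" using pi_ge_two by (intro real_le_rsqrt) auto
  ultimately show "sqrt t / 3 \<le> sqrt (t / (2 * pi))" "sqrt (t / (2 * pi)) \<le> sqrt t / 2"
    unfolding real_sqrt_divide using assms by (intro divide_left_mono; simp)+
qed

lemma sqrt_two_mult_le: "0 \<le> t \<Longrightarrow> sqrt (2 * t) \<le> 3 / 2 * sqrt t"
proof -
  assume "0 \<le> t"
  have "sqrt 2 \<le> 3 / 2" by (rule real_le_lsqrt) (auto simp: power2_eq_square)
  then have "sqrt 2 * sqrt t \<le> 3 / 2 * sqrt t" using \<open>0 \<le> t\<close> by (intro mult_right_mono) auto
  then show ?thesis by (simp add: real_sqrt_mult)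
qed

lemma string_var_le:
  assumes "0 \<le> t" shows "string_cov t x t x \<le> \<bar>x\<bar> + 2 * sqrt t"
  using heat_cov_abs_le[OF assms, of t x x] sqrt_over_two_pi(2)[OF assms] sqrt_two_mult_le[OF assms]
  unfolding string_cov_def st_inner_diag[OF assms] by linarith

section \<open>The string as a Gaussian field and its second moments\<close>

context noise_and_bm
begin

definition V :: "real \<Rightarrow> real \<Rightarrow> 'd \<Rightarrow> 'w \<Rightarrow> real" where
  "V t x i \<omega> = heat_avg (\<lambda>n. x + sqrt (2 * t) * n) i \<omega> + W i (stoch_conv_kernel t x) \<omega>"

lemma heat_gaussian: "heat_avg (\<lambda>n. x + c * n) i \<in> gaussian_space"
  by (rule heat_avg_gaussian[OF _ integrable_affine_std_normal]) measurable

lemma W_gaussian: "0 \<le> t \<Longrightarrow> W i (stoch_conv_kernel t x) \<in> gaussian_space"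
  by (intro base_gaussian_space W_base st_L2_stoch_conv_kernel)

lemma V_gaussian: "0 \<le> t \<Longrightarrow> V t x i \<in> gaussian_space"
  unfolding V_def[abs_def] by (intro gaussian_space_add heat_gaussian W_gaussian)

lemma V_measurable[measurable]: "0 \<le> t \<Longrightarrow> V t x i \<in> borel_measurable M"
  by (intro gaussian_space_measurable V_gaussian)

lemma heat_cov_eq:
  "(\<integral>\<omega>. heat_avg (\<lambda>n. x + sqrt (2 * t) * n) i \<omega> * heat_avg (\<lambda>n. y + sqrt (2 * s) * n) j \<omega> \<partial>M)
    = (if i = j then heat_cov t x s y else 0)"
  unfolding heat_cov_def by (rule heat_avg_cov[OF _ integrable_affine_std_normal _
      integrable_affine_std_normal]) measurable

lemma V_cov:
  assumes "0 \<le> t" "0 \<le> s"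
  shows "(\<integral>\<omega>. V t x i \<omega> * V s y j \<omega> \<partial>M) = (if i = j then string_cov t x s y else 0)"
proof -
  let ?H = "\<lambda>t x i. heat_avg (\<lambda>n. x + sqrt (2 * t) * n) i" and ?W = "\<lambda>t x i. W i (stoch_conv_kernel t x)"
  note L2 = st_L2_stoch_conv_kernel
  have i1: "integrable M (\<lambda>\<omega>. ?H t x i \<omega> * ?H s y j \<omega>)" and i2: "integrable M (\<lambda>\<omega>. ?H t x i \<omega> * ?W s y j \<omega>)"
    and i3: "integrable M (\<lambda>\<omega>. ?W t x i \<omega> * ?H s y j \<omega>)" and i4: "integrable M (\<lambda>\<omega>. ?W t x i \<omega> * ?W s y j \<omega>)"
    by (intro gaussian_space_mult_integrable heat_gaussian W_gaussian assms)+
  have HW: "(\<integral>\<omega>. ?H t x i \<omega> * ?W s y j \<omega> \<partial>M) = 0" if "0 \<le> s" for t x i s y j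
    by (rule heat_avg_W_cov[OF _ integrable_affine_std_normal L2[OF that]]) measurable
  have WH: "(\<integral>\<omega>. ?W t x i \<omega> * ?H s y j \<omega> \<partial>M) = 0" if "0 \<le> t" for t x i s y j
    by (subst mult.commute) (rule HW[OF that])
  have "(\<integral>\<omega>. V t x i \<omega> * V s y j \<omega> \<partial>M) = (\<integral>\<omega>. ?H t x i \<omega> * ?H s y j \<omega> + ?H t x i \<omega> * ?W s y j \<omega> +
      ?W t x i \<omega> * ?H s y j \<omega> + ?W t x i \<omega> * ?W s y j \<omega> \<partial>M)"
    by (simp add: V_def algebra_simps)
  also have "\<dots> = (\<integral>\<omega>. ?H t x i \<omega> * ?H s y j \<omega> \<partial>M) + (\<integral>\<omega>. ?H t x i \<omega> * ?W s y j \<omega> \<partial>M) +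
      (\<integral>\<omega>. ?W t x i \<omega> * ?H s y j \<omega> \<partial>M) + (\<integral>\<omega>. ?W t x i \<omega> * ?W s y j \<omega> \<partial>M)"
    by (simp only: i1 i2 i3 i4 Bochner_Integration.integral_add Bochner_Integration.integrable_add)
  also have "\<dots> = (if i = j then string_cov t x s y else 0)"
    unfolding heat_cov_eq HW[OF assms(2)] WH[OF assms(1)] W_cov[OF L2[OF assms(1)] L2[OF assms(2)]]
        string_cov_def by simp
  finally show ?thesis .
qed

text \<open>Obtained from the symmetry of the expectation of a product, which avoids Fubini for the
  double integral in \<open>heat_cov\<close>. Here and below \<open>undefined\<close> stands for an
  arbitrary component.\<close>

lemma string_cov_sym:
  assumes "0 \<le> t" "0 \<le> s" shows "string_cov t x s y = string_cov s y t x"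
  using V_cov[OF assms, of x undefined y undefined] V_cov[OF assms(2,1), of y undefined x undefined]
  by (simp add: mult.commute)

lemma heat_cov_diff_square:
  "(\<integral>\<omega>. (heat_avg (\<lambda>n. x + sqrt (2 * t) * n) i \<omega> - c * heat_avg (\<lambda>n. y + sqrt (2 * s) * n) i \<omega>)\<^sup>2 \<partial>M)
    = heat_cov t x t x - 2 * c * heat_cov t x s y + c\<^sup>2 * heat_cov s y s y"
proof -
  let ?H = "\<lambda>t x. heat_avg (\<lambda>n. x + sqrt (2 * t) * n) i"
  note int = gaussian_space_mult_integrable[OF heat_gaussian heat_gaussian]
  have "(\<integral>\<omega>. (?H t x \<omega> - c * ?H s y \<omega>)\<^sup>2 \<partial>M) =
      (\<integral>\<omega>. ?H t x \<omega> * ?H t x \<omega> - 2 * c * (?H t x \<omega> * ?H s y \<omega>) + c\<^sup>2 * (?H s y \<omega> * ?H s y \<omega>) \<partial>M)"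
    by (intro Bochner_Integration.integral_cong) (auto simp: power2_eq_square algebra_simps)
  also have "\<dots> = heat_cov t x t x - 2 * c * heat_cov t x s y + c\<^sup>2 * heat_cov s y s y"
    using int by (simp add: heat_cov_eq)
  finally show ?thesis .
qed

lemma heat_var_nonneg: "0 \<le> heat_cov t x t x"
proof -
  have "0 \<le> (\<integral>\<omega>. heat_avg (\<lambda>n. x + sqrt (2 * t) * n) undefined \<omega> * heat_avg (\<lambda>n. x + sqrt (2 * t)
      * n) undefined \<omega> \<partial>M)"
    by (rule Bochner_Integration.integral_nonneg) simp
  then show ?thesis by (simp only: heat_cov_eq if_True simp_thms)
qed

lemma string_var_ge_sqrt:
  assumes "0 \<le> t" shows "sqrt t / 3 \<le> string_cov t x t x"
  using heat_var_nonneg[of t x] sqrt_over_two_pi(1)[OF assms]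
  unfolding string_cov_def st_inner_diag[OF assms] by linarith

text \<open>The heat part carries \<open>\<bar>x\<bar>\<close> up to an error of order
  \<open>sqrt t\<close>, and the noise part, which carries \<open>sqrt t\<close>, absorbs the error.
  The constant 14 leaves some slack.\<close>

lemma string_var_ge:
  assumes "0 \<le> t" shows "(\<bar>x\<bar> + sqrt t) / 14 \<le> string_cov t x t x"
proof -
  have "0 \<le> sqrt (t / (2 * pi))" "0 \<le> sqrt t" using assms by auto
  then have "heat_cov t x t x \<le> string_cov t x t x" by (simp add: string_cov_def st_inner_diag[OF assms])
  moreover have "sqrt t \<le> 3 * string_cov t x t x" using string_var_ge_sqrt[OF assms, of x] by simp
  moreover have "\<bar>x\<bar> \<le> heat_cov t x t x + 3 / 2 * sqrt t"
    using heat_cov_diag_ge[OF assms, of x] sqrt_two_mult_le[OF assms] by linarith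
  ultimately have "\<bar>x\<bar> + sqrt t \<le> 14 * string_cov t x t x" using \<open>0 \<le> sqrt t\<close> by argo
  then show ?thesis by simp
qed

lemma string_cov_cross_le:
  assumes "0 \<le> s" "s < t"
  shows "\<bar>string_cov t x s y\<bar> \<le> \<bar>y\<bar> + sqrt (2 * s) + s / sqrt (4 * pi * (t - s))"
proof -
  have "st_inner (stoch_conv_kernel t x) (stoch_conv_kernel s y) = noise_cov (t - s) (x - y) s"
    using assms by (intro st_inner_stoch_conv_kernel) auto
  then show ?thesis
    using heat_cov_abs_le[OF assms(1), of t x y] noise_cov_le_separated[of "t - s" s "x
        - y"] noise_cov_nonneg[of "t - s" "x - y" s] assms
    unfolding string_cov_def by linarith
qed

text \<open>Heat part and noise part are uncorrelated, and the heat part contributes a variance,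
  which is nonnegative and may be dropped.\<close>

lemma string_nondegenerate:
  assumes st: "0 \<le> s" "s \<le> t" and a: "(x - y)\<^sup>2 \<le> 16 * s"
  shows "(sqrt (t - s) + \<bar>x - y\<bar>) / 48 \<le> string_cov t x t x - 2 * c * string_cov t x s y + c\<^sup>2
      * string_cov s y s y"
proof -
  have t: "0 \<le> t" using st by simp
  have N: "st_inner (stoch_conv_kernel t x) (stoch_conv_kernel s y) = noise_cov (t - s) (x - y) s"
    using st by (intro st_inner_stoch_conv_kernel) auto
  have "0 \<le> heat_cov t x t x - 2 * c * heat_cov t x s y + c\<^sup>2 * heat_cov s y s y"
    unfolding heat_cov_diff_square[where i=undefined, symmetric] by simp
  moreover have "(sqrt (t - s) + \<bar>x - y\<bar>) / 48
      \<le> sqrt (t / (2 * pi)) - 2 * c * noise_cov (t - s) (x - y) s + c\<^sup>2 * sqrt (s / (2 * pi))"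
    using noise_nondegenerate[of "t - s" s "x - y" c] st a by simp
  ultimately show ?thesis
    unfolding string_cov_def st_inner_diag[OF t] st_inner_diag[OF st(1)] N by (simp add: algebra_simps)
qed

lemma V_comb_square:
  assumes "0 \<le> t" "0 \<le> s"
  shows "(\<integral>\<omega>. (V t x i \<omega> - c * V s y i \<omega>)\<^sup>2 \<partial>M)
      = string_cov t x t x - 2 * c * string_cov t x s y + c\<^sup>2 * string_cov s y s y"
proof -
  have "(\<integral>\<omega>. (V t x i \<omega> - c * V s y i \<omega>)\<^sup>2 \<partial>M) =
      (\<integral>\<omega>. V t x i \<omega> * V t x i \<omega> - 2 * c * (V t x i \<omega> * V s y i \<omega>) + c\<^sup>2 * (V s y i \<omega> * V s y i \<omega>) \<partial>M)"
    by (intro Bochner_Integration.integral_cong) (auto simp: power2_eq_square algebra_simps)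
  also have "\<dots> = string_cov t x t x - 2 * c * string_cov t x s y + c\<^sup>2 * string_cov s y s y"
    using gaussian_space_mult_integrable[OF V_gaussian V_gaussian] assms by (simp add: V_cov)
  finally show ?thesis .
qed

lemma V_increment_le:
  assumes st: "0 \<le> s" "s \<le> t"
  shows "(\<integral>\<omega>. (V t x i \<omega> - V s y i \<omega>)\<^sup>2 \<partial>M) \<le> 5 * (\<bar>x - y\<bar> + sqrt (t - s))"
proof -
  have t: "0 \<le> t" using st by simp
  have N: "st_inner (stoch_conv_kernel t x) (stoch_conv_kernel s y) = noise_cov (t - s) (x - y) s"
    using st by (intro st_inner_stoch_conv_kernel) auto
  have subadd: "sqrt t \<le> sqrt s + sqrt (t - s)"
    using sqrt_add_le_add_sqrt[of s "t - s"] st by simp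
  have "(\<integral>\<omega>. (heat_avg (\<lambda>n. x + sqrt (2 * t) * n) i \<omega> - heat_avg (\<lambda>n. y + sqrt (2 * s) * n) i \<omega>)\<^sup>2 \<partial>M)
      \<le> (\<integral>n. \<bar>(x + sqrt (2 * t) * n) - (y + sqrt (2 * s) * n)\<bar> \<partial>std_normal_distribution)"
    by (rule heat_avg_diff(2)[OF _ _ integrable_affine_std_normal integrable_affine_std_normal]) measurable
  also have "\<dots> = (\<integral>n. \<bar>(x - y) + (sqrt (2 * t) - sqrt (2 * s)) * n\<bar> \<partial>std_normal_distribution)"
    by (simp add: algebra_simps)
  also have "\<dots> \<le> \<bar>x - y\<bar> + \<bar>sqrt (2 * t) - sqrt (2 * s)\<bar>" by (rule integral_abs_affine_std_normal_le)
  also have "\<bar>sqrt (2 * t) - sqrt (2 * s)\<bar> \<le> sqrt (2 * (t - s))"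
    using sqrt_add_le_add_sqrt[of "2 * s" "2 * (t - s)"] st real_sqrt_le_mono[of "2 * s" "2 * t"]
        by (simp add: algebra_simps)
  also have "\<dots> \<le> 3 / 2 * sqrt (t - s)" using st by (intro sqrt_two_mult_le) simp
  finally have H: "heat_cov t x t x - 2 * heat_cov t x s y + heat_cov s y s y
      \<le> \<bar>x - y\<bar> + 3 / 2 * sqrt (t - s)"
    using heat_cov_diff_square[of x t i 1 y s] by simp
  have "sqrt (t / (2 * pi)) \<le> sqrt (s / (2 * pi)) + sqrt ((t - s) / (2 * pi))"
    using sqrt_add_le_add_sqrt[of "s / (2 * pi)" "(t - s) / (2 * pi)"] st
        by (simp add: add_divide_distrib[symmetric])
  moreover have "sqrt ((t - s) / (2 * pi)) \<le> sqrt (t - s) / 2" using st by (intro sqrt_over_two_pi) simp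
  moreover have "sqrt (s / (2 * pi)) - sqrt (t - s) - \<bar>x - y\<bar> \<le> noise_cov (t - s) (x - y) s"
    using st by (intro noise_cov_ge) auto
  moreover have "0 \<le> sqrt (t - s)" using st by simp
  \<comment> \<open>The heat part contributes at most
    \<open>\<bar>x - y\<bar> + 3 / 2 * sqrt (t - s)\<close>. In the noise part the terms with
    \<open>sqrt (s / (2 * pi))\<close> cancel, which leaves
    \<open>2 * \<bar>x - y\<bar> + 5 / 2 * sqrt (t - s)\<close>.\<close>
  ultimately have "(heat_cov t x t x + sqrt (t / (2 * pi))) - 2 * (heat_cov t x s y + noise_cov (t
      - s) (x - y) s) + (heat_cov s y s y + sqrt (s / (2 * pi)))
     \<le> 5 * (\<bar>x - y\<bar> + sqrt (t - s))" using H abs_ge_zero[of "x - y"] by argo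
  then show ?thesis
    using V_comb_square[OF t st(1), of x i 1 y]
    unfolding string_cov_def st_inner_diag[OF t] st_inner_diag[OF st(1)] N by simp
qed

end

section \<open>Gaussian bumps of the string\<close>

context noise_and_bm
begin

text \<open>Every linear combination of all coordinates of X and Y lies again in the Gaussian space,
  so its characteristic function is determined by its variance, and the assumed covariances split
  that variance over the components.\<close>

lemma gaussian_space_expectation_prod_exp_square:
  fixes X Y :: "'d \<Rightarrow> 'w \<Rightarrow> real"
  assumes X: "\<And>i. X i \<in> gaussian_space" and Y: "\<And>i. Y i \<in> gaussian_space"
    and XX: "\<And>i j. (\<integral>\<omega>. X i \<omega> * X j \<omega> \<partial>M) = (if i = j then v else 0)"
    and XY: "\<And>i j. (\<integral>\<omega>. X i \<omega> * Y j \<omega> \<partial>M) = (if i = j then c else 0)"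
    and YY: "\<And>i j. (\<integral>\<omega>. Y i \<omega> * Y j \<omega> \<partial>M) = (if i = j then v' else 0)"
  shows "(\<integral>\<omega>. (\<Prod>i\<in>UNIV. exp (- ((X i \<omega>)\<^sup>2 + (Y i \<omega>)\<^sup>2) / 2)) \<partial>M)
    = (1 / sqrt ((1 + v) * (1 + v') - c\<^sup>2)) ^ CARD('d)"
proof (rule expectation_prod_exp_square)
  show "X i \<in> borel_measurable M" "Y i \<in> borel_measurable M" for i
    using X Y by (auto intro: gaussian_space_measurable)
  have vX: "v = (\<integral>\<omega>. (X i \<omega>)\<^sup>2 \<partial>M)" and vY: "v' = (\<integral>\<omega>. (Y i \<omega>)\<^sup>2 \<partial>M)"
      and cXY: "c = (\<integral>\<omega>. X i \<omega> * Y i \<omega> \<partial>M)" for i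
    using XX[of i i] YY[of i i] XY[of i i] by (auto simp: power2_eq_square)
  show "0 \<le> v" unfolding vX[of undefined] by simp
  show "0 \<le> v'" unfolding vY[of undefined] by simp
  show "c\<^sup>2 \<le> v * v'"
    unfolding vX[of undefined] vY[of undefined] cXY[of undefined]
    by (intro integral_cauchy_schwarz gaussian_space_measurable gaussian_space_square_integrable X Y)
  fix a b :: "'d \<Rightarrow> real"
  define Z where "Z i \<omega> = a i * X i \<omega> + b i * Y i \<omega>" for i \<omega>
  have Zg: "Z i \<in> gaussian_space" for i
    unfolding Z_def[abs_def] by (intro gaussian_space_add gaussian_space_scale X Y)
  have YX: "(\<integral>\<omega>. Y i \<omega> * X j \<omega> \<partial>M) = (if i = j then c else 0)" for i j
    using XY[of j i] by (auto simp: mult.commute)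
  have ZZ: "(\<integral>\<omega>. Z i \<omega> * Z j \<omega> \<partial>M) = (if i = j then (a i)\<^sup>2 * v + 2 * a i * b i * c + (b i)\<^sup>2
      * v' else 0)" for i j
  proof -
    have i1: "integrable M (\<lambda>\<omega>. X i \<omega> * X j \<omega>)" and i2: "integrable M (\<lambda>\<omega>. X i \<omega> * Y j \<omega>)"
      and i3: "integrable M (\<lambda>\<omega>. Y i \<omega> * X j \<omega>)" and i4: "integrable M (\<lambda>\<omega>. Y i \<omega> * Y j \<omega>)"
      by (intro gaussian_space_mult_integrable X Y)+
    have "(\<integral>\<omega>. Z i \<omega> * Z j \<omega> \<partial>M) = (\<integral>\<omega>. a i * a j * (X i \<omega> * X j \<omega>) + a i * b j * (X i \<omega> * Y j \<omega>) +
        b i * a j * (Y i \<omega> * X j \<omega>) + b i * b j * (Y i \<omega> * Y j \<omega>) \<partial>M)"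
      by (simp add: Z_def algebra_simps)
    also have "\<dots> = a i * a j * (\<integral>\<omega>. X i \<omega> * X j \<omega> \<partial>M) + a i * b j * (\<integral>\<omega>. X i \<omega> * Y j \<omega> \<partial>M) +
        b i * a j * (\<integral>\<omega>. Y i \<omega> * X j \<omega> \<partial>M) + b i * b j * (\<integral>\<omega>. Y i \<omega> * Y j \<omega> \<partial>M)"
      by (simp only: i1 i2 i3 i4 Bochner_Integration.integral_add Bochner_Integration.integrable_add
          integrable_mult_right integral_mult_right_zero)
    also have "\<dots> = (if i = j then (a i)\<^sup>2 * v + 2 * a i * b i * c + (b i)\<^sup>2 * v' else 0)"
      unfolding XX XY YX YY by (simp add: power2_eq_square)
    finally show ?thesis .
  qed
  have "(\<integral>\<omega>. (\<Sum>i\<in>UNIV. Z i \<omega>)\<^sup>2 \<partial>M) = (\<integral>\<omega>. (\<Sum>i\<in>UNIV. \<Sum>j\<in>UNIV. Z i \<omega> * Z j \<omega>) \<partial>M)"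
    by (simp add: power2_eq_square sum_product)
  also have "\<dots> = (\<Sum>i\<in>UNIV. \<Sum>j\<in>UNIV. \<integral>\<omega>. Z i \<omega> * Z j \<omega> \<partial>M)"
    by (simp add: gaussian_space_mult_integrable[OF Zg Zg])
  also have "\<dots> = (\<Sum>i\<in>UNIV. (a i)\<^sup>2 * v + 2 * a i * b i * c + (b i)\<^sup>2 * v')"
    unfolding ZZ by simp
  finally have var: "(\<integral>\<omega>. (\<Sum>i\<in>UNIV. Z i \<omega>)\<^sup>2 \<partial>M) = \<dots>" .
  have "(\<lambda>\<omega>. \<Sum>i\<in>UNIV. Z i \<omega>) \<in> gaussian_space" by (rule gaussian_space_sum[OF finite Zg])
  from gaussian_space_centered[OF this]
  have "(\<integral>\<omega>. iexp (1 * (\<Sum>i\<in>UNIV. Z i \<omega>)) \<partial>M) = complex_of_real (exp (- (1\<^sup>2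
      * (\<integral>\<omega>. (\<Sum>i\<in>UNIV. Z i \<omega>)\<^sup>2 \<partial>M)) / 2))"
    unfolding centered_gaussian_def by blast
  then show "(\<integral>\<omega>. iexp (\<Sum>i\<in>UNIV. a i * X i \<omega> + b i * Y i \<omega>) \<partial>M)
      = complex_of_real (exp (- (\<Sum>i\<in>UNIV. (a i)\<^sup>2 * v + 2 * a i * b i * c + (b i)\<^sup>2 * v') / 2))"
    unfolding var by (simp only: Z_def mult_1 one_power2)
qed

definition bump :: "real \<Rightarrow> real \<Rightarrow> real \<Rightarrow> 'w \<Rightarrow> real" where
  "bump \<eta> t x \<omega> = (\<Prod>i\<in>UNIV. exp (- (V t x i \<omega> / \<eta>)\<^sup>2 / 2))"

lemma bump_eq_exp: "bump \<eta> t x \<omega> = exp (- (\<Sum>i\<in>UNIV. (V t x i \<omega>)\<^sup>2) / (2 * \<eta>\<^sup>2))"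
proof -
  have "(\<Sum>i\<in>UNIV. - (V t x i \<omega> / \<eta>)\<^sup>2 / 2) = - (\<Sum>i\<in>UNIV. (V t x i \<omega>)\<^sup>2) / (2 * \<eta>\<^sup>2)"
    by (simp add: power_divide sum_negf sum_divide_distrib mult.commute)
  then show ?thesis unfolding bump_def exp_sum[OF finite, symmetric] by simp
qed

lemma bump_pos: "0 < bump \<eta> t x \<omega>" by (simp add: bump_eq_exp)

lemma bump_le_1: "bump \<eta> t x \<omega> \<le> 1"
  unfolding bump_eq_exp by (simp add: sum_nonneg divide_nonpos_nonneg)

lemma bump_measurable[measurable]: "0 \<le> t \<Longrightarrow> bump \<eta> t x \<in> borel_measurable M"
  unfolding bump_def[abs_def] by measurable

lemma bump_pair_expectation:
  assumes "0 \<le> t" "0 \<le> s"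
  shows "(\<integral>\<omega>. bump \<eta> t x \<omega> * bump \<eta> s y \<omega> \<partial>M)
    = (1 / sqrt ((1 + string_cov t x t x / \<eta>\<^sup>2) * (1 + string_cov s y s y / \<eta>\<^sup>2)
        - (string_cov t x s y / \<eta>\<^sup>2)\<^sup>2)) ^ CARD('d)"
proof -
  have sc: "(\<lambda>\<omega>. V t x i \<omega> / \<eta>) \<in> gaussian_space" if "0 \<le> t" for t x i
    using gaussian_space_scale[OF V_gaussian[OF that], of "1 / \<eta>"] by simp
  have cov: "(\<integral>\<omega>. V t x i \<omega> / \<eta> * (V s y j \<omega> / \<eta>) \<partial>M) = (if i = j then string_cov t x s y / \<eta>\<^sup>2 else 0)"
    if "0 \<le> t" "0 \<le> s" for t x s y i j
  proof -
    have "(\<integral>\<omega>. V t x i \<omega> / \<eta> * (V s y j \<omega> / \<eta>) \<partial>M) = (\<integral>\<omega>. V t x i \<omega> * V s y j \<omega> / \<eta>\<^sup>2 \<partial>M)"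
      by (simp add: power2_eq_square)
    also have "\<dots> = (\<integral>\<omega>. V t x i \<omega> * V s y j \<omega> \<partial>M) / \<eta>\<^sup>2" by simp
    finally show ?thesis unfolding V_cov[OF that] by simp
  qed
  have "(\<integral>\<omega>. bump \<eta> t x \<omega> * bump \<eta> s y \<omega> \<partial>M) = (\<integral>\<omega>. (\<Prod>i\<in>UNIV. exp (- ((V t x i \<omega> / \<eta>)\<^sup>2 + (V s y i \<omega>
      / \<eta>)\<^sup>2) / 2)) \<partial>M)"
  proof (rule Bochner_Integration.integral_cong[OF refl])
    fix \<omega>
    have "exp (- p / 2) * exp (- q / 2) = exp (- (p + q) / 2)" for p q :: real
      by (simp add: diff_divide_distrib flip: exp_add)
    then show "bump \<eta> t x \<omega> * bump \<eta> s y \<omega> = (\<Prod>i\<in>UNIV. exp (- ((V t x i \<omega> / \<eta>)\<^sup>2 + (V s y i \<omega> / \<eta>)\<^sup>2) / 2))"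
      unfolding bump_def prod.distrib[symmetric] by (simp only:)
  qed
  also have "\<dots> = (1 / sqrt ((1 + string_cov t x t x / \<eta>\<^sup>2) * (1 + string_cov s y s y / \<eta>\<^sup>2)
      - (string_cov t x s y / \<eta>\<^sup>2)\<^sup>2)) ^ CARD('d)"
    by (rule gaussian_space_expectation_prod_exp_square) (intro sc cov assms)+
  finally show ?thesis .
qed

lemma string_cov_cauchy_schwarz:
  assumes "0 \<le> t" "0 \<le> s"
  shows "(string_cov t x s y)\<^sup>2 \<le> string_cov t x t x * string_cov s y s y"
proof -
  have "(\<integral>\<omega>. V t x undefined \<omega> * V s y undefined \<omega> \<partial>M)\<^sup>2
      \<le> (\<integral>\<omega>. (V t x undefined \<omega>)\<^sup>2 \<partial>M) * (\<integral>\<omega>. (V s y undefined \<omega>)\<^sup>2 \<partial>M)"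
    by (intro integral_cauchy_schwarz gaussian_space_measurable gaussian_space_square_integrable
        V_gaussian assms)
  then show ?thesis using assms by (simp only: V_cov power2_eq_square if_True simp_thms)
qed

lemma bump_expectation:
  assumes "0 \<le> t"
  shows "(\<integral>\<omega>. bump \<eta> t x \<omega> \<partial>M) = (1 / sqrt (1 + string_cov t x t x / \<eta>\<^sup>2)) ^ CARD('d)"
proof -
  \<comment> \<open>The string is pinned at the origin, so the one-point formula is the two-point formula with \<open>(0, 0)\<close>.\<close>
  have V0: "V 0 0 i \<in> gaussian_space" for i by (rule V_gaussian) simp
  have c0: "string_cov 0 0 0 0 = 0"
    using string_var_le[of 0 0] string_var_ge_sqrt[of 0 0] by simp
  have c1: "string_cov t x 0 0 = 0"
    using string_cov_cauchy_schwarz[OF assms order_refl, of x 0] by (simp add: c0)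
  have "AE \<omega> in M. V 0 0 i \<omega> = 0" for i
  proof -
    have "(\<integral>\<omega>. (V 0 0 i \<omega>)\<^sup>2 \<partial>M) = 0" using V_cov[of 0 0 0 i 0 i] c0 by (simp add: power2_eq_square)
    then have "AE \<omega> in M. (V 0 0 i \<omega>)\<^sup>2 = 0"
      by (subst (asm) integral_nonneg_eq_0_iff_AE) (simp_all add: gaussian_space_square_integrable[OF V0])
    then show ?thesis by simp
  qed
  then have "AE \<omega> in M. \<forall>i. V 0 0 i \<omega> = 0" by (simp add: AE_all_countable)
  then have "AE \<omega> in M. bump \<eta> 0 0 \<omega> = 1" by eventually_elim (simp add: bump_eq_exp)
  then have "(\<integral>\<omega>. bump \<eta> t x \<omega> \<partial>M) = (\<integral>\<omega>. bump \<eta> t x \<omega> * bump \<eta> 0 0 \<omega> \<partial>M)"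
    using assms by (intro integral_cong_AE) auto
  also have "\<dots> = (1 / sqrt (1 + string_cov t x t x / \<eta>\<^sup>2)) ^ CARD('d)"
    unfolding bump_pair_expectation[OF assms order_refl] c0 c1 by simp
  finally show ?thesis .
qed

section \<open>Identification with the pinned string\<close>

lemma std_normal_density_heat_kernel:
  assumes "0 < t" shows "sqrt (2 * t) * heat_kernel t (- (sqrt (2 * t) * n)) = std_normal_density n"
proof -
  have "sqrt (4 * pi * t) = sqrt (2 * pi) * sqrt (2 * t)" by (simp flip: real_sqrt_mult)
  then show ?thesis using assms
    by (simp add: heat_kernel_def std_normal_density_def power_mult_distrib)
qed

lemma sum_axis_nth: "(\<Sum>j\<in>UNIV. f j *\<^sub>R axis j 1) $ i = f i" for f :: "'d \<Rightarrow> real"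
proof -
  have "(\<Sum>j\<in>UNIV. f j *\<^sub>R axis j 1) $ i = (\<Sum>j\<in>UNIV. if j = i then f j else 0)"
    unfolding sum_component by (intro sum.cong) (auto simp: axis_def)
  then show ?thesis by simp
qed

lemma vec_scaleR_sum_axis: "c *\<^sub>R v = (\<Sum>i\<in>UNIV. (c * v $ i) *\<^sub>R axis i 1)" for v :: "real ^ 'd"
  by (simp only: vec_eq_iff sum_axis_nth vector_scaleR_component real_scaleR_def simp_thms)

text \<open>For positive t one substitutes z = x + sqrt (2 t) n and expands the vector in the
  standard basis, so that the integral is taken coordinate by coordinate. At t = 0 the average is
  over a constant, in accordance with the special case in \<open>heat_part\<close>.\<close>

lemma heat_part_eq_heat_avg:
  assumes t: "0 \<le> t" and eq: "\<And>y. B \<omega> y = U0 \<omega> y"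
    and int: "\<And>i. integrable std_normal_distribution (\<lambda>n. B \<omega> (x + sqrt (2 * t) * n) $ i)"
  shows "heat_part (U0 \<omega>) t x $ i = heat_avg (\<lambda>n. x + sqrt (2 * t) * n) i \<omega>"
proof (cases "t = 0")
  case True
  then show ?thesis by (simp add: heat_part_def heat_avg_def eq)
next
  case False
  then have t: "0 < t" using t by simp
  let ?c = "sqrt (2 * t)"
  have int': "integrable lborel (\<lambda>n. std_normal_density n * U0 \<omega> (x + ?c * n) $ j)" for j
    using int[of j] by (subst (asm) integrable_density) (auto simp: eq[symmetric])
  have "heat_part (U0 \<omega>) t x = (\<integral>z. heat_kernel t (x - z) *\<^sub>R U0 \<omega> z \<partial>lborel)"
    using t by (simp add: heat_part_def)
  also have "\<dots> = \<bar>?c\<bar> *\<^sub>R (\<integral>n. heat_kernel t (x - (x + ?c * n)) *\<^sub>R U0 \<omega> (x + ?c * n) \<partial>lborel)"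
    by (rule lborel_integral_real_affine) (use t in simp)
  also have "\<dots> = (\<integral>n. std_normal_density n *\<^sub>R U0 \<omega> (x + ?c * n) \<partial>lborel)"
    unfolding integral_scaleR_right[symmetric] std_normal_density_heat_kernel[OF t, symmetric] using t by simp
  also have "\<dots> = (\<integral>n. (\<Sum>j\<in>UNIV. (std_normal_density n * U0 \<omega> (x + ?c * n) $ j) *\<^sub>R axis j 1) \<partial>lborel)"
    by (subst vec_scaleR_sum_axis) simp
  also have "\<dots> = (\<Sum>j\<in>UNIV. (\<integral>n. std_normal_density n * U0 \<omega> (x + ?c * n) $ j \<partial>lborel) *\<^sub>R axis j 1)"
    using int' by simp
  also have "\<dots> $ i = (\<integral>n. std_normal_density n * U0 \<omega> (x + ?c * n) $ i \<partial>lborel)"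
    by (rule sum_axis_nth)
  also have "\<dots> = heat_avg (\<lambda>n. x + ?c * n) i \<omega>"
    unfolding heat_avg_def eq[symmetric] by (subst integral_density) auto
  finally show ?thesis .
qed

lemma V_AE:
  assumes U: "pinned_string_version M U0 W U" and t: "0 \<le> t"
  shows "AE \<omega> in M. \<forall>i. U \<omega> t x $ i = V t x i \<omega>"
proof -
  have "AE \<omega> in M. \<forall>i. integrable std_normal_distribution (\<lambda>n. B \<omega> (x + sqrt (2 * t) * n) $ i)"
    unfolding AE_all_countable
    by (intro allI heat_avg_AE_integrable integrable_affine_std_normal) measurable
  moreover have "AE \<omega> in M. \<forall>i. U \<omega> t x $ i = heat_part (U0 \<omega>) t x $ i + W i (stoch_conv_kernel t x) \<omega>"
    using U t by (auto simp: pinned_string_version_def)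
  ultimately show ?thesis using B_AE
    by eventually_elim (simp add: V_def heat_part_eq_heat_avg[OF t])
qed

end

section \<open>Correlation of bumps\<close>

lemma sum_inverse_cube_le:
  fixes A :: real
  assumes A: "1 \<le> A"
  shows "(\<Sum>a<n. 1 / (A + real a) ^ 3) \<le> 2 / A\<^sup>2"
proof -
  have "(\<Sum>a<n. 1 / (A + real a) ^ 3) \<le> 2 / A * (1 / A - 1 / (A + real n))"
  proof (induction n)
    case (Suc n)
    define B where "B = A + real n"
    have B: "A \<le> B" "1 \<le> B" using A by (auto simp: B_def)
    \<comment> \<open>One of the three factors \<open>1 / B\<close> is traded for
      \<open>1 / A\<close>; the other two telescope.\<close>
    have "1 / B ^ 3 \<le> 2 / A * (1 / B - 1 / (B + 1))"
    proof -
      have "A * (B + 1) \<le> B * (2 * B)" using A B by (intro mult_mono) auto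
      then have "A * (B * (B + 1)) \<le> 2 * B ^ 3"
        using mult_left_mono[of "A * (B + 1)" "B * (2 * B)" B] B by (simp add: power3_eq_cube mult_ac)
      then have "2 / (2 * B ^ 3) \<le> 2 / (A * (B * (B + 1)))"
        using A B by (intro divide_left_mono mult_pos_pos) auto
      then have "1 / B ^ 3 \<le> 2 / (A * (B * (B + 1)))" by simp
      also have "\<dots> = 2 / A * (1 / B - 1 / (B + 1))" using A B by (simp add: field_simps)
      finally show ?thesis .
    qed
    then show ?case using Suc by (simp add: B_def algebra_simps)
  qed simp
  also have "\<dots> \<le> 2 / A * (1 / A)" using A by (intro mult_left_mono) auto
  finally show ?thesis by (simp add: power2_eq_square)
qed

lemma sum_inverse_dyadic_le: "(\<Sum>h<2 ^ m. 1 / (1 + real h)) \<le> 1 + real m"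
proof (induction m)
  case (Suc m)
  have "(\<Sum>h<2 ^ Suc m. 1 / (1 + real h)) = (\<Sum>h<2 ^ m. 1 / (1 + real h)) + (\<Sum>h\<in>{2 ^ m..<2 ^ Suc m}. 1
      / (1 + real h))"
    by (subst sum.union_disjoint[symmetric]) (auto intro!: sum.cong)
  also have "(\<Sum>h\<in>{2 ^ m..<2 ^ Suc m}. 1 / (1 + real h)) \<le> (\<Sum>h\<in>{2 ^ m..<(2::nat) ^ Suc m}. 1 / 2 ^ m)"
  proof (intro sum_mono frac_le)
    fix h :: nat assume "h \<in> {2 ^ m..<2 ^ Suc m}"
    then have "real (2 ^ m) \<le> real h" by (simp only: of_nat_le_iff atLeastLessThan_iff)
    then have "2 ^ m \<le> real h" by (simp only: of_nat_power of_nat_numeral)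
    then show "(2::real) ^ m \<le> 1 + real h" by linarith
  qed auto
  also have "\<dots> = 1" by simp
  finally show ?case using Suc by simp
qed simp

text \<open>Summation over the spatial index leaves at most \<open>2 / (1 + real h)\<close>, and the
  harmonic sum up to \<open>4 ^ k\<close> is O(k). This is the logarithm of the critical
  dimension.\<close>

lemma lattice_sum_le:
  "(\<Sum>h<4 ^ k. \<Sum>a<n. 1 / (1 + sqrt (real h) + real a) ^ 3) \<le> 2 * (1 + 2 * real k)"
proof -
  have "(\<Sum>a<n. 1 / (1 + sqrt (real h) + real a) ^ 3) \<le> 2 * (1 / (1 + real h))" for h
  proof -
    have "(\<Sum>a<n. 1 / (1 + sqrt (real h) + real a) ^ 3) \<le> 2 / (1 + sqrt (real h))\<^sup>2"
      by (rule sum_inverse_cube_le) simp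
    also have "\<dots> \<le> 2 / (1 + real h)" by (intro divide_left_mono) (auto simp: power2_sum intro!:
        mult_pos_pos add_pos_nonneg)
    finally show ?thesis by simp
  qed
  then have "(\<Sum>h<4 ^ k. \<Sum>a<n. 1 / (1 + sqrt (real h) + real a) ^ 3) \<le> (\<Sum>h<4 ^ k. 2 * (1 / (1 + real h)))"
    by (rule sum_mono)
  also have "\<dots> = 2 * (\<Sum>h<2 ^ (2 * k). 1 / (1 + real h))"
    unfolding sum_distrib_left[symmetric] by (simp add: power_mult)
  also have "\<dots> \<le> 2 * (1 + real (2 * k))" by (intro mult_left_mono sum_inverse_dyadic_le) simp
  finally show ?thesis by simp
qed

definition nat_dist :: "nat \<Rightarrow> nat \<Rightarrow> nat" where
  "nat_dist i s = (if s \<le> i then i - s else s - i)"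

lemma real_nat_dist: "real (nat_dist i s) = \<bar>real i - real s\<bar>"
  by (auto simp: nat_dist_def of_nat_diff)

text \<open>Each distance from i is attained at most once on either side of i.\<close>

lemma sum_nat_dist_le:
  fixes g :: "nat \<Rightarrow> real"
  assumes g: "\<And>h. 0 \<le> g h" and i: "i < n"
  shows "(\<Sum>s<n. g (nat_dist i s)) \<le> 2 * (\<Sum>h<n. g h)"
proof -
  have part: "(\<Sum>s\<in>S. g (nat_dist i s)) \<le> (\<Sum>h<n. g h)" if "S \<subseteq> {..<n}" "inj_on (nat_dist i) S" for S
  proof -
    have "(\<Sum>s\<in>S. g (nat_dist i s)) = (\<Sum>h\<in>nat_dist i ` S. g h)"
      using that by (simp add: sum.reindex comp_def)
    also have "\<dots> \<le> (\<Sum>h<n. g h)"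
      using that i g by (intro sum_mono2) (auto simp: nat_dist_def subset_iff)
    finally show ?thesis .
  qed
  have "inj_on (nat_dist i) {..i}" "inj_on (nat_dist i) {i<..<n}" by (auto simp: inj_on_def nat_dist_def)
  moreover have "{..i} \<subseteq> {..<n}" "{i<..<n} \<subseteq> {..<n}" using i by auto
  ultimately have "(\<Sum>s\<in>{..i}. g (nat_dist i s)) \<le> (\<Sum>h<n. g h)" "(\<Sum>s\<in>{i<..<n}. g (nat_dist i s)) \<le> (\<Sum>h<n. g h)"
    using part by blast+
  moreover have "(\<Sum>s<n. g (nat_dist i s)) = (\<Sum>s\<in>{..i}. g (nat_dist i s)) + (\<Sum>s\<in>{i<..<n}. g (nat_dist i s))"
    using i by (subst sum.union_disjoint[symmetric]) (auto intro!: sum.cong)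
  ultimately show ?thesis by simp
qed

lemma lattice_dist_sum_le:
  assumes "i < 4 ^ k" "j < 2 ^ k"
  shows "(\<Sum>s<4 ^ k. \<Sum>y<2 ^ k. 1 / (1 + sqrt \<bar>real i - real s\<bar> + \<bar>real j - real y\<bar>) ^ 3)
      \<le> 8 * (1 + 2 * real k)"
proof -
  have "(\<Sum>s<4 ^ k. \<Sum>y<2 ^ k. 1 / (1 + sqrt \<bar>real i - real s\<bar> + \<bar>real j - real y\<bar>) ^ 3)
     = (\<Sum>s<4 ^ k. \<Sum>y<2 ^ k. 1 / (1 + sqrt (real (nat_dist i s)) + real (nat_dist j y)) ^ 3)"
    by (simp add: real_nat_dist)
  also have "\<dots> \<le> (\<Sum>s<4 ^ k. 2 * (\<Sum>a<2 ^ k. 1 / (1 + sqrt (real (nat_dist i s)) + real a) ^ 3))"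
    by (intro sum_mono sum_nat_dist_le[where g="\<lambda>a. 1 / (1 + sqrt (real (nat_dist i s))
        + real a) ^ 3" for s] assms) simp
  also have "\<dots> \<le> 2 * (\<Sum>h<4 ^ k. 2 * (\<Sum>a<2 ^ k. 1 / (1 + sqrt (real h) + real a) ^ 3))"
    by (rule sum_nat_dist_le[where g="\<lambda>h. 2 * (\<Sum>a<2 ^ k. 1 / (1 + sqrt (real h) + real a) ^ 3)"])
      (auto intro!: mult_nonneg_nonneg sum_nonneg assms)
  also have "\<dots> \<le> 8 * (1 + 2 * real k)"
    using lattice_sum_le[where k=k and n="2 ^ k"] by (simp add: sum_distrib_left[symmetric])
  finally show ?thesis .
qed

text \<open>The product of the normalised bumps at two points has mean \<open>corr_ratio powr (d / 2)\<close>, at most the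
  cube of \<open>corr_ratio\<close> if \<open>d \<le> 6\<close>.\<close>
definition corr_ratio :: "real \<Rightarrow> real \<Rightarrow> real \<Rightarrow> real \<Rightarrow> real \<Rightarrow> real" where
  "corr_ratio \<eta> t x s y = (let P = (1 + string_cov t x t x / \<eta>\<^sup>2) * (1 + string_cov s y s y / \<eta>\<^sup>2)
     in P / (P - (string_cov t x s y / \<eta>\<^sup>2)\<^sup>2))"

section \<open>Two-point bounds for normalised bumps\<close>

context noise_and_bm
begin

lemma string_var_nonneg: "0 \<le> t \<Longrightarrow> 0 \<le> string_cov t x t x"
  using string_var_ge_sqrt[of t x] by (smt (verit) real_sqrt_ge_zero divide_nonneg_nonneg)

lemma corr_det_pos:
  assumes "0 \<le> t" "0 \<le> s"
  shows "0 < (1 + string_cov t x t x / \<eta>\<^sup>2) * (1 + string_cov s y s y / \<eta>\<^sup>2) - (string_cov t x s y / \<eta>\<^sup>2)\<^sup>2"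
proof -
  have v: "0 \<le> string_cov t x t x / \<eta>\<^sup>2" "0 \<le> string_cov s y s y / \<eta>\<^sup>2"
    using assms by (auto intro!: divide_nonneg_nonneg string_var_nonneg)
  have "(string_cov t x s y / \<eta>\<^sup>2)\<^sup>2 \<le> string_cov t x t x * string_cov s y s y / (\<eta>\<^sup>2)\<^sup>2"
    using string_cov_cauchy_schwarz[OF assms, of x y] by (simp add: power_divide divide_right_mono)
  also have "\<dots> = (string_cov t x t x / \<eta>\<^sup>2) * (string_cov s y s y / \<eta>\<^sup>2)" by (simp add: power2_eq_square)
  finally show ?thesis using v by (simp add: algebra_simps)
qed

definition nbump :: "real \<Rightarrow> real \<Rightarrow> real \<Rightarrow> 'w \<Rightarrow> real" where
  "nbump \<eta> t x \<omega> = bump \<eta> t x \<omega> / (\<integral>\<omega>. bump \<eta> t x \<omega> \<partial>M)"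

lemma bump_expectation_pos: "0 \<le> t \<Longrightarrow> 0 < (\<integral>\<omega>. bump \<eta> t x \<omega> \<partial>M)"
  using string_var_nonneg[of t x] by (auto simp: bump_expectation add_pos_nonneg intro!:
      zero_less_power divide_pos_pos)

lemma bump_integrable: "0 \<le> t \<Longrightarrow> integrable M (bump \<eta> t x)"
  by (rule integrable_const_bound[where B=1]) (auto simp: bump_le_1 bump_pos less_imp_le)

lemma bump_pair_integrable: "0 \<le> t \<Longrightarrow> 0 \<le> s \<Longrightarrow> integrable M (\<lambda>\<omega>. bump \<eta> t x \<omega> * bump \<eta> s y \<omega>)"
  by (rule integrable_const_bound[where B=1])
    (auto simp: bump_le_1 bump_pos less_imp_le abs_mult intro!: mult_le_one)

lemma nbump_measurable[measurable]: "0 \<le> t \<Longrightarrow> nbump \<eta> t x \<in> borel_measurable M"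
  unfolding nbump_def[abs_def] by measurable

lemma nbump_integrable: "0 \<le> t \<Longrightarrow> integrable M (nbump \<eta> t x)"
  unfolding nbump_def[abs_def] by (intro integrable_divide bump_integrable)

lemma nbump_pair_integrable: "0 \<le> t \<Longrightarrow> 0 \<le> s \<Longrightarrow> integrable M (\<lambda>\<omega>. nbump \<eta> t x \<omega> * nbump \<eta> s y \<omega>)"
  unfolding nbump_def[abs_def] using bump_pair_integrable[of t s \<eta> x y] by simp

lemma nbump_expectation: "0 \<le> t \<Longrightarrow> (\<integral>\<omega>. nbump \<eta> t x \<omega> \<partial>M) = 1"
  unfolding nbump_def using bump_expectation_pos[of t \<eta> x] by simp

lemma nbump_pair_le:
  assumes "0 \<le> t" "0 \<le> s" and d: "CARD('d) \<le> 6"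
  shows "(\<integral>\<omega>. nbump \<eta> t x \<omega> * nbump \<eta> s y \<omega> \<partial>M) \<le> corr_ratio \<eta> t x s y ^ 3"
proof -
  define v v' c where "v = string_cov t x t x / \<eta>\<^sup>2" and "v' = string_cov s y s y / \<eta>\<^sup>2"
      and "c = string_cov t x s y / \<eta>\<^sup>2"
  define P where "P = (1 + v) * (1 + v')"
  have v: "0 \<le> v" "0 \<le> v'" using assms by (auto simp: v_def v'_def intro!: divide_nonneg_nonneg
      string_var_nonneg)
  have D: "0 < P - c\<^sup>2" using corr_det_pos[OF assms(1,2), of x \<eta> y] by (simp add: P_def v_def v'_def c_def)
  have P: "0 < P" using v by (simp add: P_def)
  have "(\<integral>\<omega>. nbump \<eta> t x \<omega> * nbump \<eta> s y \<omega> \<partial>M)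
      = (\<integral>\<omega>. bump \<eta> t x \<omega> * bump \<eta> s y \<omega> \<partial>M) / ((\<integral>\<omega>. bump \<eta> t x \<omega> \<partial>M) * (\<integral>\<omega>. bump \<eta> s y \<omega> \<partial>M))"
    unfolding nbump_def by simp
  also have "\<dots> = (1 / sqrt (P - c\<^sup>2)) ^ CARD('d) / ((1 / sqrt (1 + v)) ^ CARD('d) * (1 / sqrt (1
      + v')) ^ CARD('d))"
    using assms by (simp add: bump_pair_expectation bump_expectation P_def v_def v'_def c_def)
  also have "\<dots> = sqrt (P / (P - c\<^sup>2)) ^ CARD('d)"
    using v by (simp add: P_def real_sqrt_divide real_sqrt_mult power_divide power_mult_distrib)
  \<comment> \<open>The base is at least 1, so the exponent may be raised from d to 6. This is how
    the dimension enters the two-point bound.\<close>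
  also have "\<dots> \<le> sqrt (P / (P - c\<^sup>2)) ^ 6"
    using D P d by (intro power_increasing) (auto simp: real_le_rsqrt pos_le_divide_eq)
  also have "\<dots> = (P / (P - c\<^sup>2)) ^ 3"
  proof -
    have "sqrt z ^ 6 = z ^ 3" if "0 \<le> z" for z
      using power_mult[of "sqrt z" 2 3] that by simp
    then show ?thesis using D P by simp
  qed
  also have "P / (P - c\<^sup>2) = corr_ratio \<eta> t x s y"
      by (simp add: corr_ratio_def Let_def P_def v_def v'_def c_def)
  finally show ?thesis .
qed

lemma corr_ratio_sym:
  assumes "0 \<le> t" "0 \<le> s" shows "corr_ratio \<eta> t x s y = corr_ratio \<eta> s y t x"
  by (simp add: corr_ratio_def Let_def string_cov_sym[OF assms, of x y] mult.commute)

lemma corr_ratio_nonneg: "0 \<le> t \<Longrightarrow> 0 \<le> s \<Longrightarrow> 0 \<le> corr_ratio \<eta> t x s y"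
  unfolding corr_ratio_def Let_def using corr_det_pos[of t s x \<eta> y]
  by (intro divide_nonneg_nonneg mult_nonneg_nonneg add_nonneg_nonneg) (auto intro!:
      divide_nonneg_nonneg string_var_nonneg)

text \<open>Both variances are of order \<open>2 ^ k\<close>, so the numerator is of order
  \<open>4 ^ k\<close>. The determinant is at least of order \<open>2 ^ k\<close> times 1 plus the
  variance left after linear prediction, which grows like the parabolic distance of the
  points.\<close>

lemma corr_ratio_same_scale_ordered:
  fixes k :: nat
  assumes \<eta>: "0 < \<eta>" "\<eta> \<le> 1" and st: "4 ^ k \<le> s" "s \<le> t" "t \<le> 2 * 4 ^ k"
    and x: "0 \<le> x" "x \<le> 2 ^ k" and y: "0 \<le> y" "y \<le> 2 ^ k"
  shows "corr_ratio \<eta> t x s y \<le> 3600 / \<eta>\<^sup>2 * 2 ^ k * (1 / (1 + sqrt (t - s) + \<bar>x - y\<bar>))"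
proof -
  \<comment> \<open>Because \<eta> is at most 1, e is at least 1, and the constants 1 in the
    regularised variances are absorbed into multiples of e.\<close>
  define e where "e = 1 / \<eta>\<^sup>2"
  have "\<eta>\<^sup>2 \<le> 1\<^sup>2" using \<eta> by (intro power_mono) auto
  then have e: "1 \<le> e" using \<eta> by (simp add: e_def)
  have k1: "(1::real) \<le> 2 ^ k" by simp
  have k4: "(4::real) ^ k = (2 ^ k)\<^sup>2" by (simp add: power2_eq_square flip: power_mult_distrib)
  have s0: "0 \<le> s" "0 \<le> t" using st by (auto intro: order_trans[of 0 "4 ^ k"])
  let ?vp = "string_cov t x t x" and ?vq = "string_cov s y s y" and ?K = "string_cov t x s y"
  have sq: "sqrt r \<le> 3 / 2 * 2 ^ k" if "r \<le> 2 * 4 ^ k" for r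
  proof -
    have "(3 / 2 * 2 ^ k)\<^sup>2 = 9 / 4 * ((2::real) ^ k)\<^sup>2" by (simp add: power_mult_distrib power_divide)
    moreover have "0 \<le> ((2::real) ^ k)\<^sup>2" by (rule zero_le_power2)
    ultimately have "r \<le> (3 / 2 * 2 ^ k)\<^sup>2" using that k4 by linarith
    then have "sqrt r \<le> sqrt ((3 / 2 * 2 ^ k)\<^sup>2)" by (rule real_sqrt_le_mono)
    also have "\<dots> = 3 / 2 * 2 ^ k" by (simp only: real_sqrt_abs) simp
    finally show ?thesis .
  qed
  have vp: "?vp \<le> 4 * 2 ^ k" using string_var_le[of t x] sq[of t] st x s0 by simp
  have vq: "?vq \<le> 4 * 2 ^ k" using string_var_le[of s y] sq[of s] st y s0 by simp
  have "2 ^ k \<le> sqrt s" by (rule real_le_rsqrt) (use st k4 in simp)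
  then have vq': "2 ^ k / 3 \<le> ?vq" using string_var_ge_sqrt[of s y] s0 by simp
  have vq0: "0 < ?vq" using vq' by (rule less_le_trans[rotated]) simp
  have vp0: "0 \<le> ?vp" using s0 by (intro string_var_nonneg)
  define m where "m = (sqrt (t - s) + \<bar>x - y\<bar>) / 48"
  have m0: "0 \<le> m" using st by (simp add: m_def)
  have "(x - y)\<^sup>2 \<le> (2 ^ k)\<^sup>2" using x y by (intro power2_le_iff_abs_le[THEN iffD2]) auto
  then have xy: "(x - y)\<^sup>2 \<le> 16 * s" using st k4 s0 by simp
  \<comment> \<open>The coefficient is that of linear regression, the minimiser of the quadratic;
    multiplied by \<open>?vq\<close>, the minimum is the determinant of the covariance
    matrix.\<close>
  have "m \<le> ?vp - 2 * (?K / ?vq) * ?K + (?K / ?vq)\<^sup>2 * ?vq"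
    unfolding m_def by (rule string_nondegenerate[OF s0(1) st(2) xy])
  also have "\<dots> = ?vp - ?K\<^sup>2 / ?vq" using vq0 by (simp add: power2_eq_square field_simps)
  finally have det: "?vq * m \<le> ?vp * ?vq - ?K\<^sup>2" using vq0 by (simp add: field_simps)
  have P: "(1 + ?vp / \<eta>\<^sup>2) * (1 + ?vq / \<eta>\<^sup>2) \<le> (e * (5 * 2 ^ k)) * (e * (5 * 2 ^ k))"
  proof (rule mult_mono)
    have a: "1 + v / \<eta>\<^sup>2 \<le> e * (5 * 2 ^ k)" if "v \<le> 4 * 2 ^ k" for v
    proof -
      have "1 \<le> e * 2 ^ k" using mult_mono[OF e k1] e by simp
      moreover have "v / \<eta>\<^sup>2 \<le> e * (4 * 2 ^ k)" using mult_left_mono[OF that, of e] e by (simp add: e_def)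
      ultimately show ?thesis by simp
    qed
    show "1 + ?vp / \<eta>\<^sup>2 \<le> e * (5 * 2 ^ k)" "1 + ?vq / \<eta>\<^sup>2 \<le> e * (5 * 2 ^ k)" using a vp vq by auto
  qed (use vq0 e in auto)
  have D: "e * (2 ^ k / 3) * (1 + m) \<le> (1 + ?vp / \<eta>\<^sup>2) * (1 + ?vq / \<eta>\<^sup>2) - (?K / \<eta>\<^sup>2)\<^sup>2"
  proof -
    have "e * (2 ^ k / 3) * (1 + m) \<le> e * ?vq * (1 + m)"
      using e m0 vq' by (intro mult_right_mono mult_left_mono) auto
    also have "\<dots> = e * ?vq + e * (?vq * m)" by (simp add: algebra_simps)
    also have "\<dots> \<le> e * ?vq + e * (?vp * ?vq - ?K\<^sup>2)" using e det by (intro add_left_mono mult_left_mono) auto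
    also have "\<dots> \<le> e * ?vq + e * e * (?vp * ?vq - ?K\<^sup>2)"
    proof -
      have "0 \<le> ?vp * ?vq - ?K\<^sup>2" using det m0 vq0 by (smt (verit) mult_nonneg_nonneg)
      then show ?thesis using e by (intro add_left_mono mult_right_mono) (auto simp: mult_le_cancel_left1)
    qed
    also have "\<dots> \<le> 1 + e * ?vp + e * ?vq + e * e * (?vp * ?vq - ?K\<^sup>2)" using e vp0 by simp
    also have "\<dots> = (1 + ?vp / \<eta>\<^sup>2) * (1 + ?vq / \<eta>\<^sup>2) - (?K / \<eta>\<^sup>2)\<^sup>2"
      by (simp add: e_def power2_eq_square algebra_simps diff_divide_distrib)
    finally show ?thesis .
  qed
  have "corr_ratio \<eta> t x s y \<le> (e * (5 * 2 ^ k)) * (e * (5 * 2 ^ k)) / (e * (2 ^ k / 3) * (1 + m))"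
    unfolding corr_ratio_def Let_def using P D e m0 vp0 vq0 by (intro frac_le) auto
  \<comment> \<open>5 * 5 * 3 = 75; the factor 48 from \<open>string_nondegenerate\<close> then
    makes 3600.\<close>
  also have "\<dots> = 75 * e * 2 ^ k * (1 / (1 + m))"
  proof -
    have "(e * (5 * X)) * (e * (5 * X)) / (e * (X / 3) * q) = 75 * e * X * (1 / q)" if "X \<noteq> 0" for X q
      using that e by simp
    then show ?thesis by simp
  qed
  also have "\<dots> \<le> 75 * e * 2 ^ k * (48 * (1 / (1 + sqrt (t - s) + \<bar>x - y\<bar>)))"
  proof (rule mult_left_mono)
    have "0 \<le> sqrt (t - s)" using st by simp
    then have "0 < (1 + sqrt (t - s) + \<bar>x - y\<bar>) / 48" by (simp add: add_pos_nonneg)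
    moreover have "(1 + sqrt (t - s) + \<bar>x - y\<bar>) / 48 \<le> 1 + m" unfolding m_def
        by (simp add: add_divide_distrib)
    ultimately have "1 / (1 + m) \<le> 1 / ((1 + sqrt (t - s) + \<bar>x - y\<bar>) / 48)" by (intro frac_le) auto
    then show "1 / (1 + m) \<le> 48 * (1 / (1 + sqrt (t - s) + \<bar>x - y\<bar>))" by simp
  qed (use e in auto)
  finally show ?thesis by (simp add: e_def)
qed

lemma corr_ratio_same_scale:
  fixes k i j i' j' :: nat
  assumes \<eta>: "0 < \<eta>" "\<eta> \<le> 1" and ij: "i < 4 ^ k" "i' < 4 ^ k" "j < 2 ^ k" "j' < 2 ^ k"
  shows "corr_ratio \<eta> (4 ^ k + real i) (real j) (4 ^ k + real i') (real j')
    \<le> 3600 / \<eta>\<^sup>2 * 2 ^ k * (1 / (1 + sqrt \<bar>real i - real i'\<bar> + \<bar>real j - real j'\<bar>))"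
proof -
  have r: "real i < 4 ^ k" "real i' < 4 ^ k" "real j < 2 ^ k" "real j' < 2 ^ k"
    using ij by (metis of_nat_less_iff of_nat_power of_nat_numeral)+
  show ?thesis
  proof (cases "i' \<le> i")
    case True
    then show ?thesis
      using corr_ratio_same_scale_ordered[OF \<eta>, of k "4 ^ k + real i'" "4 ^ k
          + real i" "real j" "real j'"] r by simp
  next
    case False
    then show ?thesis
      using corr_ratio_same_scale_ordered[OF \<eta>, of k "4 ^ k + real i" "4 ^ k + real i'" "real j'" "real j"] r
      by (subst corr_ratio_sym) (simp_all add: abs_minus_commute)
  qed
qed

text \<open>The covariance is at most of the order \<open>2 ^ l\<close> of the smaller scale, while
  the product of the variances is at least of order \<open>2 ^ k * 2 ^ l\<close>; so the squared
  correlation is O(2^l / 2^k). The constant is 144 = 4^2 * 9, from the covariance bound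
  \<open>4 * 2 ^ l\<close> and the two variance bounds with denominator 3.\<close>

lemma corr_ratio_cross_scale:
  fixes k l :: nat
  assumes \<eta>: "0 < \<eta>" and lk: "l < k" "144 * 2 ^ l / 2 ^ k < (1::real)"
    and s: "4 ^ l \<le> s" "s \<le> 2 * 4 ^ l" and t: "4 ^ k \<le> t" and y: "0 \<le> y" "y \<le> 2 ^ l"
  shows "corr_ratio \<eta> t x s y \<le> 1 / (1 - 144 * 2 ^ l / 2 ^ k)"
proof -
  have l4: "(4::real) ^ l = (2 ^ l)\<^sup>2" "(4::real) ^ k = (2 ^ k)\<^sup>2"
      by (auto simp: power2_eq_square simp flip: power_mult_distrib)
  have "(4::real) ^ Suc l \<le> 4 ^ k" using lk by (intro power_increasing) auto
  then have gap: "4 ^ k / 2 \<le> t - s" using s t by simp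
  have kpos: "(0::real) < 4 ^ k" by simp
  have s0: "0 \<le> s" "0 \<le> t" using s t by (auto intro: order_trans[of 0 "4 ^ l"] order_trans[of 0 "4 ^ k"])
  have st: "s < t" using gap kpos by linarith
  let ?vp = "string_cov t x t x" and ?vq = "string_cov s y s y" and ?K = "string_cov t x s y"
  have "\<bar>?K\<bar> \<le> \<bar>y\<bar> + sqrt (2 * s) + s / sqrt (4 * pi * (t - s))"
    by (rule string_cov_cross_le[OF s0(1) st])
  also have "\<bar>y\<bar> \<le> 2 ^ l" using y by simp
  also have "sqrt (2 * s) \<le> 2 * 2 ^ l"
  proof -
    have "sqrt (2 * s) \<le> sqrt ((2 * 2 ^ l)\<^sup>2)" using s
        by (intro real_sqrt_le_mono) (simp add: l4 power_mult_distrib)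
    also have "\<dots> = 2 * 2 ^ l" by (simp only: real_sqrt_abs) simp
    finally show ?thesis .
  qed
  also have "s / sqrt (4 * pi * (t - s)) \<le> 2 ^ l"
  proof -
    have "2 * 2 ^ k \<le> sqrt (4 * pi * (t - s))"
    proof (rule real_le_rsqrt)
      have "(2 * 2 ^ k)\<^sup>2 = 4 * 2 * (4 ^ k / 2 :: real)" by (simp add: l4 power_mult_distrib)
      also have "\<dots> \<le> 4 * pi * (t - s)" using pi_ge_two gap by (intro mult_mono) auto
      finally show "(2 * 2 ^ k)\<^sup>2 \<le> 4 * pi * (t - s)" .
    qed
    then have "s / sqrt (4 * pi * (t - s)) \<le> (2 * 4 ^ l) / (2 * 2 ^ k)"
      using s by (intro frac_le) auto
    also have "\<dots> = 2 ^ l * (2 ^ l / 2 ^ k)" by (simp add: l4 power2_eq_square)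
    also have "\<dots> \<le> 2 ^ l * 1" using lk by (intro mult_left_mono) (auto simp: divide_le_eq_1 intro!:
        power_increasing)
    finally show ?thesis by simp
  qed
  finally have K: "\<bar>?K\<bar> \<le> 4 * 2 ^ l" by simp
  have "2 ^ l \<le> sqrt s" by (rule real_le_rsqrt) (use s l4 in simp)
  moreover have "2 ^ k \<le> sqrt t" by (rule real_le_rsqrt) (use t l4 in simp)
  ultimately have vq: "2 ^ l / 3 \<le> ?vq" and vp: "2 ^ k / 3 \<le> ?vp"
    using string_var_ge_sqrt[OF s0(1), of y] string_var_ge_sqrt[OF s0(2), of x] by auto
  define P C where "P = (1 + ?vp / \<eta>\<^sup>2) * (1 + ?vq / \<eta>\<^sup>2)" and "C = (?K / \<eta>\<^sup>2)\<^sup>2"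
  have D: "0 < P - C" unfolding P_def C_def by (rule corr_det_pos[OF s0(2,1)])
  have P0: "0 < P" using D by (simp add: C_def) (smt (verit) zero_le_power2 divide_nonneg_nonneg power_divide)
  have "C \<le> (144 * 2 ^ l / 2 ^ k) * P"
  proof -
    have "?K\<^sup>2 \<le> (4 * 2 ^ l)\<^sup>2" using power_mono[OF K abs_ge_zero, of 2] by (simp only: power2_abs)
    also have "\<dots> = (144 * 2 ^ l / 2 ^ k) * ((2 ^ k / 3) * (2 ^ l / 3))" by (simp add: power2_eq_square)
    also have "\<dots> \<le> (144 * 2 ^ l / 2 ^ k) * (?vp * ?vq)" using vp vq
        by (intro mult_left_mono mult_mono) (auto intro: order_trans[OF _ vp])
    finally have "C \<le> (144 * 2 ^ l / 2 ^ k) * (?vp * ?vq) / (\<eta>\<^sup>2)\<^sup>2"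
      unfolding C_def power_divide by (rule divide_right_mono) simp
    also have "\<dots> = (144 * 2 ^ l / 2 ^ k) * ((?vp / \<eta>\<^sup>2) * (?vq / \<eta>\<^sup>2))" by (simp add: power2_eq_square)
    also have "\<dots> \<le> (144 * 2 ^ l / 2 ^ k) * P" unfolding P_def
      using s0 by (intro mult_left_mono mult_mono) (auto intro!: divide_nonneg_nonneg
          string_var_nonneg add_nonneg_nonneg)
    finally show ?thesis .
  qed
  then have "(1 - 144 * 2 ^ l / 2 ^ k) * P \<le> P - C" by (simp add: algebra_simps)
  then have "P * (1 - 144 * 2 ^ l / 2 ^ k) \<le> 1 * (P - C)" by (simp add: mult.commute)
  then have "P / (P - C) \<le> 1 / (1 - 144 * 2 ^ l / 2 ^ k)"
    using D lk by (intro frac_le_eq[THEN iffD2] divide_le_eq[THEN iffD2]) (auto simp: field_simps)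
  then show ?thesis by (simp add: corr_ratio_def Let_def P_def C_def)
qed

end

section \<open>Recurrence in dimension at most six\<close>

lemma harm_sum: "(\<Sum>i\<in>{1..N}. 1 / real i) = harm N"
  by (simp add: harm_def inverse_eq_divide)

context noise_and_bm
begin

text \<open>Offsets inside a parabolic box with \<open>8 ^ k\<close> integer points:
  \<open>grid_bump\<close> shifts the times by \<open>4 ^ k\<close>, so different k use disjoint
  time ranges.\<close>

definition grid :: "nat \<Rightarrow> (nat \<times> nat) set" where
  "grid k = {..<4 ^ k} \<times> {..<2 ^ k}"

definition grid_bump :: "real \<Rightarrow> nat \<Rightarrow> nat \<times> nat \<Rightarrow> 'w \<Rightarrow> real" where
  "grid_bump \<eta> k p = nbump \<eta> (4 ^ k + real (fst p)) (real (snd p))"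

definition grid_avg :: "real \<Rightarrow> nat \<Rightarrow> 'w \<Rightarrow> real" where
  "grid_avg \<eta> k \<omega> = (\<Sum>p\<in>grid k. grid_bump \<eta> k p \<omega>) / 8 ^ k"

lemma finite_grid[simp]: "finite (grid k)" by (simp add: grid_def)

lemma card_grid: "real (card (grid k)) = 8 ^ k"
  by (simp add: grid_def card_cartesian_product flip: power_mult_distrib)

lemma grid_bump_integrable: "integrable M (grid_bump \<eta> k p)"
  unfolding grid_bump_def by (rule nbump_integrable) simp

lemma grid_bump_pair_integrable: "integrable M (\<lambda>\<omega>. grid_bump \<eta> k p \<omega> * grid_bump \<eta> l q \<omega>)"
  unfolding grid_bump_def by (rule nbump_pair_integrable) simp_all

lemma grid_avg_integrable: "integrable M (grid_avg \<eta> k)"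
  unfolding grid_avg_def[abs_def] by (intro integrable_divide Bochner_Integration.integrable_sum
      grid_bump_integrable)

lemma grid_avg_expectation: "(\<integral>\<omega>. grid_avg \<eta> k \<omega> \<partial>M) = 1"
proof -
  have "(\<integral>\<omega>. grid_bump \<eta> k p \<omega> \<partial>M) = 1" for p
    unfolding grid_bump_def by (rule nbump_expectation) simp
  then show ?thesis unfolding grid_avg_def
    by (simp add: grid_bump_integrable card_grid)
qed

lemma grid_avg_mult: "grid_avg \<eta> k \<omega> * grid_avg \<eta> l \<omega> =
    (\<Sum>p\<in>grid k. \<Sum>q\<in>grid l. grid_bump \<eta> k p \<omega> * grid_bump \<eta> l q \<omega>) / (8 ^ k * 8 ^ l)"
  by (simp add: grid_avg_def sum_product)

lemma grid_avg_pair_integrable: "integrable M (\<lambda>\<omega>. grid_avg \<eta> k \<omega> * grid_avg \<eta> l \<omega>)"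
  unfolding grid_avg_mult
  by (intro integrable_divide Bochner_Integration.integrable_sum grid_bump_pair_integrable)

lemma grid_avg_pair_expectation: "(\<integral>\<omega>. grid_avg \<eta> k \<omega> * grid_avg \<eta> l \<omega> \<partial>M) =
    (\<Sum>p\<in>grid k. \<Sum>q\<in>grid l. \<integral>\<omega>. grid_bump \<eta> k p \<omega> * grid_bump \<eta> l q \<omega> \<partial>M) / (8 ^ k * 8 ^ l)"
  unfolding grid_avg_mult by (simp add: grid_bump_pair_integrable)

lemma grid_avg_pair_le:
  assumes "\<And>p q. p \<in> grid k \<Longrightarrow> q \<in> grid l \<Longrightarrow> (\<integral>\<omega>. grid_bump \<eta> k p \<omega> * grid_bump \<eta> l q \<omega> \<partial>M) \<le> r"
  shows "(\<integral>\<omega>. grid_avg \<eta> k \<omega> * grid_avg \<eta> l \<omega> \<partial>M) \<le> r"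
proof -
  have "(\<Sum>p\<in>grid k. \<Sum>q\<in>grid l. \<integral>\<omega>. grid_bump \<eta> k p \<omega> * grid_bump \<eta> l q \<omega> \<partial>M) \<le> (\<Sum>p\<in>grid k. \<Sum>q\<in>grid l. r)"
    by (intro sum_mono assms)
  also have "\<dots> = 8 ^ k * 8 ^ l * r" by (simp add: card_grid)
  finally show ?thesis unfolding grid_avg_pair_expectation by (simp add: divide_le_eq mult.commute)
qed

lemma grid_avg_cross_scale:
  assumes \<eta>: "0 < \<eta>" and d: "CARD('d) \<le> 6" and lk: "l < k" "144 * 2 ^ l / 2 ^ k < (1::real)"
  shows "(\<integral>\<omega>. grid_avg \<eta> k \<omega> * grid_avg \<eta> l \<omega> \<partial>M) \<le> (1 / (1 - 144 * 2 ^ l / 2 ^ k)) ^ 3"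
proof (rule grid_avg_pair_le)
  fix p q assume "p \<in> grid k" "q \<in> grid l"
  then have q: "real (fst q) \<le> 4 ^ l" "real (snd q) \<le> 2 ^ l"
    unfolding grid_def by auto
  have "(\<integral>\<omega>. grid_bump \<eta> k p \<omega> * grid_bump \<eta> l q \<omega> \<partial>M)
      \<le> corr_ratio \<eta> (4 ^ k + real (fst p)) (real (snd p)) (4 ^ l + real (fst q)) (real (snd q)) ^ 3"
    unfolding grid_bump_def by (rule nbump_pair_le[OF _ _ d]) auto
  also have "\<dots> \<le> (1 / (1 - 144 * 2 ^ l / 2 ^ k)) ^ 3"
    by (intro power_mono corr_ratio_cross_scale[OF \<eta> lk] corr_ratio_nonneg) (use q in auto)
  finally show "(\<integral>\<omega>. grid_bump \<eta> k p \<omega> * grid_bump \<eta> l q \<omega> \<partial>M) \<le> (1 / (1 - 144 * 2 ^ l / 2 ^ k)) ^ 3" .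
qed

text \<open>The cube of the correlation ratio contributes \<open>(2 ^ k) ^ 3\<close>, exactly the
  number of grid points, so it is cancelled by the normalisation. What remains is the lattice sum,
  of order k.\<close>

lemma grid_avg_same_scale:
  assumes \<eta>: "0 < \<eta>" "\<eta> \<le> 1" and d: "CARD('d) \<le> 6" and k: "1 \<le> k"
  shows "(\<integral>\<omega>. grid_avg \<eta> k \<omega> * grid_avg \<eta> k \<omega> \<partial>M) \<le> 24 * (3600 / \<eta>\<^sup>2) ^ 3 * real k"
proof -
  let ?C = "(3600 / \<eta>\<^sup>2) ^ 3"
  have C0: "0 \<le> ?C" by simp
  have row: "(\<Sum>q\<in>grid k. \<integral>\<omega>. grid_bump \<eta> k p \<omega> * grid_bump \<eta> k q \<omega> \<partial>M) \<le> ?C * 8 ^ k * (8 * (1 + 2 * real k))"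
    if p: "p \<in> grid k" for p
  proof -
    let ?w = "\<lambda>s y. 1 / (1 + sqrt \<bar>real (fst p) - real s\<bar> + \<bar>real (snd p) - real y\<bar>) ^ 3"
    have pp: "fst p < 4 ^ k" "snd p < 2 ^ k" using p by (auto simp: grid_def)
    have "(\<integral>\<omega>. grid_bump \<eta> k p \<omega> * grid_bump \<eta> k q \<omega> \<partial>M) \<le> ?C * 8 ^ k * ?w (fst q) (snd q)"
        if q: "q \<in> grid k" for q
    proof -
      have qq: "fst q < 4 ^ k" "snd q < 2 ^ k" using q by (auto simp: grid_def)
      have "(\<integral>\<omega>. grid_bump \<eta> k p \<omega> * grid_bump \<eta> k q \<omega> \<partial>M)
          \<le> corr_ratio \<eta> (4 ^ k + real (fst p)) (real (snd p)) (4 ^ k + real (fst q)) (real (snd q)) ^ 3"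
        unfolding grid_bump_def by (rule nbump_pair_le[OF _ _ d]) auto
      also have "\<dots> \<le> (3600 / \<eta>\<^sup>2 * 2 ^ k * (1 / (1 + sqrt \<bar>real (fst p) - real (fst q)\<bar>
          + \<bar>real (snd p) - real (snd q)\<bar>))) ^ 3"
        by (intro power_mono corr_ratio_same_scale[OF \<eta> pp(1) qq(1) pp(2) qq(2)] corr_ratio_nonneg) auto
      also have "\<dots> = ?C * 8 ^ k * ?w (fst q) (snd q)"
      proof -
        have "((2::real) ^ k) ^ 3 = (2 ^ 3) ^ k" by (simp only: power_mult[symmetric] mult.commute)
        then have "((2::real) ^ k) ^ 3 = 8 ^ k" by simp
        then show ?thesis by (simp only: power_mult_distrib power_one_over)
      qed
      finally show ?thesis .
    qed
    then have "(\<Sum>q\<in>grid k. \<integral>\<omega>. grid_bump \<eta> k p \<omega> * grid_bump \<eta> k q \<omega> \<partial>M)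
        \<le> (\<Sum>q\<in>grid k. ?C * 8 ^ k * ?w (fst q) (snd q))"
      by (rule sum_mono)
    also have "\<dots> = ?C * 8 ^ k * (\<Sum>q\<in>grid k. ?w (fst q) (snd q))" by (rule sum_distrib_left[symmetric])
    also have "(\<Sum>q\<in>grid k. ?w (fst q) (snd q)) = (\<Sum>s<4 ^ k. \<Sum>y<2 ^ k. ?w s y)"
      unfolding grid_def by (simp add: sum.cartesian_product case_prod_beta)
    also have "?C * 8 ^ k * \<dots> \<le> ?C * 8 ^ k * (8 * (1 + 2 * real k))"
      by (intro mult_left_mono lattice_dist_sum_le pp mult_nonneg_nonneg C0) simp
    finally show ?thesis .
  qed
  have "(\<Sum>p\<in>grid k. \<Sum>q\<in>grid k. \<integral>\<omega>. grid_bump \<eta> k p \<omega> * grid_bump \<eta> k q \<omega> \<partial>M)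
     \<le> (\<Sum>p\<in>grid k. ?C * 8 ^ k * (8 * (1 + 2 * real k)))"
    by (rule sum_mono[OF row])
  also have "\<dots> = 8 ^ k * 8 ^ k * (?C * (8 * (1 + 2 * real k)))" by (simp add: card_grid)
  finally have "(\<integral>\<omega>. grid_avg \<eta> k \<omega> * grid_avg \<eta> k \<omega> \<partial>M) \<le> ?C * (8 * (1 + 2 * real k))"
    unfolding grid_avg_pair_expectation by (simp add: divide_le_eq mult.commute)
  also have "\<dots> \<le> ?C * (24 * real k)" using k by (intro mult_left_mono C0) simp
  finally show ?thesis by (simp add: mult_ac)
qed

text \<open>Half of the exponent is spent on the factor
  \<open>exp (- \<delta>\<^sup>2 / (4 * \<eta>\<^sup>2))\<close>; the other half is a bump of width
  \<open>sqrt 2 * \<eta>\<close>. Passing between these widths changes the expectation by a factor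
  of at most 2 to the power d / 2, hence at most 8.\<close>

lemma nbump_off_box:
  assumes t: "0 \<le> t" and \<eta>: "0 < \<eta>" and \<delta>: "0 < \<delta>" and d: "CARD('d) \<le> 6"
    and A[measurable]: "A \<in> sets M" and off: "\<And>\<omega>. \<omega> \<in> A \<Longrightarrow> \<exists>i. \<delta> \<le> \<bar>V t x i \<omega>\<bar>"
  shows "(\<integral>\<omega>. nbump \<eta> t x \<omega> * indicator A \<omega> \<partial>M) \<le> 8 * exp (- \<delta>\<^sup>2 / (4 * \<eta>\<^sup>2))"
proof -
  let ?\<eta> = "sqrt 2 * \<eta>" and ?k = "exp (- \<delta>\<^sup>2 / (4 * \<eta>\<^sup>2))"
  let ?v = "string_cov t x t x / \<eta>\<^sup>2"
  have v: "0 \<le> ?v" using t by (intro divide_nonneg_nonneg string_var_nonneg) auto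
  have pt: "bump \<eta> t x \<omega> * indicator A \<omega> \<le> ?k * bump ?\<eta> t x \<omega>" for \<omega>
  proof (cases "\<omega> \<in> A")
    case True
    let ?S = "\<Sum>i\<in>UNIV. (V t x i \<omega>)\<^sup>2"
    obtain i where i: "\<delta> \<le> \<bar>V t x i \<omega>\<bar>" using off[OF True] by blast
    have "\<delta>\<^sup>2 \<le> (V t x i \<omega>)\<^sup>2" using power_mono[OF i, of 2] \<delta> by simp
    also have "\<dots> \<le> ?S" by (rule member_le_sum) auto
    finally have "\<delta>\<^sup>2 / (4 * \<eta>\<^sup>2) \<le> ?S / (4 * \<eta>\<^sup>2)" by (rule divide_right_mono) simp
    then have "- ?S / (2 * \<eta>\<^sup>2) \<le> - \<delta>\<^sup>2 / (4 * \<eta>\<^sup>2) + - ?S / (2 * ?\<eta>\<^sup>2)"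
      by (simp add: power_mult_distrib)
    then show ?thesis using True by (simp add: bump_eq_exp flip: exp_add)
  qed (simp add: bump_pos less_imp_le)
  have "(\<integral>\<omega>. bump \<eta> t x \<omega> * indicator A \<omega> \<partial>M) \<le> (\<integral>\<omega>. ?k * bump ?\<eta> t x \<omega> \<partial>M)"
    using bump_integrable[OF t] by (intro integral_mono pt integrable_mult_indicator[of A,
        simplified mult.commute] integrable_mult_right) (auto simp: mult.commute[of _ "indicator A
        _"] integrable_mult_indicator[where 'b=real, simplified])
  also have "\<dots> = ?k * (1 / sqrt (1 + ?v / 2)) ^ CARD('d)"
    using t by (simp add: bump_expectation power_mult_distrib mult.commute)
  finally have "(\<integral>\<omega>. bump \<eta> t x \<omega> * indicator A \<omega> \<partial>M) \<le> ?k * (1 / sqrt (1 + ?v / 2)) ^ CARD('d)" .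
  then have "(\<integral>\<omega>. nbump \<eta> t x \<omega> * indicator A \<omega> \<partial>M)
      \<le> ?k * (1 / sqrt (1 + ?v / 2)) ^ CARD('d) / (1 / sqrt (1 + ?v)) ^ CARD('d)"
    unfolding nbump_def bump_expectation[OF t, symmetric] using bump_expectation_pos[OF t, of \<eta> x]
    by (simp add: divide_right_mono)
  also have "\<dots> = ?k * sqrt ((1 + ?v) / (1 + ?v / 2)) ^ CARD('d)"
    using v by (simp add: real_sqrt_divide power_divide)
  also have "sqrt ((1 + ?v) / (1 + ?v / 2)) ^ CARD('d) \<le> sqrt ((1 + ?v) / (1 + ?v / 2)) ^ 6"
    using v d by (intro power_increasing) (auto simp: pos_le_divide_eq)
  also have "\<dots> = ((1 + ?v) / (1 + ?v / 2)) ^ 3"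
    using power_mult[of "sqrt ((1 + ?v) / (1 + ?v / 2))" 2 3] v by simp
  also have "\<dots> \<le> 2 ^ 3" using v by (intro power_mono) (auto simp: pos_divide_le_eq)
  finally show ?thesis by (simp add: mult_ac)
qed

text \<open>Formulated for \<open>V\<close> at integer times and nonnegative integer positions:
  measurability is then a matter of countable intersections, and a hit at such points is enough for
  recurrence.\<close>

definition no_hit :: "real \<Rightarrow> nat \<Rightarrow> 'w set" where
  "no_hit \<delta> T = {\<omega> \<in> space M. \<forall>n\<ge>T. \<forall>m::nat. \<exists>i. \<delta> \<le> \<bar>V (real n) (real m) i \<omega>\<bar>}"

lemma no_hit_sets[measurable]: "no_hit \<delta> T \<in> sets M"
  unfolding no_hit_def by measurable

text \<open>The three parameters act separately: \<eta> makes the exponential small, L brings the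
  off-diagonal second moments close to 1, and N makes the diagonal contribution, relative to the
  squared mean, of order \<open>L / harm N\<close>.\<close>

lemma no_hit_prob_le:
  assumes \<eta>: "0 < \<eta>" "\<eta> \<le> 1" and \<delta>: "0 < \<delta>" and d: "CARD('d) \<le> 6"
    and L: "T \<le> 4 ^ L" "144 / 2 ^ L < (1::real)" and N: "1 \<le> N"
  shows "prob (no_hit \<delta> T) \<le> 8 * exp (- \<delta>\<^sup>2 / (4 * \<eta>\<^sup>2)) +
     sqrt (((1 / (1 - 144 / 2 ^ L)) ^ 3 - 1) + 24 * (3600 / \<eta>\<^sup>2) ^ 3 * real L / harm N)"
proof -
  define H :: real where "H = harm N"
  define r :: real where "r = (1 / (1 - 144 / 2 ^ L)) ^ 3"
  define C where "C = 24 * (3600 / \<eta>\<^sup>2) ^ 3"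
  define \<kappa> where "\<kappa> = 8 * exp (- \<delta>\<^sup>2 / (4 * \<eta>\<^sup>2))"
  define A where "A = no_hit \<delta> T"
  \<comment> \<open>Scales are spaced by L, so every distinct pair is subject to the same bound
    \<open>144 / 2 ^ L\<close>. With weight \<open>1 / i\<close>, a diagonal term of size O(L i)
    contributes O(L / i).\<close>
  define Z where "Z \<omega> = (\<Sum>i\<in>{1..N}. 1 / real i * grid_avg \<eta> (L * i) \<omega>)" for \<omega>
  have L1: "1 \<le> L" using L(2) by (cases L) auto
  have H0: "0 < H" unfolding H_def using N by (intro harm_pos) simp
  have Hs: "(\<Sum>i\<in>{1..N}. 1 / real i) = H" unfolding H_def by (rule harm_sum)
  have r0: "0 \<le> r" unfolding r_def using L by simp
  have C0: "0 \<le> C" unfolding C_def by simp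
  have Zint: "integrable M Z" unfolding Z_def[abs_def]
    by (intro Bochner_Integration.integrable_sum integrable_mult_right grid_avg_integrable)
  have [measurable]: "Z \<in> borel_measurable M" using Zint by (rule borel_measurable_integrable)
  have EZ: "(\<integral>\<omega>. Z \<omega> \<partial>M) = H"
    unfolding Z_def by (simp add: grid_avg_integrable grid_avg_expectation Hs del: One_nat_def)
  have Z2: "(Z \<omega>)\<^sup>2 = (\<Sum>i\<in>{1..N}. \<Sum>j\<in>{1..N}. 1 / real i * (1 / real j) * (grid_avg \<eta> (L * i) \<omega>
      * grid_avg \<eta> (L * j) \<omega>))" for \<omega>
    unfolding Z_def power2_eq_square sum_product by (intro sum.cong refl) simp
  have Z2int: "integrable M (\<lambda>\<omega>. (Z \<omega>)\<^sup>2)" unfolding Z2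
    by (intro Bochner_Integration.integrable_sum integrable_mult_right grid_avg_pair_integrable)
  have cross: "(\<integral>\<omega>. grid_avg \<eta> (L * i) \<omega> * grid_avg \<eta> (L * j) \<omega> \<partial>M) \<le> r" if ij: "i > j" for i j
  proof -
    have le: "144 * 2 ^ (L * j) / 2 ^ (L * i) \<le> 144 / (2::real) ^ L"
    proof -
      have "L * j + L \<le> L * i" using ij by (metis Suc_leI mult_Suc_right mult_le_mono2 add.commute)
      then have "(2::real) ^ (L * j + L) \<le> 2 ^ (L * i)" by (intro power_increasing) auto
      then show ?thesis by (simp add: power_add field_simps)
    qed
    have "(\<integral>\<omega>. grid_avg \<eta> (L * i) \<omega> * grid_avg \<eta> (L * j) \<omega> \<partial>M)
        \<le> (1 / (1 - 144 * 2 ^ (L * j) / 2 ^ (L * i))) ^ 3"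
    proof (rule grid_avg_cross_scale[OF \<eta>(1) d])
      show "L * j < L * i" using ij L1 by simp
      show "144 * 2 ^ (L * j) / 2 ^ (L * i) < (1::real)" using le L(2) by linarith
    qed
    also have "\<dots> \<le> r"
    proof -
      have "1 / (1 - a) \<le> 1 / (1 - b)" "0 \<le> 1 / (1 - a)" if "a \<le> b" "b < 1" for a b :: real
        using that by (auto intro!: frac_le)
      from this[OF le L(2)] show ?thesis unfolding r_def by (intro power_mono)
    qed
    finally show ?thesis .
  qed
  have pair: "(\<integral>\<omega>. grid_avg \<eta> (L * i) \<omega> * grid_avg \<eta> (L * j) \<omega> \<partial>M) \<le> r + (if i
      = j then C * real L * real i else 0)"
    if "i \<in> {1..N}" for i j
  proof -
    consider "i = j" | "i > j" | "j > i" by linarith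
    then show ?thesis
    proof cases
      case 1
      have "1 \<le> L * i" using L1 that by (cases L; cases i) auto
      then have "(\<integral>\<omega>. grid_avg \<eta> (L * i) \<omega> * grid_avg \<eta> (L * i) \<omega> \<partial>M) \<le> C * real (L * i)"
        unfolding C_def by (intro grid_avg_same_scale \<eta> d)
      then show ?thesis using 1 r0 by (simp add: mult.assoc)
    next
      case 2 then show ?thesis using cross by simp
    next
      case 3 then show ?thesis using cross[of i j] by (simp add: mult.commute)
    qed
  qed
  have "(\<integral>\<omega>. (Z \<omega>)\<^sup>2 \<partial>M) = (\<Sum>i\<in>{1..N}. \<Sum>j\<in>{1..N}. 1 / real i * (1 / real j) * (\<integral>\<omega>. grid_avg \<eta> (L
      * i) \<omega> * grid_avg \<eta> (L * j) \<omega> \<partial>M))"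
    unfolding Z2 by (simp add: grid_avg_pair_integrable del: times_divide_eq_left times_divide_eq_right)
  also have "\<dots> \<le> (\<Sum>i\<in>{1..N}. \<Sum>j\<in>{1..N}. 1 / real i * (1 / real j) * (r + (if i
      = j then C * real L * real i else 0)))"
    by (intro sum_mono mult_left_mono pair) auto
  also have "\<dots> = (\<Sum>i\<in>{1..N}. \<Sum>j\<in>{1..N}. r * (1 / real i * (1 / real j)) + (if i
      = j then C * real L * (1 / real i) else 0))"
    by (intro sum.cong refl) (auto simp: field_simps)
  also have "\<dots> = r * (H * H) + C * real L * H"
  proof -
    have "(\<Sum>i\<in>{1..N}. \<Sum>j\<in>{1..N}. r * (1 / real i * (1 / real j))) = r * (H * H)"
    proof -
      have "H * H = (\<Sum>i\<in>{1..N}. \<Sum>j\<in>{1..N}. 1 / real i * (1 / real j))"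
        unfolding Hs[symmetric] by (rule sum_product)
      then show ?thesis by (simp only: sum_distrib_left)
    qed
    moreover have "(\<Sum>i\<in>{1..N}. \<Sum>j\<in>{1..N}. if i = j then C * real L * (1 / real i) else 0)
        = (\<Sum>i\<in>{1..N}. C * real L * (1 / real i))"
      by (intro sum.cong refl) (simp only: sum.delta' finite_atLeastAtMost if_True)
    moreover have "(\<Sum>i\<in>{1..N}. C * real L * (1 / real i)) = C * real L * H"
      unfolding Hs[symmetric] sum_distrib_left ..
    ultimately show ?thesis by (simp only: sum.distrib)
  qed
  finally have EZ2: "(\<integral>\<omega>. (Z \<omega>)\<^sup>2 \<partial>M) \<le> r * (H * H) + C * real L * H" .
  have dint: "integrable M (\<lambda>\<omega>. (Z \<omega> - H)\<^sup>2)" unfolding power2_diff using Zint Z2int by simp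
  have "(\<integral>\<omega>. (Z \<omega> - H)\<^sup>2 \<partial>M) = (\<integral>\<omega>. (Z \<omega>)\<^sup>2 \<partial>M) + H\<^sup>2 - 2 * H * H"
    unfolding power2_diff using Zint Z2int EZ by (simp add: prob_space)
  also have "\<dots> \<le> (r - 1) * (H * H) + C * real L * H" using EZ2 by (simp add: power2_eq_square algebra_simps)
  finally have var: "(\<integral>\<omega>. (Z \<omega> - H)\<^sup>2 \<partial>M) \<le> (r - 1) * (H * H) + C * real L * H" .
  have a: "integrable M (\<lambda>\<omega>. \<bar>Z \<omega> - H\<bar>)" "(\<integral>\<omega>. \<bar>Z \<omega> - H\<bar> \<partial>M)\<^sup>2 \<le> (\<integral>\<omega>. (Z \<omega> - H)\<^sup>2 \<partial>M)"
    using integral_square_le[of "\<lambda>\<omega>. \<bar>Z \<omega> - H\<bar>"] dint by auto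
  then have abs: "(\<integral>\<omega>. \<bar>Z \<omega> - H\<bar> \<partial>M) \<le> sqrt ((r - 1) * (H * H) + C * real L * H)"
    using var by (intro real_le_rsqrt) linarith
  have A[measurable]: "A \<in> sets M" by (simp add: A_def)
  have gA: "integrable M (\<lambda>\<omega>. grid_bump \<eta> k p \<omega> * indicator A \<omega>)" for k p
    by (rule integrable_real_mult_indicator[OF A grid_bump_integrable])
  have ZA: "integrable M (\<lambda>\<omega>. Z \<omega> * indicator A \<omega>)" by (rule integrable_real_mult_indicator[OF A Zint])
  have avgA: "(\<integral>\<omega>. grid_avg \<eta> (L * i) \<omega> * indicator A \<omega> \<partial>M) \<le> \<kappa>" if i: "i \<in> {1..N}" for i
  proof -
    let ?k = "L * i"
    have "(\<integral>\<omega>. grid_bump \<eta> ?k p \<omega> * indicator A \<omega> \<partial>M) \<le> \<kappa>" for p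
      unfolding grid_bump_def \<kappa>_def
    proof (rule nbump_off_box[OF _ \<eta>(1) \<delta> d A])
      fix \<omega> assume "\<omega> \<in> A"
      moreover have "T \<le> 4 ^ ?k + fst p"
      proof -
        have "(4::nat) ^ L \<le> 4 ^ (L * i)" using i by (intro power_increasing) auto
        then show ?thesis using L(1) by linarith
      qed
      ultimately have "\<exists>j. \<delta> \<le> \<bar>V (real (4 ^ ?k + fst p)) (real (snd p)) j \<omega>\<bar>"
        unfolding A_def no_hit_def by blast
      then show "\<exists>j. \<delta> \<le> \<bar>V (4 ^ ?k + real (fst p)) (real (snd p)) j \<omega>\<bar>"
        by (simp only: of_nat_add of_nat_power of_nat_numeral)
    qed simp
    then have "(\<Sum>p\<in>grid ?k. \<integral>\<omega>. grid_bump \<eta> ?k p \<omega> * indicator A \<omega> \<partial>M) \<le> (\<Sum>p\<in>grid ?k. \<kappa>)"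
      by (intro sum_mono)
    also have "\<dots> = 8 ^ ?k * \<kappa>" by (simp add: card_grid)
    finally have s: "(\<Sum>p\<in>grid ?k. \<integral>\<omega>. grid_bump \<eta> ?k p \<omega> * indicator A \<omega> \<partial>M) / 8 ^ ?k \<le> \<kappa>"
      by (simp add: divide_le_eq mult.commute)
    have "(\<integral>\<omega>. grid_avg \<eta> ?k \<omega> * indicator A \<omega> \<partial>M)
        = (\<integral>\<omega>. (\<Sum>p\<in>grid ?k. grid_bump \<eta> ?k p \<omega> * indicator A \<omega>) / 8 ^ ?k \<partial>M)"
      by (simp add: grid_avg_def sum_distrib_right)
    also have "\<dots> = (\<Sum>p\<in>grid ?k. \<integral>\<omega>. grid_bump \<eta> ?k p \<omega> * indicator A \<omega> \<partial>M) / 8 ^ ?k"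
      by (simp only: integral_divide_zero Bochner_Integration.integral_sum gA)
    finally show ?thesis using s by simp
  qed
  have "(\<integral>\<omega>. Z \<omega> * indicator A \<omega> \<partial>M) = (\<integral>\<omega>. (\<Sum>i\<in>{1..N}. 1 / real i * (grid_avg \<eta> (L * i) \<omega>
      * indicator A \<omega>)) \<partial>M)"
    unfolding Z_def sum_distrib_right by (simp only: mult.assoc)
  also have "\<dots> = (\<Sum>i\<in>{1..N}. 1 / real i * (\<integral>\<omega>. grid_avg \<eta> (L * i) \<omega> * indicator A \<omega> \<partial>M))"
    by (simp add: integrable_real_mult_indicator[OF A grid_avg_integrable] del: times_divide_eq_left
        times_divide_eq_right)
  also have "\<dots> \<le> (\<Sum>i\<in>{1..N}. 1 / real i * \<kappa>)" by (intro sum_mono mult_left_mono avgA) auto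
  also have "\<dots> = H * \<kappa>" unfolding sum_distrib_right[symmetric] Hs ..
  finally have ZAle: "(\<integral>\<omega>. Z \<omega> * indicator A \<omega> \<partial>M) \<le> H * \<kappa>" .
  \<comment> \<open>Without a hit \<open>Z\<close> has small mean, yet it is close to \<open>H\<close> in L1.\<close>
  have "H * prob A = (\<integral>\<omega>. H * indicator A \<omega> \<partial>M)" by simp
  also have "\<dots> \<le> (\<integral>\<omega>. Z \<omega> * indicator A \<omega> + \<bar>Z \<omega> - H\<bar> \<partial>M)"
  proof (rule integral_mono)
    show "integrable M (\<lambda>\<omega>. H * indicator A \<omega>)" by (simp add: less_top[symmetric])
    show "integrable M (\<lambda>\<omega>. Z \<omega> * indicator A \<omega> + \<bar>Z \<omega> - H\<bar>)" using ZA a by simp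
    show "H * indicator A \<omega> \<le> Z \<omega> * indicator A \<omega> + \<bar>Z \<omega> - H\<bar>" for \<omega>
      using abs_ge_minus_self[of "Z \<omega> - H"] by (cases "\<omega> \<in> A") auto
  qed
  also have "\<dots> = (\<integral>\<omega>. Z \<omega> * indicator A \<omega> \<partial>M) + (\<integral>\<omega>. \<bar>Z \<omega> - H\<bar> \<partial>M)" using ZA a by simp
  also have "\<dots> \<le> H * \<kappa> + sqrt ((r - 1) * (H * H) + C * real L * H)" using ZAle abs by linarith
  also have "sqrt ((r - 1) * (H * H) + C * real L * H) = H * sqrt ((r - 1) + C * real L / H)"
  proof -
    have "(r - 1) * (H * H) + C * real L * H = H\<^sup>2 * ((r - 1) + C * real L / H)"
      using H0 by (simp add: power2_eq_square field_simps)
    then show ?thesis using H0 by (simp add: real_sqrt_mult)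
  qed
  also have "H * \<kappa> + H * sqrt ((r - 1) + C * real L / H) = H * (\<kappa> + sqrt ((r - 1) + C * real L / H))"
    by (simp add: algebra_simps)
  finally have "prob A \<le> \<kappa> + sqrt ((r - 1) + C * real L / H)" using H0 by simp
  then show ?thesis unfolding A_def \<kappa>_def r_def C_def H_def .
qed

lemma no_hit_null:
  assumes \<delta>: "0 < \<delta>" and d: "CARD('d) \<le> 6"
  shows "prob (no_hit \<delta> T) = 0"
proof (rule ccontr)
  let ?p = "prob (no_hit \<delta> T)"
  assume "?p \<noteq> 0"
  then have p: "0 < ?p" "?p \<le> 1" by (auto simp: zero_less_measure_iff)
  \<comment> \<open>With \<tau> bounding the exponential, the excess of the second moment and the
    diagonal part alike, the bound is at most \<tau> + sqrt (2 \<tau>); here sqrt (2 \<tau>) = p / 4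
    and \<tau> is at most p / 32, which is less than p in total.\<close>
  define \<tau> where "\<tau> = ?p\<^sup>2 / 32"
  have \<tau>: "0 < \<tau>" using p by (simp add: \<tau>_def)
  \<comment> \<open>Since \<open>exp z \<ge> z\<close>, the exponential term is at most
    \<open>32 * \<eta>\<^sup>2 / \<delta>\<^sup>2\<close>, and this \<eta> makes it at most
    \<tau>.\<close>
  define \<eta> where "\<eta> = min 1 (sqrt (\<tau> * \<delta>\<^sup>2 / 32))"
  have \<eta>: "0 < \<eta>" "\<eta> \<le> 1" using \<tau> \<delta> by (auto simp: \<eta>_def)
  have "\<eta>\<^sup>2 \<le> (sqrt (\<tau> * \<delta>\<^sup>2 / 32))\<^sup>2" using \<eta> by (intro power_mono) (auto simp: \<eta>_def)
  then have \<eta>2: "32 * \<eta>\<^sup>2 \<le> \<tau> * \<delta>\<^sup>2" using \<tau> by simp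
  have kappa: "8 * exp (- \<delta>\<^sup>2 / (4 * \<eta>\<^sup>2)) \<le> \<tau>"
  proof -
    let ?z = "\<delta>\<^sup>2 / (4 * \<eta>\<^sup>2)"
    have z: "0 < ?z" using \<delta> \<eta> by simp
    have "?z \<le> exp ?z" using exp_ge_add_one_self[of ?z] by linarith
    then have "8 / exp ?z \<le> 8 / ?z" using z by (intro frac_le) auto
    moreover have "8 * exp (- ?z) = 8 / exp ?z" by (simp only: exp_minus divide_inverse)
    ultimately have "8 * exp (- ?z) \<le> 8 / ?z" by (simp only:)
    also have "\<dots> = 32 * \<eta>\<^sup>2 / \<delta>\<^sup>2" using \<delta> \<eta> by simp
    also have "\<dots> \<le> \<tau>" using \<eta>2 \<delta> by (simp add: pos_divide_le_eq)
    finally show ?thesis by simp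
  qed
  have lim0: "(\<lambda>L. 144 / (2::real) ^ L) \<longlonglongrightarrow> 0" by (rule LIMSEQ_divide_realpow_zero) simp
  have lim: "(\<lambda>L. (1 / (1 - 144 / (2::real) ^ L)) ^ 3) \<longlonglongrightarrow> (1 / (1 - 0)) ^ 3"
    by (intro tendsto_intros lim0) simp
  have ev1: "\<forall>\<^sub>F L in sequentially. 144 / (2::real) ^ L < 1"
    using order_tendstoD(2)[OF lim0, of 1] by simp
  have ev2: "\<forall>\<^sub>F L in sequentially. (1 / (1 - 144 / (2::real) ^ L)) ^ 3 < 1 + \<tau>"
    using order_tendstoD(2)[OF lim, of "1 + \<tau>"] \<tau> by simp
  obtain L where L: "144 / (2::real) ^ L < 1" "(1 / (1 - 144 / (2::real) ^ L)) ^ 3 < 1 + \<tau>" "T \<le> L"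
    using eventually_happens'[OF _ eventually_conj[OF ev1 eventually_conj[OF ev2
        eventually_ge_at_top[of T]]]] by auto
  have "L < 2 ^ L" by (rule less_exp)
  also have "(2::nat) ^ L \<le> 4 ^ L" by (rule power_mono) auto
  finally have LT: "T \<le> 4 ^ L" using L by simp
  let ?C = "24 * (3600 / \<eta>\<^sup>2) ^ 3 * real L"
  have "\<forall>\<^sub>F N in sequentially. ?C / \<tau> + 1 \<le> harm N"
    using harm_at_top by (simp add: filterlim_at_top)
  then obtain N where N: "?C / \<tau> + 1 \<le> harm N" "1 \<le> N"
    using eventually_happens'[OF _ eventually_conj[OF _ eventually_ge_at_top[of "1::nat"]]] by force
  have "0 \<le> ?C / \<tau>" using \<tau> by simp
  then have H0: "0 < (harm N :: real)" using N by linarith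
  have "?C / harm N \<le> \<tau>"
  proof -
    have "?C / \<tau> \<le> harm N" using N by simp
    then have "?C \<le> harm N * \<tau>" using \<tau> by (simp add: pos_divide_le_eq)
    then show ?thesis using H0 by (simp add: pos_divide_le_eq mult.commute)
  qed
  then have "sqrt (((1 / (1 - 144 / 2 ^ L)) ^ 3 - 1) + ?C / harm N) \<le> sqrt ((?p / 4)\<^sup>2)"
    using L(2) by (intro real_sqrt_le_mono) (simp add: \<tau>_def power_divide)
  moreover have "\<dots> = ?p / 4" using p by simp
  moreover have "\<tau> \<le> ?p / 32"
    unfolding \<tau>_def power2_eq_square using p mult_left_mono[of ?p 1 ?p] by simp
  ultimately have "?p \<le> ?p / 32 + ?p / 4"
    using no_hit_prob_le[OF \<eta> \<delta> d LT L(1) N(2)] kappa by linarith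
  then show False using p by simp
qed

lemma recurrent_AE:
  assumes U: "pinned_string_version M U0 W U" and d: "CARD('d) \<le> 6"
  shows "AE \<omega> in M. recurrent (U \<omega>)"
proof -
  have "AE \<omega> in M. \<forall>k T::nat. \<omega> \<notin> no_hit (1 / real (Suc k)) T"
    unfolding AE_all_countable
    by (intro allI AE_not_in) (auto simp: null_sets_def emeasure_eq_measure no_hit_null[OF _ d])
  moreover have "AE \<omega> in M. \<forall>n m::nat. \<forall>i. U \<omega> (real n) (real m) $ i = V (real n) (real m) i \<omega>"
  proof -
    have "AE \<omega> in M. U \<omega> (real n) (real m) $ i = V (real n) (real m) i \<omega>" for n m i
      using V_AE[OF U of_nat_0_le_iff, of n "real m"] by eventually_elim blast
    then show ?thesis by (simp add: AE_all_countable)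
  qed
  ultimately show ?thesis using AE_space
  proof eventually_elim
    case (elim \<omega>)
    show ?case unfolding recurrent_def
    proof (intro allI impI)
      fix \<delta> :: real assume "0 < \<delta>"
      then obtain k where k: "1 / real (Suc k) < \<delta>" using nat_approx_posE by blast
      have "\<forall>T. \<exists>p::nat \<times> nat. T \<le> fst p \<and> (\<forall>i. \<bar>V (real (fst p)) (real (snd p)) i \<omega>\<bar> < 1 / real (Suc k))"
      proof
        fix T
        have "\<omega> \<notin> no_hit (1 / real (Suc k)) T" using elim by blast
        then obtain n m where "T \<le> n" "\<forall>i. \<bar>V (real n) (real m) i \<omega>\<bar> < 1 / real (Suc k)"
          using elim(3) unfolding no_hit_def by (auto simp: not_le)
        then show "\<exists>p::nat \<times> nat. T \<le> fst p \<and> (\<forall>i. \<bar>V (real (fst p)) (real (snd p)) i \<omega>\<bar> < 1 / real (Suc k))"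
          by (intro exI[of _ "(n, m)"]) simp
      qed
      then obtain p where p: "\<And>T. T \<le> fst (p T)" "\<And>T i. \<bar>V (real (fst (p T))) (real (snd (p T))) i
          \<omega>\<bar> < 1 / real (Suc k)"
        by metis
      show "\<exists>xs ts. (\<forall>n. 0 \<le> ts n) \<and> filterlim ts at_top sequentially \<and> (\<forall>n. U \<omega> (ts n) (xs n) \<in> box_nbhd \<delta>)"
      proof (rule exI[of _ "\<lambda>T. real (snd (p T))"], rule exI[of _ "\<lambda>T. real (fst (p T))"], intro conjI allI)
        show "filterlim (\<lambda>T. real (fst (p T))) at_top sequentially"
          by (rule filterlim_at_top_mono[OF filterlim_real_sequentially]) (use p(1) in auto)
        show "U \<omega> (real (fst (p n))) (real (snd (p n))) \<in> box_nbhd \<delta>" for n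
          unfolding box_nbhd_def using elim(2) less_trans[OF p(2) k] by simp
      qed simp
    qed
  qed
qed

end

section \<open>Transience in dimension at least seven\<close>

context noise_and_bm
begin

lemma V_increment_gaussian:
  assumes "0 \<le> t" "0 \<le> s"
  shows "centered_gaussian M (\<integral>\<omega>. (V t x i \<omega> - V s y i \<omega>)\<^sup>2 \<partial>M) (\<lambda>\<omega>. V t x i \<omega> - V s y i \<omega>)"
proof -
  have "(\<lambda>\<omega>. V t x i \<omega> + (- 1) * V s y i \<omega>) \<in> gaussian_space"
    by (intro gaussian_space_add gaussian_space_scale V_gaussian assms)
  then show ?thesis by (intro gaussian_space_centered) simp
qed

text \<open>On the event each factor of the bump of width K is at least
  \<open>exp (- 1 / 2)\<close>, so the expectation of the bump bounds the probability. The constant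
  is 42 = 3 * 14, with 3 in place of \<open>exp 1\<close> and 14 from
  \<open>string_var_ge\<close>.\<close>

lemma V_small_prob:
  assumes t: "0 < t" and K: "0 < K" and d: "7 \<le> CARD('d)"
  shows "prob {\<omega> \<in> space M. \<forall>i. \<bar>V t x i \<omega>\<bar> < K} \<le> (42 * K\<^sup>2 / (\<bar>x\<bar> + sqrt t)) powr (7 / 2)"
proof -
  let ?A = "{\<omega> \<in> space M. \<forall>i. \<bar>V t x i \<omega>\<bar> < K}"
  let ?v = "string_cov t x t x"
  let ?R = "\<bar>x\<bar> + sqrt t"
  have t0: "0 \<le> t" using t by simp
  note [measurable] = V_measurable[OF t0]
  have A[measurable]: "?A \<in> sets M" by measurable
  have R: "0 < ?R" using t by (simp add: add_nonneg_pos)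
  have v: "?R / 14 \<le> ?v" by (rule string_var_ge[OF t0])
  have v0: "0 < ?v" using v R by (intro less_le_trans[OF _ v]) auto
  define q where "q = 42 * K\<^sup>2 / ?R"
  have q0: "0 < q" using K R by (simp add: q_def)
  show ?thesis
  \<comment> \<open>If q exceeds 1 the bound is trivial; otherwise \<open>sqrt q\<close> is at most
    1 and the exponent may be lowered from d to 7.\<close>
  proof (cases "q \<le> 1")
    case False
    have "prob ?A \<le> 1" by simp
    also have "1 \<le> q powr (7 / 2)" using False by (intro ge_one_powr_ge_zero) auto
    finally show ?thesis by (simp add: q_def)
  next
    case True
    let ?d = "CARD('d)"
    have pt: "indicator ?A \<omega> \<le> exp (1 / 2) ^ ?d * bump K t x \<omega>" for \<omega>
    proof (cases "\<omega> \<in> ?A")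
      case True
      have "exp (- (1 / 2)) \<le> exp (- (V t x i \<omega> / K)\<^sup>2 / 2)" for i
      proof -
        have "\<bar>V t x i \<omega> / K\<bar> \<le> 1" using True K by (auto simp: abs_divide divide_le_eq_1 less_imp_le)
        then have "(V t x i \<omega> / K)\<^sup>2 \<le> 1" by (simp add: abs_square_le_1)
        then show ?thesis by simp
      qed
      then have "(\<Prod>i\<in>(UNIV::'d set). exp (- (1 / 2))) \<le> bump K t x \<omega>"
        unfolding bump_def by (intro prod_mono) auto
      then have "exp (1 / 2) ^ ?d * exp (- (1 / 2)) ^ ?d \<le> exp (1 / 2) ^ ?d * bump K t x \<omega>"
        by (intro mult_left_mono) auto
      moreover have "exp (1 / 2) ^ ?d * exp (- (1 / 2)) ^ ?d = (1::real)"
        by (simp flip: power_mult_distrib exp_add)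
      ultimately show ?thesis using True by simp
    qed (simp add: bump_pos less_imp_le)
    have "prob ?A = (\<integral>\<omega>. indicator ?A \<omega> \<partial>M)" by simp
    also have "\<dots> \<le> (\<integral>\<omega>. exp (1 / 2) ^ ?d * bump K t x \<omega> \<partial>M)"
      using bump_integrable[OF t0, of K x] by (intro integral_mono pt) (auto simp: less_top[symmetric])
    also have "\<dots> = (exp (1 / 2) / sqrt (1 + ?v / K\<^sup>2)) ^ ?d"
      by (simp add: bump_expectation[OF t0] power_divide)
    also have "\<dots> \<le> sqrt q ^ ?d"
    proof (rule power_mono)
      have "exp (1 / 2) = sqrt (exp 1 :: real)"
          by (rule real_sqrt_unique[symmetric]) (auto simp flip: exp_double)
      then have "exp (1 / 2) / sqrt (1 + ?v / K\<^sup>2) = sqrt (exp 1 / (1 + ?v / K\<^sup>2))"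
          by (simp add: real_sqrt_divide)
      also have "\<dots> \<le> sqrt q"
      proof (rule real_sqrt_le_mono)
        have "exp 1 / (1 + ?v / K\<^sup>2) \<le> 3 / (?R / 14 / K\<^sup>2)"
        proof (rule frac_le)
          have "?R / 14 / K\<^sup>2 \<le> ?v / K\<^sup>2" using v by (rule divide_right_mono) simp
          then show "?R / 14 / K\<^sup>2 \<le> 1 + ?v / K\<^sup>2" by simp
        qed (use R K exp_le in auto)
        also have "\<dots> = q" using R K by (simp add: q_def)
        finally show "exp 1 / (1 + ?v / K\<^sup>2) \<le> q" .
      qed
      finally show "exp (1 / 2) / sqrt (1 + ?v / K\<^sup>2) \<le> sqrt q" .
    qed (use v0 in auto)
    also have "\<dots> \<le> sqrt q ^ 7" using True q0 d by (intro power_decreasing) auto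
    also have "\<dots> = q powr (7 / 2)"
    proof -
      have "sqrt q = q powr (1 / 2)" using q0 by (simp add: powr_half_sqrt)
      then have "sqrt q powr 7 = q powr (7 / 2)" by (simp only: powr_powr) simp
      moreover have "sqrt q powr 7 = sqrt q ^ 7" using q0 by simp
      ultimately show ?thesis by simp
    qed
    finally show ?thesis by (simp add: q_def)
  qed
qed

section \<open>Chaining inside unit boxes\<close>

definition dyadic :: "nat \<Rightarrow> nat \<Rightarrow> real" where
  "dyadic l i = real i / 2 ^ l"

text \<open>Increments from level \<open>l\<close> to \<open>l + 1\<close> up to \<open>K (9/10) ^ (l + 1)\<close> sum to less than \<open>10 K\<close>.
  With the 112th moment the failure probability decays like \<open>8 powr (- l)\<close>, which beats the \<open>4 ^ l\<close>
  grid points, and like \<open>K powr (- 112)\<close>.\<close>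
definition step_const :: real where
  "step_const = fact 112 * 10 ^ 56"

lemma step_const_pos: "0 < step_const" unfolding step_const_def by (intro mult_pos_pos) auto

text \<open>The point with index i at level l + 1 is compared with the one of index
  \<open>i div 2\<close> at level l, which is obtained by rounding down. Time therefore never
  decreases along the chain, as \<open>V_increment_le\<close> demands.\<close>

definition big_step :: "real \<Rightarrow> nat \<Rightarrow> int \<Rightarrow> nat \<Rightarrow> nat \<Rightarrow> nat \<Rightarrow> 'd \<Rightarrow> 'w set" where
  "big_step K n m l i j c = {\<omega> \<in> space M. K * (9 / 10) ^ Suc l \<le>
     \<bar>V (real n + dyadic (Suc l) i) (real_of_int m + dyadic (Suc l) j) c \<omega> -
      V (real n + dyadic l (i div 2)) (real_of_int m + dyadic l (j div 2)) c \<omega>\<bar>}"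

lemma dyadic_nonneg[simp]: "0 \<le> dyadic l i" by (simp add: dyadic_def)

lemma dyadic_step: "0 \<le> dyadic (Suc l) i - dyadic l (i div 2)" "dyadic (Suc l) i
    - dyadic l (i div 2) \<le> 1 / 2 ^ Suc l"
proof -
  have "real i = 2 * real (i div 2) + real (i mod 2)"
    by (metis mult_div_mod_eq of_nat_add of_nat_mult of_nat_numeral)
  then have "dyadic (Suc l) i - dyadic l (i div 2) = real (i mod 2) / 2 ^ Suc l"
    by (simp add: dyadic_def add_divide_distrib)
  moreover have "real (i mod 2) \<le> 1" by simp
  ultimately show "0 \<le> dyadic (Suc l) i - dyadic l (i div 2)" "dyadic (Suc l) i - dyadic l (i div 2)
      \<le> 1 / 2 ^ Suc l"
    by (auto intro!: divide_right_mono)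
qed

lemma big_step_sets[measurable]: "big_step K n m l i j c \<in> sets M"
proof -
  have [measurable]: "V (real n + dyadic l' i') x c \<in> borel_measurable M" for l' i' x
    by (rule V_measurable) simp
  show ?thesis unfolding big_step_def by measurable
qed

text \<open>Per level the variance bound shrinks by \<open>1 / sqrt 2\<close> and the squared
  threshold by \<open>(9 / 10)\<^sup>2\<close>. Their ratio is less than 1, and its 56th power,
  coming from the moment of order 112, falls below 1 / 8.\<close>

lemma step_ratio_le: "(1 / sqrt 2 / (9 / 10)\<^sup>2) ^ 56 \<le> (1 / 8 :: real)"
proof -
  have "(1 / sqrt 2 / (9 / 10)\<^sup>2) ^ 56 = ((1 / sqrt 2 / (9 / 10)\<^sup>2)\<^sup>2) ^ 28"
      by (simp only: power_mult[symmetric]) simp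
  also have "(1 / sqrt 2 / (9 / 10)\<^sup>2)\<^sup>2 = (5000 / 6561 :: real)" by (simp add: power_divide power2_eq_square)
  also have "(5000 / 6561 :: real) ^ 28 \<le> (4 / 5) ^ 28" by (rule power_mono) auto
  also have "\<dots> \<le> 1 / 8" by (simp add: power_divide)
  finally show ?thesis .
qed

lemma step_power_eq:
  "(10 * sqrt (1 / 2 ^ k) / (K * (9 / 10) ^ k)\<^sup>2) ^ 56
      = 10 ^ 56 / K ^ 112 * ((1 / sqrt 2 / (9 / 10)\<^sup>2) ^ 56) ^ k"
proof -
  have "sqrt (1 / 2 ^ k) = (1 / sqrt 2) ^ k" by (simp add: real_sqrt_divide real_sqrt_power power_one_over)
  moreover have "(K * (9 / 10) ^ k)\<^sup>2 = K\<^sup>2 * ((9 / 10)\<^sup>2) ^ k"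
      by (simp only: power_mult_distrib power_mult[symmetric] mult.commute)
  ultimately have "10 * sqrt (1 / 2 ^ k) / (K * (9 / 10) ^ k)\<^sup>2 = 10 / K\<^sup>2 * (1 / sqrt 2 / (9 / 10)\<^sup>2) ^ k"
    by (simp only: power_divide[of "1 / sqrt 2"] times_divide_times_eq)
  then have "(10 * sqrt (1 / 2 ^ k) / (K * (9 / 10) ^ k)\<^sup>2) ^ 56
      = (10 / K\<^sup>2) ^ 56 * ((1 / sqrt 2 / (9 / 10)\<^sup>2) ^ k) ^ 56"
    by (simp only: power_mult_distrib)
  also have "((1 / sqrt 2 / (9 / 10)\<^sup>2) ^ k) ^ 56 = ((1 / sqrt 2 / (9 / 10 :: real)\<^sup>2) ^ 56) ^ k"
    by (simp only: power_mult[symmetric] mult.commute)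
  also have "(10 / K\<^sup>2) ^ 56 = 10 ^ 56 / K ^ 112"
  proof -
    have "(K\<^sup>2) ^ 56 = K ^ 112" by (simp flip: power_mult)
    then show ?thesis by (simp only: power_divide)
  qed
  finally show ?thesis .
qed

lemma big_step_prob:
  assumes K: "0 < K"
  shows "prob (big_step K n m l i j c) \<le> step_const / K ^ 112 * (1 / 8) ^ Suc l"
proof -
  let ?t = "real n + dyadic (Suc l) i" and ?s = "real n + dyadic l (i div 2)"
  let ?x = "real_of_int m + dyadic (Suc l) j" and ?y = "real_of_int m + dyadic l (j div 2)"
  let ?v = "\<integral>\<omega>. (V ?t ?x c \<omega> - V ?s ?y c \<omega>)\<^sup>2 \<partial>M"
  let ?a = "K * (9 / 10) ^ Suc l"
  define b :: real where "b = 1 / 2 ^ Suc l"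
  have b0: "0 \<le> b" by (simp add: b_def)
  have b1: "b \<le> 1" using one_le_power[of "2::real" "Suc l"] by (simp add: b_def divide_le_eq_1 del: power_Suc)
  \<comment> \<open>Time and space are refined at the same rate, so the temporal part
    \<open>sqrt b\<close> of the increment bound dominates the spatial part.\<close>
  have bs: "b \<le> sqrt b"
    using mult_left_mono[OF b1 b0] by (intro real_le_rsqrt) (simp add: power2_eq_square)
  have "?v \<le> 5 * (\<bar>?x - ?y\<bar> + sqrt (?t - ?s))"
    by (rule V_increment_le) (use dyadic_step(1)[of l i] in auto)
  also have "\<dots> \<le> 5 * (b + sqrt b)"
    using dyadic_step[of l i] dyadic_step[of l j] unfolding b_def[symmetric]
    by (intro mult_left_mono add_mono real_sqrt_le_mono) auto
  also have "\<dots> \<le> 10 * sqrt b" using bs by simp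
  finally have v: "?v \<le> 10 * sqrt b" .
  have a0: "0 < ?a" using K by simp
  have "prob (big_step K n m l i j c) \<le> fact (2 * 56) * (?v / ?a\<^sup>2) ^ 56"
    unfolding big_step_def
    by (rule centered_gaussian_tail[OF V_increment_gaussian a0]) auto
  also have "\<dots> \<le> fact (2 * 56) * (10 * sqrt b / ?a\<^sup>2) ^ 56"
    using v by (intro mult_left_mono power_mono divide_right_mono divide_nonneg_nonneg) auto
  also have "\<dots> = fact (2 * 56) * (10 ^ 56 / K ^ 112 * ((1 / sqrt 2 / (9 / 10)\<^sup>2) ^ 56) ^ Suc l)"
    unfolding b_def step_power_eq ..
  also have "\<dots> \<le> fact (2 * 56) * (10 ^ 56 / K ^ 112 * (1 / 8) ^ Suc l)"
    using K by (intro mult_left_mono power_mono step_ratio_le) auto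
  also have "\<dots> = step_const / K ^ 112 * (1 / 8) ^ Suc l"
  proof -
    have "(2 * 56 :: nat) = 112" by simp
    then show ?thesis unfolding step_const_def
        by (simp only: times_divide_eq_left times_divide_eq_right mult.assoc)
  qed
  finally show ?thesis .
qed

text \<open>Outside this event some coordinate at the corner is at least \<open>1 + 10 * K\<close>,
  while the increments along any chain from the corner sum to less than \<open>10 * K\<close>; that
  coordinate therefore stays at least 1 in the whole box.\<close>

definition bad_box :: "real \<Rightarrow> nat \<Rightarrow> int \<Rightarrow> 'w set" where
  "bad_box K n m = {\<omega> \<in> space M. \<forall>c. \<bar>V (real n) (real_of_int m) c \<omega>\<bar> < 1 + 10 * K} \<union>
     (\<Union>l. \<Union>i<2 ^ Suc l. \<Union>j<2 ^ Suc l. \<Union>c. big_step K n m l i j c)"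

lemma corner_sets[measurable]: "{\<omega> \<in> space M. \<forall>c. \<bar>V (real n) x c \<omega>\<bar> < K} \<in> sets M"
proof -
  have [measurable]: "V (real n) x c \<in> borel_measurable M" for c by (rule V_measurable) simp
  show ?thesis by measurable
qed

lemma big_steps_level_sets: "(\<Union>i<2 ^ Suc l. \<Union>j<2 ^ Suc l. \<Union>c. big_step K n m l i j c) \<in> sets M"
  by (intro sets.finite_UN big_step_sets) simp_all

lemma big_steps_sets: "(\<Union>l. \<Union>i<2 ^ Suc l. \<Union>j<2 ^ Suc l. \<Union>c. big_step K n m l i j c) \<in> sets M"
  by (rule sets.countable_UN) (use big_steps_level_sets in auto)

lemma bad_box_sets[measurable]: "bad_box K n m \<in> sets M"
  unfolding bad_box_def by (intro sets.Un corner_sets big_steps_sets)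

lemma big_step_union_prob:
  assumes K: "0 < K"
  shows "prob (\<Union>l. \<Union>i<2 ^ Suc l. \<Union>j<2 ^ Suc l. \<Union>c. big_step K n m l i j c)
    \<le> real CARD('d) * (step_const / K ^ 112)"
proof -
  let ?C = "step_const / K ^ 112 :: real"
  let ?S = "\<lambda>l. (\<Union>i<2 ^ Suc l. \<Union>j<2 ^ Suc l. \<Union>c. big_step K n m l i j c)"
  have C0: "0 \<le> ?C" using K step_const_pos by simp
  have S: "?S l \<in> sets M" for l by (rule big_steps_level_sets)
  have Sp: "prob (?S l) \<le> real CARD('d) * ?C * (1 / 2) ^ Suc l" for l
  proof -
    have "prob (?S l) \<le> (\<Sum>i<2 ^ Suc l. prob (\<Union>j<2 ^ Suc l. \<Union>c. big_step K n m l i j c))"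
      by (rule finite_measure_subadditive_finite) (auto intro!: sets.finite_UN)
    also have "\<dots> \<le> (\<Sum>i<(2::nat) ^ Suc l. \<Sum>j<(2::nat) ^ Suc l. prob (\<Union>c. big_step K n m l i j c))"
      by (intro sum_mono finite_measure_subadditive_finite) (auto intro!: sets.finite_UN)
    also have "\<dots> \<le> (\<Sum>i<(2::nat) ^ Suc l. \<Sum>j<(2::nat) ^ Suc l. \<Sum>c\<in>(UNIV::'d set). prob (big_step K n
        m l i j c))"
      by (intro sum_mono finite_measure_subadditive_finite) auto
    also have "\<dots> \<le> (\<Sum>i<(2::nat) ^ Suc l. \<Sum>j<(2::nat) ^ Suc l. \<Sum>c\<in>(UNIV::'d set). ?C * (1 / 8) ^ Suc l)"
      by (intro sum_mono big_step_prob[OF K])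
    also have "\<dots> = real CARD('d) * ?C * (2 ^ Suc l * 2 ^ Suc l * (1 / 8) ^ Suc l)"
      by (simp only: sum_constant card_lessThan of_nat_power of_nat_numeral mult_ac)
    also have "(2 ^ Suc l * 2 ^ Suc l * (1 / 8) ^ Suc l) = (1 / 2 :: real) ^ Suc l"
      by (simp only: power_mult_distrib[symmetric]) simp
    finally show ?thesis .
  qed
  have "(\<lambda>l. (1 / 2 :: real) ^ Suc l) sums 1" using power_half_series .
  then have sm: "(\<lambda>l. real CARD('d) * ?C * (1 / 2) ^ Suc l) sums (real CARD('d) * ?C * 1)" by (rule sums_mult)
  have sp: "summable (\<lambda>l. prob (?S l))"
    by (rule summable_comparison_test'[OF sums_summable[OF sm], of 0]) (use Sp in auto)
  have "prob (\<Union>l. ?S l) \<le> (\<Sum>l. prob (?S l))"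
    by (rule finite_measure_subadditive_countably) (use S sp in auto)
  also have "\<dots> \<le> (\<Sum>l. real CARD('d) * ?C * (1 / 2) ^ Suc l)"
    by (rule suminf_le[OF Sp sp sums_summable[OF sm]])
  also have "\<dots> = real CARD('d) * ?C" using sums_unique[OF sm, symmetric] by (simp only: mult_1_right)
  finally show ?thesis .
qed

text \<open>The point (t, x) is approached by rounding down to dyadics. Rounding at level l is
  halving the index of level l + 1, so the approximations form a chain in the sense of
  \<open>big_step\<close>; continuity carries the bound to the limit. The box is half-open, so that
  indices at level l stay below \<open>2 ^ l\<close>.\<close>

lemma box_escape:
  assumes cont: "continuous_on ({0..} \<times> UNIV) (\<lambda>(t, x). f t x)"
    and eq: "\<And>n m l i j c. f (real n + dyadic l i) (real_of_int m + dyadic l j) $ c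
        = V (real n + dyadic l i) (real_of_int m + dyadic l j) c \<omega>"
    and \<omega>: "\<omega> \<in> space M" "\<omega> \<notin> bad_box K n m" and K: "0 < K"
    and t: "real n \<le> t" "t < real n + 1" and x: "real_of_int m \<le> x" "x < real_of_int m + 1"
  shows "f t x \<notin> box_nbhd 1"
proof -
  define a where "a l = nat \<lfloor>2 ^ l * (t - real n)\<rfloor>" for l
  define b where "b l = nat \<lfloor>2 ^ l * (x - real_of_int m)\<rfloor>" for l
  have floor_props: "nat \<lfloor>2 ^ l * z\<rfloor> < 2 ^ l" "nat \<lfloor>2 ^ Suc l * z\<rfloor> div 2 = nat \<lfloor>2 ^ l * z\<rfloor>"
    "\<bar>dyadic l (nat \<lfloor>2 ^ l * z\<rfloor>) - z\<bar> \<le> (1 / 2) ^ l" "nat \<lfloor>2 ^ 0 * z\<rfloor> = 0"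
    if z: "0 \<le> z" "z < 1" for z :: real and l
  proof -
    have z2: "0 \<le> 2 ^ l * z" "2 ^ l * z < 2 ^ l" using z by auto
    then have "\<lfloor>2 ^ l * z\<rfloor> < 2 ^ l" by (simp add: floor_less_iff)
    then show "nat \<lfloor>2 ^ l * z\<rfloor> < 2 ^ l" using z2 by (simp add: nat_less_iff)
    show "nat \<lfloor>2 ^ 0 * z\<rfloor> = 0" using z by (simp add: floor_eq_iff)
    have "\<lfloor>2 ^ Suc l * z\<rfloor> div 2 = \<lfloor>2 ^ Suc l * z / real_of_int 2\<rfloor>"
      using floor_divide_real_eq_div[of 2 "2 ^ Suc l * z"] by simp
    then have "\<lfloor>2 ^ Suc l * z\<rfloor> div 2 = \<lfloor>2 ^ l * z\<rfloor>" by simp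
    then show "nat \<lfloor>2 ^ Suc l * z\<rfloor> div 2 = nat \<lfloor>2 ^ l * z\<rfloor>"
        by (metis nat_div_distrib' nat_numeral zero_le_numeral)
    have "real (nat \<lfloor>2 ^ l * z\<rfloor>) = real_of_int \<lfloor>2 ^ l * z\<rfloor>" using z2 by simp
    then have "dyadic l (nat \<lfloor>2 ^ l * z\<rfloor>) - z = (real_of_int \<lfloor>2 ^ l * z\<rfloor> - 2 ^ l * z) / 2 ^ l"
      by (simp add: dyadic_def diff_divide_distrib)
    moreover have "\<bar>real_of_int \<lfloor>2 ^ l * z\<rfloor> - 2 ^ l * z\<bar> \<le> 1" using floor_correct[of "2 ^ l * z"] by linarith
    ultimately show "\<bar>dyadic l (nat \<lfloor>2 ^ l * z\<rfloor>) - z\<bar> \<le> (1 / 2) ^ l"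
      by (simp add: abs_divide power_one_over divide_right_mono)
  qed
  have tz: "0 \<le> t - real n" "t - real n < 1" and xz: "0 \<le> x - real_of_int m" "x - real_of_int m < 1"
      using t x by auto
  define P where "P l c = f (real n + dyadic l (a l)) (real_of_int m + dyadic l (b l)) $ c" for l c
  have step: "\<bar>P (Suc l) c - P l c\<bar> < K * (9 / 10) ^ Suc l" for l c
  proof -
    have "\<omega> \<notin> big_step K n m l (a (Suc l)) (b (Suc l)) c"
      using \<omega>(2) floor_props(1)[OF tz, of "Suc l"] floor_props(1)[OF xz, of "Suc l"]
      unfolding bad_box_def a_def b_def by blast
    then show ?thesis
      using \<omega>(1) floor_props(2)[OF tz, of l] floor_props(2)[OF xz, of l]
      unfolding big_step_def P_def eq a_def b_def by (simp add: not_le)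
  qed
  have tele: "\<bar>P l c - P 0 c\<bar> \<le> 10 * K * (1 - (9 / 10) ^ l)" for l c
  proof (induction l)
    case (Suc l)
    have "10 * K * (1 - (9 / 10) ^ l) + K * (9 / 10) ^ Suc l \<le> 10 * K * (1 - (9 / 10) ^ Suc l)"
      using K by (simp add: algebra_simps)
    then show ?case using Suc step[of l c] by linarith
  qed simp
  have P0: "P 0 c = V (real n) (real_of_int m) c \<omega>" for c
    using eq[of n 0 0 m 0 c] floor_props(4)[OF tz] floor_props(4)[OF xz]
        by (simp add: P_def a_def b_def dyadic_def)
  obtain c where c: "1 + 10 * K \<le> \<bar>V (real n) (real_of_int m) c \<omega>\<bar>"
    using \<omega> unfolding bad_box_def by (auto simp: not_less)
  have ge: "1 \<le> \<bar>P l c\<bar>" for l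
  proof -
    have "10 * K * (1 - (9 / 10) ^ l) \<le> 10 * K" using K by simp
    then show ?thesis using tele[of l c] c unfolding P0 by linarith
  qed
  have lim: "(\<lambda>l. (real n + dyadic l (a l), real_of_int m + dyadic l (b l))) \<longlonglongrightarrow> (t, x)"
  proof (rule tendsto_Pair)
    have "(\<lambda>l. dyadic l (nat \<lfloor>2 ^ l * z\<rfloor>) - z) \<longlonglongrightarrow> 0" if "0 \<le> z" "z < 1" for z
      by (rule Lim_null_comparison[OF always_eventually LIMSEQ_realpow_zero[of "1/2"]]) (use
          floor_props(3)[OF that] in auto)
    from this[OF tz] this[OF xz]
    show "(\<lambda>l. real n + dyadic l (a l)) \<longlonglongrightarrow> t" "(\<lambda>l. real_of_int m + dyadic l (b l)) \<longlonglongrightarrow> x"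
      unfolding a_def b_def by (auto intro!: LIM_zero_cancel simp: algebra_simps)
  qed
  have "(\<lambda>l. (\<lambda>(t, x). f t x) (real n + dyadic l (a l), real_of_int m + dyadic l (b l)))
      \<longlonglongrightarrow> (\<lambda>(t, x). f t x) (t, x)"
    by (rule continuous_on_tendsto_compose[OF cont lim]) (use t in auto)
  then have "(\<lambda>l. P l c) \<longlonglongrightarrow> f t x $ c" unfolding P_def by (auto intro: tendsto_vec_nth)
  then have "(\<lambda>l. \<bar>P l c\<bar>) \<longlonglongrightarrow> \<bar>f t x $ c\<bar>" by (rule tendsto_rabs)
  then have "1 \<le> \<bar>f t x $ c\<bar>" by (rule LIMSEQ_le_const) (use ge in auto)
  then show ?thesis unfolding box_nbhd_def by (auto simp: not_less)
qed

section \<open>Summation over all boxes\<close>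

definition radius :: "nat \<Rightarrow> int \<Rightarrow> real" where
  "radius n m = 1 + \<bar>real_of_int m\<bar> + sqrt (real n)"

lemma radius_pos: "0 < radius n m"
  unfolding radius_def by (intro add_pos_nonneg) auto

text \<open>The exponent 1/28 leaves room on both sides: \<open>K ^ 112 = R ^ 4\<close> and
  \<open>(K\<^sup>2 / R) powr (7/2) = R powr (- 13/4)\<close>, while summability only needs an exponent below -3.\<close>
lemma bad_box_prob:
  assumes d: "7 \<le> CARD('d)"
  obtains C where "0 \<le> C" and "\<And>n m. 1 \<le> n \<Longrightarrow> prob (bad_box (radius n m powr (1 / 28)) n m)
      \<le> C * radius n m powr (- (13 / 4))"
proof -
  \<comment> \<open>From \<open>1 + 10 * K \<le> 11 * K\<close> comes 121; replacing the distance by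
    \<open>R / 2\<close> doubles 42 to 84.\<close>
  define C1 :: real where "C1 = (84 * 121) powr (7 / 2)"
  define C2 :: real where "C2 = real CARD('d) * step_const"
  have C: "0 \<le> C1" "0 \<le> C2" using step_const_pos by (auto simp: C1_def C2_def)
  have "prob (bad_box (radius n m powr (1 / 28)) n m) \<le> (C1 + C2) * radius n m powr (- (13 / 4))"
      if n: "1 \<le> n" for n m
  proof -
    define R where "R = radius n m"
    define K where "K = R powr (1 / 28)"
    have sn: "1 \<le> sqrt (real n)" using n by simp
    have R: "1 \<le> R" unfolding R_def radius_def using sn by simp
    have K: "1 \<le> K" unfolding K_def using R by (intro ge_one_powr_ge_zero) auto
    have K0: "0 < K" using K by simp
    have "R \<le> 2 * (\<bar>real_of_int m\<bar> + sqrt (real n))"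
      unfolding R_def radius_def using sn abs_ge_zero[of "real_of_int m"] by argo
    then have half: "R / 2 \<le> \<bar>real_of_int m\<bar> + sqrt (real n)" by simp
    have "prob {\<omega> \<in> space M. \<forall>c. \<bar>V (real n) (real_of_int m) c \<omega>\<bar> < 1 + 10 * K}
        \<le> (42 * (1 + 10 * K)\<^sup>2 / (\<bar>real_of_int m\<bar> + sqrt (real n))) powr (7 / 2)"
      using n K by (intro V_small_prob d) auto
    also have "\<dots> \<le> (84 * 121 * (K\<^sup>2 / R)) powr (7 / 2)"
    proof (rule powr_mono2)
      have "42 * (1 + 10 * K)\<^sup>2 / (\<bar>real_of_int m\<bar> + sqrt (real n)) \<le> 42 * (11 * K)\<^sup>2 / (R / 2)"
        using K R half by (intro frac_le mult_left_mono power_mono) auto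
      also have "\<dots> = 84 * 121 * (K\<^sup>2 / R)" by (simp add: power_mult_distrib)
      finally show "42 * (1 + 10 * K)\<^sup>2 / (\<bar>real_of_int m\<bar> + sqrt (real n)) \<le> 84 * 121 * (K\<^sup>2 / R)" .
    qed (use sn in auto)
    also have "\<dots> = C1 * (K\<^sup>2 / R) powr (7 / 2)" unfolding C1_def using R by (subst powr_mult) auto
    also have "K\<^sup>2 / R = R powr (- (13 / 14))"
    proof -
      have "K\<^sup>2 = R powr (1 / 14)" unfolding K_def using R by (simp add: powr_powr flip: powr_numeral)
      moreover have "R powr (- (13 / 14)) = R powr (1 / 14) / R powr 1"
        using powr_diff[of R "1 / 14" 1] by simp
      ultimately show ?thesis using R by simp
    qed
    also have "(R powr (- (13 / 14))) powr (7 / 2) = R powr (- (13 / 4))" by (simp add: powr_powr)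
    finally have p1: "prob {\<omega> \<in> space M. \<forall>c. \<bar>V (real n) (real_of_int m) c \<omega>\<bar> < 1 + 10 * K}
        \<le> C1 * R powr (- (13 / 4))" .
    have "prob (\<Union>l. \<Union>i<2 ^ Suc l. \<Union>j<2 ^ Suc l. \<Union>c. big_step K n m l i j c)
        \<le> real CARD('d) * (step_const / K ^ 112)"
      by (rule big_step_union_prob[OF K0])
    also have "\<dots> = C2 * (1 / K ^ 112)" by (simp add: C2_def)
    also have "1 / K ^ 112 = R powr (- 4)"
    proof -
      have "K ^ 112 = K powr 112" using K0 by (simp add: powr_numeral)
      also have "\<dots> = R powr 4" unfolding K_def by (simp add: powr_powr)
      finally show ?thesis by (simp add: powr_minus_divide)
    qed
    also have "C2 * R powr (- 4) \<le> C2 * R powr (- (13 / 4))" using R C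
        by (intro mult_left_mono powr_mono) auto
    finally have p2: "prob (\<Union>l. \<Union>i<2 ^ Suc l. \<Union>j<2 ^ Suc l. \<Union>c. big_step K n m l i j c)
        \<le> C2 * R powr (- (13 / 4))" .
    have "prob (bad_box K n m) \<le> prob {\<omega> \<in> space M. \<forall>c. \<bar>V (real n) (real_of_int m) c \<omega>\<bar> < 1 + 10 * K} +
        prob (\<Union>l. \<Union>i<2 ^ Suc l. \<Union>j<2 ^ Suc l. \<Union>c. big_step K n m l i j c)"
      unfolding bad_box_def by (intro measure_Un_le corner_sets big_steps_sets)
    also have "\<dots> \<le> (C1 + C2) * R powr (- (13 / 4))" using p1 p2 by (simp add: algebra_simps)
    finally show ?thesis by (simp add: K_def R_def)
  qed
  then show ?thesis using C by (intro that[of "C1 + C2"]) auto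
qed

text \<open>The radius dominates both \<open>1 + \<bar>m\<bar>\<close> and \<open>sqrt n\<close>.
  Writing 13/4 = 13/12 + 13/6, the power 13/6 of \<open>sqrt n\<close> is the power 13/12 of n, so
  both directions are summable: time counts twice in the parabolic dimension 3.\<close>

lemma radius_powr_le:
  assumes "1 \<le> n"
  shows "radius n m powr (- (13 / 4)) \<le> (1 + \<bar>real_of_int m\<bar>) powr (- (13 / 12)) * real n powr (- (13 / 12))"
proof -
  let ?A = "1 + \<bar>real_of_int m\<bar>" and ?B = "sqrt (real n)"
  have B: "0 < ?B" using assms by simp
  have R: "?A \<le> radius n m" "?B \<le> radius n m" unfolding radius_def using B by auto
  have "radius n m powr (- (13 / 4)) = radius n m powr (- (13 / 12)) * radius n m powr (- (13 / 6))"
    by (simp flip: powr_add)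
  also have "\<dots> \<le> ?A powr (- (13 / 12)) * ?B powr (- (13 / 6))"
    using R B by (intro mult_mono powr_mono2') auto
  also have "?B powr (- (13 / 6)) = real n powr (- (13 / 12))"
    using assms by (simp add: powr_half_sqrt[symmetric] powr_powr)
  finally show ?thesis .
qed

text \<open>Since the positions in a recurrence sequence are arbitrary, each event for
  Borel-Cantelli must cover an entire time slab: the bad boxes with all spatial indices are united
  first, and the probabilities of these unions are summable over n.\<close>

lemma not_recurrent_AE:
  assumes U: "pinned_string_version M U0 W U" and d: "7 \<le> CARD('d)"
  shows "AE \<omega> in M. \<not> recurrent (U \<omega>)"
proof -
  obtain C where C: "0 \<le> C" and bad: "\<And>n m. 1 \<le> n \<Longrightarrow> prob (bad_box (radius n m powr (1 / 28)) n m)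
      \<le> C * radius n m powr (- (13 / 4))"
    using bad_box_prob[OF d] by blast
  define E where "E n m = bad_box (radius n m powr (1 / 28)) n m" for n m
  \<comment> \<open>All integers are reached by j and -j; counting 0 twice only costs in the
    constant.\<close>
  define A where "A n = (\<Union>j::nat. E n (int j) \<union> E n (- int j))" for n
  have Es[measurable]: "E n m \<in> sets M" for n m by (simp add: E_def)
  have As: "A n \<in> sets M" for n unfolding A_def by measurable
  define s :: "nat \<Rightarrow> real" where "s j = (1 + real j) powr (- (13 / 12))" for j
  have ssum: "summable s"
  proof -
    have "summable (\<lambda>j. real (Suc j) powr (- (13 / 12)))"
      using summable_real_powr_iff[of "- (13 / 12)"] by (subst summable_Suc_iff) simp
    then show ?thesis by (simp add: s_def[abs_def] add.commute)
  qed
  have nsum: "summable (\<lambda>n. real n powr (- (13 / 12)))" using summable_real_powr_iff[of "- (13 / 12)"] by simp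
  have Ap: "prob (A n) \<le> 2 * C * suminf s * real n powr (- (13 / 12))" if n: "1 \<le> n" for n
  proof -
    let ?q = "real n powr (- (13 / 12))"
    have e: "prob (E n m) \<le> C * ((1 + \<bar>real_of_int m\<bar>) powr (- (13 / 12)) * ?q)" for m
      unfolding E_def using bad[OF n, of m] mult_left_mono[OF radius_powr_le[OF n, of m] C] by linarith
    have b: "prob (E n (int j) \<union> E n (- int j)) \<le> 2 * C * ?q * s j" for j
    proof -
      have "prob (E n (int j) \<union> E n (- int j)) \<le> prob (E n (int j)) + prob (E n (- int j))"
        by (rule measure_Un_le) auto
      also have "\<dots> \<le> 2 * C * ?q * s j" using e[of "int j"] e[of "- int j"] by (simp add: s_def mult_ac)
      finally show ?thesis .
    qed
    have sb: "summable (\<lambda>j. 2 * C * ?q * s j)" by (intro summable_mult ssum)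
    have sp: "summable (\<lambda>j. prob (E n (int j) \<union> E n (- int j)))"
      by (rule summable_comparison_test'[OF sb, of 0]) (use b in auto)
    have "prob (A n) \<le> (\<Sum>j. prob (E n (int j) \<union> E n (- int j)))"
      unfolding A_def by (rule finite_measure_subadditive_countably) (use sp in auto)
    also have "\<dots> \<le> (\<Sum>j. 2 * C * ?q * s j)" by (rule suminf_le[OF b sp sb])
    also have "\<dots> = 2 * C * ?q * suminf s" by (rule suminf_mult[OF ssum])
    finally show ?thesis by (simp add: mult_ac)
  qed
  have "summable (\<lambda>n. prob (A n))"
    by (rule summable_comparison_test'[OF summable_mult[OF nsum, of "2 * C
        * suminf s"], of 1]) (use Ap in auto)
  then have "AE \<omega> in M. \<forall>\<^sub>F n in sequentially. \<omega> \<in> space M - A n"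
    by (intro borel_cantelli_AE1 As) (auto simp: less_top[symmetric])
  \<comment> \<open>Agreement with \<open>V\<close> on the countable dyadic set suffices, since
    continuity of the given string extends the conclusion to all points.\<close>
  moreover have "AE \<omega> in M. \<forall>n m l i j. \<forall>c. U \<omega> (real n + dyadic l i) (real_of_int m
      + dyadic l j) $ c = V (real n + dyadic l i) (real_of_int m + dyadic l j) c \<omega>"
  proof -
    have "AE \<omega> in M. U \<omega> (real n + dyadic l i) (real_of_int m + dyadic l j) $ c
        = V (real n + dyadic l i) (real_of_int m + dyadic l j) c \<omega>" for n l i j c m
      using V_AE[OF U, of "real n + dyadic l i" "real_of_int m + dyadic l j"] by (auto elim: eventually_mono)
    then show ?thesis by (simp add: AE_all_countable)
  qed
  moreover have "AE \<omega> in M. continuous_on ({0..} \<times> UNIV) (\<lambda>(t, x). U \<omega> t x)"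
    using U by (simp add: pinned_string_version_def)
  ultimately show ?thesis using AE_space
  proof eventually_elim
    case (elim \<omega>)
    obtain n0 where n0: "\<And>n. n0 \<le> n \<Longrightarrow> \<omega> \<notin> A n"
      using elim(1) by (auto simp: eventually_sequentially)
    \<comment> \<open>From some time on the string avoids the box of size 1 at every position, which
      contradicts recurrence already for \<delta> = 1.\<close>
    have esc: "U \<omega> t x \<notin> box_nbhd 1" if t: "real n0 \<le> t" for t x
    proof -
      define n where "n = nat \<lfloor>t\<rfloor>"
      define m where "m = \<lfloor>x\<rfloor>"
      have t0: "0 \<le> t" using t by (rule order_trans[rotated]) simp
      have n: "real n \<le> t" "t < real n + 1" unfolding n_def using t0 by (auto simp: of_nat_nat)
      have "n0 \<le> n" unfolding n_def using t by (simp add: le_nat_floor)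
      then have "\<omega> \<notin> A n" by (rule n0)
      then have "\<omega> \<notin> E n (int (nat \<bar>m\<bar>))" "\<omega> \<notin> E n (- int (nat \<bar>m\<bar>))" unfolding A_def by blast+
      then have "\<omega> \<notin> E n m" by (cases "0 \<le> m") auto
      then have bb: "\<omega> \<notin> bad_box (radius n m powr (1 / 28)) n m" by (simp add: E_def)
      have rp: "0 < radius n m" by (rule radius_pos)
      show ?thesis
        by (rule box_escape[OF elim(3) _ elim(4) bb]) (use elim(2) n rp in \<open>auto simp: m_def\<close>)
    qed
    show ?case
    proof
      assume "recurrent (U \<omega>)"
      then obtain xs ts :: "nat \<Rightarrow> real" where ts: "filterlim ts at_top sequentially" "\<And>n. U \<omega> (ts n)
          (xs n) \<in> box_nbhd 1"
        unfolding recurrent_def by (meson zero_less_one)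
      have "\<forall>\<^sub>F k in sequentially. real n0 \<le> ts k" using ts(1) by (simp add: filterlim_at_top)
      then obtain k where "real n0 \<le> ts k" by (auto simp: eventually_sequentially)
      then show False using esc ts(2) by blast
    qed
  qed
qed

end

theorem theorem3:
  fixes M :: "'w measure"
    and F :: "real \<Rightarrow> 'w set set"
    and W :: "'d::finite \<Rightarrow> (real \<times> real \<Rightarrow> real) \<Rightarrow> 'w \<Rightarrow> real"
    and U0 :: "'w \<Rightarrow> real \<Rightarrow> real ^ 'd"
    and U :: "'w \<Rightarrow> real \<Rightarrow> real \<Rightarrow> real ^ 'd"
  assumes "prob_space M"
    and "adapted_white_noise M F W"
    and "two_sided_BM M U0"
    and "sigma_U0 M U0 \<subseteq> F 0"
    and "prob_space.indep_set M (sigma_U0 M U0) (sigma_W M W (\<lambda>f. True))"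
    and "pinned_string_version M U0 W U"
  shows "(CARD('d) \<le> 6 \<longrightarrow> (AE \<omega> in M. recurrent (U \<omega>))) \<and>
         (CARD('d) \<ge> 7 \<longrightarrow> (AE \<omega> in M. \<not> recurrent (U \<omega>)))"
proof -
  interpret prob_space M by fact
  interpret noise_and_bm M W U0
    by unfold_locales (use assms in \<open>auto simp: adapted_white_noise_def\<close>)
  show ?thesis
    using recurrent_AE[OF assms(6)] not_recurrent_AE[OF assms(6)] by blast
qed

end
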